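(* Fix a prime $p \geq 3$. For $n \geq 1$, let $t_n$ be the rank of $\widetilde{H}_{n-2}(\mathcal{T}_n(\mathbb{Q})/\Gamma_n(p))$. Then $t_1 = 1$ and $$t_n = \left(\frac{p-3}{2} + \left(\frac{p-1}{2}\right)\cdot p^{n-1}\right) t_{n-1} + \frac{(p-1)(p-3)}{4} \sum_{k=1}^{n-2} p^k \cdot |\mathrm{Gr}_k(\mathbb{F}_p^{n-1})| \cdot t_k\, t_{n-k-1}$$ for all $n \geq 2$.
   Context: $\Gamma_n(p)$ is the kernel of the reduction map $\mathrm{SL}_n(\mathbb{Z}) \to \mathrm{SL}_n(\mathbb{Z}/p)$. $\mathcal{T}_n(\mathbb{Q})$ is the Tits building: the simplicial complex whose $k$-simplices are flags $0 \subsetneq V_0 \subsetneq \cdots \subsetneq V_k \subsetneq \mathbb{Q}^n$ of subspaces; $\Gamma_n(p)$ acts on it via $\Gamma_n(p) \subset \mathrm{SL}_n(\mathbb{Q})$. $\widetilde{H}$ denotes reduced homology with integer coefficients, with the convention $\widetilde{H}_{-1}(\emptyset) = \mathbb{Z}$. $\mathrm{Gr}_k(V)$ is the set of $k$-dimensional subspaces of $V$, and $|S|$ is the cardinality of a set $S$. *)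

theory Defs
  imports
    "HOL-Algebra.Free_Abelian_Groups"
    "HOL-Number_Theory.Residues"
    "HOL-Library.Extended_Nat"
    "Jordan_Normal_Form.VS_Connect"
    "Jordan_Normal_Form.Determinant"
begin

section \<open>Rank of an abelian group\<close>

definition int_independent :: "('a, 'b) monoid_scheme \<Rightarrow> 'a set \<Rightarrow> bool" where
  "int_independent G B \<longleftrightarrow> finite B \<and> B \<subseteq> carrier G \<and>
    (\<forall>c :: 'a \<Rightarrow> int. finprod G (\<lambda>b. b [^]\<^bsub>G\<^esub> c b) B = \<one>\<^bsub>G\<^esub> \<longrightarrow> (\<forall>b\<in>B. c b = 0))"

definition abelian_rank :: "('a, 'b) monoid_scheme \<Rightarrow> enat" where
  "abelian_rank G = Sup {enat (card B) |B. int_independent G B}"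


section \<open>Reduced homology of an augmented semisimplicial set\<close>

text \<open>
  Here \<open>X k\<close> is the set of \<open>k\<close>-simplices for \<open>k \<ge> -1\<close>, where \<open>X (-1)\<close> consists of the
  empty simplex, and \<open>d i\<close> omits the \<open>i\<close>-th vertex of an ordered simplex. In degree
  \<open>0\<close> the boundary map is the augmentation, so the empty complex has reduced homology
  \<open>\<int>\<close> in degree \<open>-1\<close>.
\<close>

definition simplicial_boundary ::
    "(nat \<Rightarrow> 's \<Rightarrow> 's) \<Rightarrow> int \<Rightarrow> ('s \<Rightarrow>\<^sub>0 int) \<Rightarrow> ('s \<Rightarrow>\<^sub>0 int)" where
  "simplicial_boundary d k =
    frag_extend (\<lambda>\<sigma>. \<Sum>i<nat (k + 1). frag_cmul ((-1) ^ i) (frag_of (d i \<sigma>)))"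

definition reduced_simplicial_homology ::
    "(int \<Rightarrow> 's set) \<Rightarrow> (nat \<Rightarrow> 's \<Rightarrow> 's) \<Rightarrow> int \<Rightarrow> ('s \<Rightarrow>\<^sub>0 int) set monoid" where
  "reduced_simplicial_homology X d k =
    subgroup_generated (free_Abelian_group (X k))
      (kernel (free_Abelian_group (X k)) (free_Abelian_group (X (k - 1))) (simplicial_boundary d k))
    Mod (simplicial_boundary d (k + 1) ` carrier (free_Abelian_group (X (k + 1))))"


section \<open>The Tits building and its quotient by a congruence subgroup\<close>

definition congruence_subgroup :: "nat \<Rightarrow> nat \<Rightarrow> int mat set" where
  "congruence_subgroup n p =
    {A \<in> carrier_mat n n. det A = 1 \<and> map_mat (\<lambda>a. a mod int p) A = 1\<^sub>m n}"

definition proper_subspaces :: "nat \<Rightarrow> rat vec set set" where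
  "proper_subspaces n =
    {V. subspace class_ring V (module_vec TYPE(rat) n) \<and> V \<noteq> {0\<^sub>v n} \<and> V \<noteq> carrier_vec n}"

text \<open>A \<open>k\<close>-simplex is a flag with \<open>k + 1\<close> members, listed in increasing order.\<close>

definition tits_simplices :: "nat \<Rightarrow> int \<Rightarrow> rat vec set list set" where
  "tits_simplices n k =
    {F. set F \<subseteq> proper_subspaces n \<and> sorted_wrt (\<subset>) F \<and> int (length F) = k + 1}"

definition flag_face :: "nat \<Rightarrow> 'a list \<Rightarrow> 'a list" where
  "flag_face i F = take i F @ drop (Suc i) F"

definition flag_act :: "int mat \<Rightarrow> rat vec set list \<Rightarrow> rat vec set list" where
  "flag_act A = map ((`) (\<lambda>v. map_mat rat_of_int A *\<^sub>v v))"

definition flag_orbit :: "nat \<Rightarrow> nat \<Rightarrow> rat vec set list \<Rightarrow> rat vec set list set" where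
  "flag_orbit n p F = (\<lambda>A. flag_act A F) ` congruence_subgroup n p"

text \<open>
  The action preserves dimensions of subspaces, hence the order of the vertices of each
  simplex, so the quotient complex has the orbits of simplices as its simplices, and the
  face maps of the building descend to them.
\<close>

definition quotient_simplices :: "nat \<Rightarrow> nat \<Rightarrow> int \<Rightarrow> rat vec set list set set" where
  "quotient_simplices n p k = flag_orbit n p ` tits_simplices n k"

definition quotient_face :: "nat \<Rightarrow> rat vec set list set \<Rightarrow> rat vec set list set" where
  "quotient_face i = (`) (flag_face i)"

definition tits_quotient_homology ::
    "nat \<Rightarrow> nat \<Rightarrow> int \<Rightarrow> (rat vec set list set \<Rightarrow>\<^sub>0 int) set monoid" where
  "tits_quotient_homology n p =
    reduced_simplicial_homology (quotient_simplices n p) quotient_face"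


section \<open>Grassmannians over finite fields\<close>

definition coord_space :: "('a, 'b) ring_scheme \<Rightarrow> nat \<Rightarrow> ('a, nat \<Rightarrow> 'a) module" where
  "coord_space R m =
    \<lparr>carrier = {..<m} \<rightarrow>\<^sub>E carrier R,
     monoid.mult = undefined,
     one = undefined,
     zero = (\<lambda>i\<in>{..<m}. \<zero>\<^bsub>R\<^esub>),
     add = (\<lambda>u v. \<lambda>i\<in>{..<m}. u i \<oplus>\<^bsub>R\<^esub> v i),
     smult = (\<lambda>a v. \<lambda>i\<in>{..<m}. a \<otimes>\<^bsub>R\<^esub> v i)\<rparr>"

lemma vectorspace_coord_space:
  assumes "field R"
  shows "vectorspace R (coord_space R m)"
proof -
  interpret field R by fact
  have "abelian_group (coord_space R m)"
  proof (rule abelian_groupI)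
    fix x assume "x \<in> carrier (coord_space R m)"
    then show "\<exists>y\<in>carrier (coord_space R m). y \<oplus>\<^bsub>coord_space R m\<^esub> x = \<zero>\<^bsub>coord_space R m\<^esub>"
      by (intro bexI[of _ "\<lambda>i\<in>{..<m}. \<ominus>\<^bsub>R\<^esub> x i"])
         (auto simp: coord_space_def PiE_iff l_neg restrict_def extensional_def)
  qed (auto simp: coord_space_def PiE_iff a_ac restrict_def extensional_def fun_eq_iff)
  then have "Module.module R (coord_space R m)"
    by (intro module.intro module_axioms.intro is_cring)
       (auto simp: coord_space_def PiE_iff l_distr r_distr m_assoc restrict_def extensional_def fun_eq_iff)
  then show ?thesis
    using assms by (simp add: vectorspace_def)
qed

definition grassmannian ::
    "('a, 'b) ring_scheme \<Rightarrow> ('a, 'v, 'c) module_scheme \<Rightarrow> nat \<Rightarrow> 'v set set" where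
  "grassmannian K V k = {W. subspace K W V \<and> vectorspace.dim K (V\<lparr>carrier := W\<rparr>) = k}"

end

theory Submission
  imports Defs
begin

text \<open>
  There are no flags of \<open>n\<close> proper nonzero subspaces of \<open>\<rat>\<^sup>n\<close>, so the homology in degree \<open>n - 2\<close> is the
  group of cycles. Faces of maximal flags with different indices omit different dimensions and never
  cancel. Hence a cycle is an integral function on the orbits of maximal flags whose sum over every
  panel vanishes, a panel being the set of all maximal orbits with a given face that omits one member
  (\<open>abelian_rank_top_homology\<close>).

  The orbits are described modulo \<open>p\<close>. A rational subspace reduces to a subspace of \<open>F\<^sub>p\<^sup>n\<close>, and
  an integral basis of it gives a determinant that is well defined up to sign; this label takes
  \<open>m = (p - 1) / 2\<close> values. Two maximal flags are equivalent if and only if their members have the same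
  reductions and the same labels: the transition matrix between two integral frames is then triangular
  modulo \<open>p\<close> with diagonal entries \<open>\<plusminus>1\<close>, and such a matrix lifts to a triangular integral matrix of
  determinant one (\<open>orbit_of_vertices_eq\<close>). The same holds for flags that omit one dimension
  (\<open>orbit_of_vertices_eq_except\<close>), and every complete flag of \<open>F\<^sub>p\<^sup>n\<close> with arbitrary labels occurs
  (\<open>vertices_surj\<close>). So \<open>t n\<close> is the rank of the group of cycles on complete flags with labels.

  This rank is computed by recursion on the length of an interval of subspaces. Fix a nonzero vector
  \<open>e\<close>. In a flag there is a last member \<open>W\<close> without \<open>e\<close>, which may be \<open>0\<close>, and the next member is
  \<open>W + e\<close>, which may be the whole space. Filter the cycles by the dimension \<open>k\<close> of \<open>W\<close>. On flags with
  the largest occurring \<open>k\<close>, a cycle restricts to a cycle below \<open>W\<close>, an arbitrary function of the label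
  of \<open>W\<close>, a function with sum zero of the label of \<open>W + e\<close>, and a cycle above \<open>W + e\<close>. Conversely each
  such product is the leading term of a cycle; the extension to smaller \<open>k\<close> is the operator \<open>prism\<close>.
  Therefore each \<open>W\<close> contributes \<open>m * t k * (m - 1) * t (n - k - 1)\<close>, where the factor \<open>m * t k\<close> is
  absent for \<open>W = 0\<close> and the factor \<open>(m - 1) * t (n - k - 1)\<close> is absent if \<open>W + e\<close> is the whole space
  (\<open>coordinates_cycles_step\<close>). There are \<open>p\<^sup>k\<close> times as many choices of \<open>W\<close> as subspaces of
  dimension \<open>k\<close> in \<open>F\<^sub>p\<^sup>n\<^sup>-\<^sup>1\<close> (\<open>card_flats_avoiding\<close>, \<open>card_grassmannian\<close>). This is the
  asserted formula.
\<close>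

section \<open>Ranks from coordinate functions\<close>

text \<open>
  Fewer linear conditions than unknowns. The elimination multiplies crosswise instead of dividing, so
  the coefficients stay integral.
\<close>

lemma int_combination_exists:
  fixes M :: "'b \<Rightarrow> 'd \<Rightarrow> int"
  assumes "finite D" "finite B" "card D < card B"
  shows "\<exists>c. (\<exists>b\<in>B. c b \<noteq> 0) \<and> (\<forall>d\<in>D. (\<Sum>b\<in>B. c b * M b d) = 0)"
  using assms
proof (induction D arbitrary: B M rule: finite_induct)
  case empty
  then obtain b where "b \<in> B" by fastforce
  then show ?case by (intro exI[of _ "\<lambda>_. 1"]) auto
next
  case (insert d D)
  show ?case
  proof (cases "\<forall>b\<in>B. M b d = 0")
    case True
    obtain c where "\<exists>b\<in>B. c b \<noteq> 0" "\<forall>d\<in>D. (\<Sum>b\<in>B. c b * M b d) = 0"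
      using insert.IH[of B M] insert.prems insert.hyps by auto
    then show ?thesis using True by (intro exI[of _ c]) auto
  next
    case False
    then obtain p where p: "p \<in> B" "M p d \<noteq> 0" by blast
    \<comment> \<open>Eliminate the column \<open>d\<close> with the pivot row \<open>p\<close>.\<close>
    let ?N = "\<lambda>b d'. M p d * M b d' - M b d * M p d'"
    have "finite (B - {p})" "card D < card (B - {p})"
      using insert.prems insert.hyps p by (simp_all add: less_diff_conv)
    from insert.IH[OF this, of ?N] obtain c where c: "\<exists>b\<in>B - {p}. c b \<noteq> 0" "\<forall>d'\<in>D. (\<Sum>b\<in>B - {p}. c b * ?N b d') = 0"
      by blast
    define c' where "c' b = (if b = p then - (\<Sum>b\<in>B - {p}. c b * M b d) else M p d * c b)" for b
    have "(\<Sum>b\<in>B. c' b * M b d') = (\<Sum>b\<in>B - {p}. c b * ?N b d')" for d'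
    proof -
      have "(\<Sum>b\<in>B. c' b * M b d') = c' p * M p d' + (\<Sum>b\<in>B - {p}. c' b * M b d')"
        using p insert.prems by (subst sum.remove[of _ p]) auto
      also have "(\<Sum>b\<in>B - {p}. c' b * M b d') = (\<Sum>b\<in>B - {p}. M p d * c b * M b d')"
        by (intro sum.cong) (auto simp: c'_def)
      finally show ?thesis
        by (simp add: c'_def algebra_simps sum_subtractf sum_distrib_left sum_distrib_right)
    qed
    moreover have "(\<Sum>b\<in>B - {p}. c b * ?N b d) = 0" by (simp add: mult.commute)
    ultimately have "\<forall>d'\<in>insert d D. (\<Sum>b\<in>B. c' b * M b d') = 0" using c(2) by simp
    moreover have "\<exists>b\<in>B. c' b \<noteq> 0" using c(1) p by (auto simp: c'_def)
    ultimately show ?thesis by blast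
  qed
qed

lemma (in comm_group) additive_finprod_int_pow:
  fixes ev :: "'a \<Rightarrow> int" and c :: "'a \<Rightarrow> int"
  assumes ev: "\<And>x y. x \<in> carrier G \<Longrightarrow> y \<in> carrier G \<Longrightarrow> ev (x \<otimes> y) = ev x + ev y"
    and "finite B" "B \<subseteq> carrier G"
  shows "ev (finprod G (\<lambda>b. b [^] c b) B) = (\<Sum>b\<in>B. c b * ev b)"
proof -
  have one: "ev \<one> = 0" using ev[of \<one> \<one>] by simp
  have inv: "ev (inv x) = - ev x" if "x \<in> carrier G" for x
    using ev[of x "inv x"] that one by simp
  have nat: "ev (x [^] k) = int k * ev x" if "x \<in> carrier G" for x and k :: nat
    using that by (induction k) (simp_all add: one ev algebra_simps)
  have int: "ev (x [^] k) = k * ev x" if "x \<in> carrier G" for x and k :: int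
  proof (cases "k < 0")
    case True
    then have "ev (x [^] k) = ev (inv (x [^] nat (- k)))" by (simp only: int_pow_def2 if_True)
    also have "\<dots> = - (int (nat (- k)) * ev x)" using inv[OF nat_pow_closed[OF that]] nat[OF that] by simp
    finally show ?thesis using True by simp
  next
    case False
    then have "ev (x [^] k) = ev (x [^] nat k)" by (simp only: int_pow_def2 if_False)
    also have "\<dots> = int (nat k) * ev x" using nat[OF that] .
    finally show ?thesis using False by simp
  qed
  show ?thesis
    using assms(2,3)
  proof (induction B rule: finite_induct)
    case (insert b B)
    then have "(\<lambda>b. b [^] c b) \<in> B \<rightarrow> carrier G" "b \<in> carrier G" by auto
    then show ?case using insert by (simp add: ev int)
  qed (simp add: one)
qed

text \<open>
  The values \<open>ev d x\<close> embed the group into \<open>\<int>\<^sup>D\<close>. The dual elements are independent, and more than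
  \<open>card D\<close> elements satisfy a relation because a relation only has to hold after each \<open>ev d\<close>.
\<close>

theorem (in comm_group) abelian_rank_eq_card:
  fixes ev :: "'d \<Rightarrow> 'a \<Rightarrow> int"
  assumes D: "finite D"
    and ev: "\<And>d x y. d \<in> D \<Longrightarrow> x \<in> carrier G \<Longrightarrow> y \<in> carrier G \<Longrightarrow> ev d (x \<otimes> y) = ev d x + ev d y"
    and inj: "\<And>x. x \<in> carrier G \<Longrightarrow> (\<And>d. d \<in> D \<Longrightarrow> ev d x = 0) \<Longrightarrow> x = \<one>"
    and dual: "\<And>d. d \<in> D \<Longrightarrow> \<exists>x\<in>carrier G. \<forall>e\<in>D. ev e x = of_bool (e = d)"
  shows "abelian_rank G = enat (card D)"
proof -
  have upper: "card B \<le> card D" if B: "int_independent G B" for B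
  proof (rule ccontr)
    assume "\<not> card B \<le> card D"
    then obtain c where c: "\<exists>b\<in>B. c b \<noteq> 0" "\<forall>d\<in>D. (\<Sum>b\<in>B. c b * ev d b) = 0"
      using int_combination_exists[OF D, of B "\<lambda>b d. ev d b"] B by (auto simp: int_independent_def)
    have "finite B" "B \<subseteq> carrier G" using B by (auto simp: int_independent_def)
    then have "ev d (finprod G (\<lambda>b. b [^] c b) B) = 0" if "d \<in> D" for d
      using additive_finprod_int_pow[OF ev[OF that], of B c] c(2) that by simp
    moreover have "finprod G (\<lambda>b. b [^] c b) B \<in> carrier G"
      using \<open>B \<subseteq> carrier G\<close> by (intro finprod_closed) auto
    ultimately have "finprod G (\<lambda>b. b [^] c b) B = \<one>" by (intro inj)
    then show False using B c(1) by (auto simp: int_independent_def)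
  qed
  obtain b where b: "\<And>d. d \<in> D \<Longrightarrow> b d \<in> carrier G \<and> (\<forall>e\<in>D. ev e (b d) = of_bool (e = d))"
    using dual by metis
  have inj_b: "inj_on b D"
  proof (rule inj_onI)
    fix d e assume *: "d \<in> D" "e \<in> D" "b d = b e"
    then have "ev d (b d) = of_bool (d = d)" "ev d (b e) = of_bool (d = e)"
      using b[OF *(1)] b[OF *(2)] *(1) by blast+
    then show "d = e" using *(3) by (cases "d = e") auto
  qed
  have "int_independent G (b ` D)"
    unfolding int_independent_def
  proof (intro conjI allI impI ballI)
    show "finite (b ` D)" "b ` D \<subseteq> carrier G" using D b by auto
    fix c :: "'a \<Rightarrow> int" and y
    assume one: "finprod G (\<lambda>b. b [^] c b) (b ` D) = \<one>" and "y \<in> b ` D"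
    then obtain d where d: "d \<in> D" "y = b d" by auto
    have "ev d \<one> = 0" using ev[OF d(1), of \<one> \<one>] by simp
    then have "0 = (\<Sum>x\<in>b ` D. c x * ev d x)"
      using additive_finprod_int_pow[OF ev[OF d(1)], of "b ` D" c] one D b by auto
    also have "\<dots> = (\<Sum>e\<in>D. c (b e) * ev d (b e))" using inj_b by (simp add: sum.reindex)
    also have "\<dots> = (\<Sum>e\<in>D. if d = e then c (b e) else 0)"
      using b d by (intro sum.cong) auto
    also have "\<dots> = c y" using D d by simp
    finally show "c y = 0" by simp
  qed
  moreover have "card (b ` D) = card D" using inj_b by (rule card_image)
  ultimately have "enat (card D) \<in> {enat (card B) |B. int_independent G B}" by force
  moreover have "x \<le> enat (card D)" if "x \<in> {enat (card B) |B. int_independent G B}" for x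
    using that upper by auto
  ultimately show ?thesis
    unfolding abelian_rank_def by (intro antisym Sup_least Sup_upper)
qed

section \<open>Coordinates of groups of integral functions\<close>

text \<open>
  If \<open>C\<close> is a group, then restriction to \<open>D\<close> is an isomorphism from \<open>C\<close> onto \<open>\<int>\<^sup>D\<close>. Such sets of
  positions replace bases: products of coordinate sets serve for tensor products, and the rank of
  \<open>C\<close> is the cardinality of \<open>D\<close>.
\<close>

definition coordinates :: "('x \<Rightarrow> int) set \<Rightarrow> 'x set \<Rightarrow> bool" where
  "coordinates C D \<longleftrightarrow> finite D \<and>
    (\<forall>f\<in>C. (\<forall>d\<in>D. f d = 0) \<longrightarrow> (\<forall>x. f x = 0)) \<and>
    (\<forall>d\<in>D. \<exists>b\<in>C. \<forall>x\<in>D. b x = of_bool (x = d))"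

lemma coordinates_finite: "coordinates C D \<Longrightarrow> finite D"
  by (simp add: coordinates_def)

lemma coordinates_zero: "coordinates C D \<Longrightarrow> f \<in> C \<Longrightarrow> (\<And>d. d \<in> D \<Longrightarrow> f d = 0) \<Longrightarrow> f x = 0"
  by (auto simp: coordinates_def)

lemma coordinates_dual:
  "coordinates C D \<Longrightarrow> d \<in> D \<Longrightarrow> \<exists>b\<in>C. \<forall>x\<in>D. b x = of_bool (x = d)"
  by (simp add: coordinates_def)

text \<open>
  A unitriangular system of functions can be made dual to \<open>D\<close>: its entries at lower levels are cleared
  by induction on the level.
\<close>

lemma coordinates_triangular:
  fixes C :: "('x \<Rightarrow> int) set" and level :: "'x \<Rightarrow> nat"
  assumes "finite D"
    and zero: "\<And>f x. f \<in> C \<Longrightarrow> (\<And>d. d \<in> D \<Longrightarrow> f d = 0) \<Longrightarrow> f x = 0"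
    and diff: "\<And>f g a. f \<in> C \<Longrightarrow> g \<in> C \<Longrightarrow> (\<lambda>x. f x - a * g x) \<in> C"
    and tri: "\<And>d. d \<in> D \<Longrightarrow> \<exists>b\<in>C. \<forall>x\<in>D. level d \<le> level x \<longrightarrow> b x = of_bool (x = d)"
  shows "coordinates C D"
proof -
  have "\<exists>b\<in>C. \<forall>x\<in>D. b x = of_bool (x = d)" if "d \<in> D" for d
    using that
  proof (induction "level d" arbitrary: d rule: less_induct)
    case less
    obtain b where b: "b \<in> C" "\<forall>x\<in>D. level d \<le> level x \<longrightarrow> b x = of_bool (x = d)"
      using tri[OF less.prems] by blast
    \<comment> \<open>Values at positions of lower level are removed with the dual functions already found.\<close>
    define S where "S = {x \<in> D. level x < level d}"
    have "\<exists>f\<in>C. \<forall>x\<in>D. f x = (if x \<in> T then 0 else b x)" if "T \<subseteq> S" for T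
      using finite_subset[OF that] \<open>finite D\<close> that unfolding S_def
    proof (induction T rule: infinite_finite_induct)
      case empty
      then show ?case using b(1) by auto
    next
      case (insert y T)
      then obtain f where f: "f \<in> C" "\<forall>x\<in>D. f x = (if x \<in> T then 0 else b x)" by auto
      obtain c where c: "c \<in> C" "\<forall>x\<in>D. c x = of_bool (x = y)"
        using less.hyps[of y] insert.prems by auto
      show ?case
        using diff[OF f(1) c(1), of "b y"] f(2) c(2) insert.hyps
        by (intro bexI[of _ "\<lambda>x. f x - b y * c x"]) auto
    qed auto
    from this[of S] obtain f where f: "f \<in> C" "\<forall>x\<in>D. f x = (if x \<in> S then 0 else b x)" by auto
    moreover have "f x = of_bool (x = d)" if "x \<in> D" for x
      using f(2) b(2) that by (auto simp: S_def)
    ultimately show ?case by blast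
  qed
  then show ?thesis using assms(1) zero unfolding coordinates_def by blast
qed

section \<open>Flats and flags with labels\<close>

text \<open>
  The model is the set \<open>S\<close> of all subspaces of a finite vector space over a field with \<open>q\<close> elements,
  where \<open>adj U x\<close> is spanned by \<open>U\<close> and \<open>x\<close>. Dimensions are measured by cardinalities, which makes
  intervals of subspaces as easy to handle as the whole space.
\<close>

locale flats =
  fixes q :: nat and S :: "'a set set" and adj :: "'a set \<Rightarrow> 'a \<Rightarrow> 'a set"
  assumes finite_points: "finite (\<Union>S)"
    and q_gt_1: "q > 1"
    and nonempty: "U \<in> S \<Longrightarrow> U \<noteq> {}"
    and adj_flat: "U \<in> S \<Longrightarrow> x \<in> \<Union>S \<Longrightarrow> adj U x \<in> S"
    and adj_sup: "U \<in> S \<Longrightarrow> x \<in> \<Union>S \<Longrightarrow> U \<subseteq> adj U x"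
    and adj_mem: "U \<in> S \<Longrightarrow> x \<in> \<Union>S \<Longrightarrow> x \<in> adj U x"
    and adj_least: "U \<in> S \<Longrightarrow> X \<in> S \<Longrightarrow> U \<subseteq> X \<Longrightarrow> x \<in> X \<Longrightarrow> adj U x \<subseteq> X"
    and card_adj: "U \<in> S \<Longrightarrow> x \<in> \<Union>S \<Longrightarrow> x \<notin> U \<Longrightarrow> card (adj U x) = q * card U"
begin

lemma finite_flat: "U \<in> S \<Longrightarrow> finite U"
  using finite_points by (meson Union_upper finite_subset)

lemma finite_S: "finite S"
  using finite_points by (simp add: finite_UnionD)

lemma card_flat_pos: "U \<in> S \<Longrightarrow> card U > 0"
  using finite_flat nonempty by (simp add: card_gt_0_iff)

lemma flat_eqI: "U \<in> S \<Longrightarrow> X \<in> S \<Longrightarrow> U \<subseteq> X \<Longrightarrow> card X \<le> card U \<Longrightarrow> U = X"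
  by (simp add: card_seteq finite_flat)

text \<open>
  Adjoining points one at a time leads from \<open>A\<close> to \<open>B\<close>.
\<close>

lemma card_flat_dvd:
  assumes "A \<in> S" "B \<in> S" "A \<subseteq> B"
  shows "\<exists>r. card B = q ^ r * card A"
  using assms
proof (induction "card B - card A" arbitrary: A rule: less_induct)
  case less
  show ?case
  proof (cases "A = B")
    case True
    then show ?thesis by (intro exI[of _ 0]) simp
  next
    case False
    then obtain x where x: "x \<in> B" "x \<notin> A" using less by blast
    then have xS: "x \<in> \<Union>S" using less by blast
    have *: "adj A x \<in> S" "adj A x \<subseteq> B" "card (adj A x) = q * card A"
      using less x xS adj_flat adj_least card_adj by auto
    have "card A < q * card A" using card_flat_pos[of A] q_gt_1 less by simp
    moreover have "card (adj A x) \<le> card B" using * less finite_flat card_mono by metis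
    ultimately have "card B - card (adj A x) < card B - card A" using * by linarith
    from less.hyps[OF this] * less obtain r where "card B = q ^ r * card (adj A x)" by auto
    then show ?thesis using * by (intro exI[of _ "Suc r"]) simp
  qed
qed

text \<open>
  The covering relation: \<open>A\<close> is a hyperplane of \<open>B\<close>.
\<close>

definition cov :: "'a set \<Rightarrow> 'a set \<Rightarrow> bool" where
  "cov A B \<longleftrightarrow> A \<in> S \<and> B \<in> S \<and> A \<subseteq> B \<and> card B = q * card A"

lemma cov_adj: "U \<in> S \<Longrightarrow> x \<in> \<Union>S \<Longrightarrow> x \<notin> U \<Longrightarrow> cov U (adj U x)"
  by (simp add: cov_def adj_flat adj_sup card_adj)

lemma cov_eq_adj:
  assumes "cov U X" "x \<in> X" "x \<notin> U"
  shows "X = adj U x"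
proof -
  have U: "U \<in> S" "X \<in> S" "U \<subseteq> X" "x \<in> \<Union>S" "card X = q * card U"
    using assms by (auto simp: cov_def)
  have "adj U x = X"
    using U assms(2,3) by (intro flat_eqI adj_flat adj_least) (simp_all add: card_adj)
  then show ?thesis by simp
qed

lemma cov_adj_adj:
  assumes "cov A y" "cov y x" "e \<in> x" "e \<notin> y"
  shows "cov (adj A e) x"
proof -
  have "e \<in> \<Union>S" "e \<notin> A" "A \<subseteq> x" using assms by (auto simp: cov_def)
  then show ?thesis using assms by (auto simp: cov_def adj_flat card_adj adj_least)
qed

end

text \<open>
  Every member of a flag carries a label from \<open>L\<close>, which does not affect incidence. The label \<open>l0\<close> is
  an arbitrary base point.
\<close>

locale labelled_flats = flats q S adj
  for q :: nat and S :: "'a set set" and adj :: "'a set \<Rightarrow> 'a \<Rightarrow> 'a set" +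
  fixes L :: "'l set" and l0 :: 'l
  assumes finite_L: "finite L" and l0_mem: "l0 \<in> L"
begin

abbreviation "V \<equiv> S \<times> L"

lemma finite_V: "finite V" using finite_S finite_L by simp

text \<open>
  The list \<open>xs\<close> consists of the inner members of a maximal chain from \<open>A\<close> to \<open>B\<close>. The two ends are not
  listed and have no label.
\<close>

fun flag :: "'a set \<Rightarrow> ('a set \<times> 'l) list \<Rightarrow> 'a set \<Rightarrow> bool" where
  "flag A [] B \<longleftrightarrow> cov A B"
| "flag A (x # xs) B \<longleftrightarrow> cov A (fst x) \<and> snd x \<in> L \<and> flag (fst x) xs B"

lemma flag_append: "flag A (ys @ x # zs) B \<longleftrightarrow> flag A ys (fst x) \<and> snd x \<in> L \<and> flag (fst x) zs B"
  by (induction ys arbitrary: A) auto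

lemma flag_flats: "flag A xs B \<Longrightarrow> A \<in> S \<and> B \<in> S \<and> A \<subseteq> B"
  by (induction xs arbitrary: A) (auto simp: cov_def)

lemma flag_card: "flag A xs B \<Longrightarrow> card B = q ^ Suc (length xs) * card A"
  by (induction xs arbitrary: A) (auto simp: cov_def)

lemma flag_length: 
  assumes "flag A xs B" "flag A ys B" shows "length xs = length ys"
  using flag_card[OF assms(1)] flag_card[OF assms(2)] q_gt_1 card_flat_pos[of A] flag_flats[OF assms(1)]
  by simp

lemma flag_set: "flag A xs B \<Longrightarrow> x \<in> set xs \<Longrightarrow> x \<in> V \<and> A \<subseteq> fst x \<and> fst x \<subseteq> B"
proof (induction xs arbitrary: A)
  case (Cons a xs)
  then show ?case using flag_flats[of "fst a" xs B] 
    by (cases a) (fastforce simp: cov_def)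
qed auto

lemma finite_flags: "finite {xs. flag A xs B}"
proof (cases "\<exists>xs. flag A xs B")
  case True
  then obtain ys where "flag A ys B" by blast
  then have "{xs. flag A xs B} \<subseteq> {xs. set xs \<subseteq> V \<and> length xs = length ys}"
    using flag_set flag_length by blast
  then show ?thesis using finite_lists_length_eq[OF finite_V] finite_subset by blast
qed auto

text \<open>
  Half-open flags, for cutting a flag in two: the list of \<open>up A ys W\<close> includes the upper end \<open>W\<close> with a
  label, and that of \<open>down X zs B\<close> includes the lower end \<open>X\<close>. They are empty if the two ends agree.
\<close>

definition up :: "'a set \<Rightarrow> ('a set \<times> 'l) list \<Rightarrow> 'a set \<Rightarrow> bool" where
  "up A ys W \<longleftrightarrow> (ys = [] \<and> A = W) \<or> (ys \<noteq> [] \<and> fst (last ys) = W \<and> snd (last ys) \<in> L \<and> flag A (butlast ys) W)"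

definition down :: "'a set \<Rightarrow> ('a set \<times> 'l) list \<Rightarrow> 'a set \<Rightarrow> bool" where
  "down X zs B \<longleftrightarrow> (zs = [] \<and> X = B) \<or> (zs \<noteq> [] \<and> fst (hd zs) = X \<and> snd (hd zs) \<in> L \<and> flag X (tl zs) B)"

lemma up_Nil [simp]: "up A [] W \<longleftrightarrow> A = W" by (simp add: up_def)
lemma down_Nil [simp]: "down X [] B \<longleftrightarrow> X = B" by (simp add: down_def)
lemma down_Cons: "down X (z # zs) B \<longleftrightarrow> fst z = X \<and> snd z \<in> L \<and> flag X zs B" by (simp add: down_def)

lemma up_Cons: "up A (y # ys) W \<longleftrightarrow> cov A (fst y) \<and> snd y \<in> L \<and> up (fst y) ys W"
  by (cases ys) (auto simp: up_def)

lemma up_snoc: "up A (ys @ [y]) W \<longleftrightarrow> fst y = W \<and> snd y \<in> L \<and> flag A ys W"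
  by (simp add: up_def)

lemma flag_up_imp_down:
  "up A ys W \<Longrightarrow> flag A (ys @ z # zs) B \<Longrightarrow> down (fst z) (z # zs) B \<and> cov W (fst z)"
  by (induction ys arbitrary: A) (auto simp: up_Cons down_Cons)

lemma flag_down_imp_up:
  "down X zs B \<Longrightarrow> flag A (ys @ [y] @ zs) B \<Longrightarrow> up A (ys @ [y]) (fst y) \<and> cov (fst y) X"
  by (cases zs) (auto simp: down_Cons up_snoc flag_append)

lemma up_unique: "up A ys W \<Longrightarrow> up A ys W' \<Longrightarrow> W = W'"
  by (auto simp: up_def)

lemma up_flag: "up A ys W \<Longrightarrow> cov W X \<Longrightarrow> flag A ys X"
  by (induction ys arbitrary: A) (auto simp: up_Cons)

lemma flag_down: "flag A xs X \<Longrightarrow> down X zs B \<Longrightarrow> flag A (xs @ zs) B"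
  by (cases zs) (auto simp: down_Cons flag_append)

lemma up_down_flag: "up A ys W \<Longrightarrow> cov W X \<Longrightarrow> down X zs B \<Longrightarrow> flag A (ys @ zs) B"
  using up_flag flag_down by blast

lemma up_sup: "A \<in> S \<Longrightarrow> up A ys W \<Longrightarrow> W \<in> S \<and> A \<subseteq> W"
  by (induction ys arbitrary: A) (auto simp: up_Cons cov_def)

lemma down_sup: "B \<in> S \<Longrightarrow> down X zs B \<Longrightarrow> X \<in> S \<and> X \<subseteq> B"
  by (cases zs) (auto simp: down_Cons dest: flag_flats)

lemma up_set: "up A ys W \<Longrightarrow> y \<in> set ys \<Longrightarrow> A \<subseteq> fst y \<and> fst y \<subseteq> W"
proof (induction ys arbitrary: A)
  case (Cons a ys)
  then show ?case using up_sup[of "fst a" ys W] by (force simp: up_Cons cov_def)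
qed auto

lemma down_set: "down X zs B \<Longrightarrow> z \<in> set zs \<Longrightarrow> X \<subseteq> fst z"
  using flag_set[of X "tl zs" B z] by (cases zs) (auto simp: down_Cons)

lemma up_length:
  assumes "A \<in> S" "up A ys W" shows "card W = q ^ length ys * card A"
  using assms
proof (induction ys arbitrary: A)
  case (Cons y ys) then show ?case by (auto simp: up_Cons cov_def)
qed auto

text \<open>
  The sums run over all flats with labels instead of one panel, which makes no difference for
  functions that vanish off the flags.
\<close>

definition cycles :: "'a set \<Rightarrow> 'a set \<Rightarrow> (('a set \<times> 'l) list \<Rightarrow> int) set" where
  "cycles A B = {f. (\<forall>xs. \<not> flag A xs B \<longrightarrow> f xs = 0) \<and> (\<forall>ys zs. (\<Sum>x\<in>V. f (ys @ x # zs)) = 0)}"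

text \<open>
  No condition is imposed at the last member, so the label of \<open>W\<close> is free.
\<close>

definition up_cycles :: "'a set \<Rightarrow> 'a set \<Rightarrow> (('a set \<times> 'l) list \<Rightarrow> int) set" where
  "up_cycles A W = {f. (\<forall>xs. \<not> up A xs W \<longrightarrow> f xs = 0) \<and>
     (\<forall>ys zs. zs \<noteq> [] \<longrightarrow> (\<Sum>x\<in>V. f (ys @ x # zs)) = 0)}"

text \<open>
  All first members have the flat \<open>X\<close>, so the condition at the first member says that the sum over its
  label vanishes.
\<close>

definition down_cycles :: "'a set \<Rightarrow> 'a set \<Rightarrow> (('a set \<times> 'l) list \<Rightarrow> int) set" where
  "down_cycles X B = {f. (\<forall>xs. \<not> down X xs B \<longrightarrow> f xs = 0) \<and> (\<forall>ys zs. (\<Sum>x\<in>V. f (ys @ x # zs)) = 0)}"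

lemma sum_V_fiber: 
  fixes f :: "'a set \<times> 'l \<Rightarrow> int"
  assumes "W \<in> S" "\<And>x. x \<in> V \<Longrightarrow> fst x \<noteq> W \<Longrightarrow> f x = 0"
  shows "(\<Sum>x\<in>V. f x) = (\<Sum>l\<in>L. f (W, l))"
proof -
  have "(\<Sum>x\<in>V. f x) = (\<Sum>x\<in>Pair W ` L. f x)"
    using assms by (intro sum.mono_neutral_right finite_V) (force intro!: assms(2))+
  also have "\<dots> = (\<Sum>l\<in>L. f (W, l))" by (subst sum.reindex) (auto simp: inj_on_def)
  finally show ?thesis .
qed

text \<open>
  The last label is free, which gives a factor \<open>card L\<close>.
\<close>

lemma coordinates_up_cycles:
  assumes A: "A \<in> S" "A \<noteq> W" and D: "coordinates (cycles A W) D" "D \<subseteq> {xs. flag A xs W}"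
  shows "coordinates (up_cycles A W) ((\<lambda>(ys, l). ys @ [(W, l)]) ` (D \<times> L))"
  unfolding coordinates_def
proof (intro conjI ballI allI impI)
  show "finite ((\<lambda>(ys, l). ys @ [(W, l)]) ` (D \<times> L))"
    using coordinates_finite[OF D(1)] finite_L by simp
next
  fix f xs assume f: "f \<in> up_cycles A W"
    and z: "\<forall>d\<in>(\<lambda>(ys, l). ys @ [(W, l)]) ` (D \<times> L). f d = 0"
  show "f xs = 0"
  proof (cases "up A xs W")
    case True
    then obtain ys l where xs: "xs = ys @ [(W, l)]" "l \<in> L" "flag A ys W"
      using A by (cases xs rule: rev_cases) (auto simp: up_snoc)
    have "(\<lambda>ys. f (ys @ [(W, l)])) \<in> cycles A W"
      using f xs by (auto simp: cycles_def up_cycles_def up_snoc)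
    from coordinates_zero[OF D(1) this] show ?thesis using xs z by auto
  qed (use f in \<open>auto simp: up_cycles_def\<close>)
next
  fix d assume "d \<in> (\<lambda>(ys, l). ys @ [(W, l)]) ` (D \<times> L)"
  then obtain ys l where d: "d = ys @ [(W, l)]" "ys \<in> D" "l \<in> L" by auto
  obtain b where b: "b \<in> cycles A W" "\<forall>x\<in>D. b x = of_bool (x = ys)"
    using coordinates_dual[OF D(1) d(2)] by blast
  define f where "f = (\<lambda>xs. if xs \<noteq> [] \<and> last xs = (W, l) then b (butlast xs) else 0)"
  have "(\<Sum>x\<in>V. f (us @ x # vs)) = 0" if "vs \<noteq> []" for us vs
  proof -
    have "(\<Sum>x\<in>V. b (us @ x # butlast vs)) = 0" using b by (auto simp: cycles_def)
    then show ?thesis using that by (cases "last vs = (W, l)") (simp_all add: f_def butlast_append)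
  qed
  moreover have "f xs = 0" if "\<not> up A xs W" for xs
    using that b d(3) by (auto simp: f_def cycles_def up_def)
  ultimately have "f \<in> up_cycles A W" by (auto simp: up_cycles_def)
  moreover have "\<forall>x\<in>(\<lambda>(ys, l). ys @ [(W, l)]) ` (D \<times> L). f x = of_bool (x = d)"
    using b(2) d by (auto simp: f_def)
  ultimately show "\<exists>b\<in>up_cycles A W. \<forall>x\<in>(\<lambda>(ys, l). ys @ [(W, l)]) ` (D \<times> L). b x = of_bool (x = d)"
    by blast
qed

lemma coordinates_up_cycles_refl: "coordinates (up_cycles A A) {[]}"
  unfolding coordinates_def
proof (intro conjI ballI allI impI)
  fix f xs assume "f \<in> up_cycles A A" "\<forall>d\<in>{[]}. f d = 0"
  moreover have "\<not> up A xs A" if "xs \<noteq> []"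
  proof
    assume "up A xs A"
    then have "flag A (butlast xs) A" using that by (simp add: up_def)
    from flag_card[OF this] flag_flats[OF this] show False using card_flat_pos[of A] q_gt_1 by auto
  qed
  ultimately show "f xs = 0" by (cases "xs = []") (auto simp: up_cycles_def)
next
  fix d :: "('a set \<times> 'l) list" assume "d \<in> {[]}"
  then show "\<exists>b\<in>up_cycles A A. \<forall>x\<in>{[]}. b x = of_bool (x = d)"
    by (intro bexI[of _ "\<lambda>xs. of_bool (xs = [])"]) (auto simp: up_cycles_def)
qed auto

text \<open>
  The values at the first label \<open>l0\<close> are determined by those at the other labels, which leaves a factor
  \<open>card L - 1\<close>.
\<close>

lemma coordinates_down_cycles:
  assumes B: "X \<in> S" "X \<noteq> B" and D: "coordinates (cycles X B) D" "D \<subseteq> {xs. flag X xs B}"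
  shows "coordinates (down_cycles X B) ((\<lambda>(l, zs). (X, l) # zs) ` ((L - {l0}) \<times> D))"
  unfolding coordinates_def
proof (intro conjI ballI allI impI)
  show "finite ((\<lambda>(l, zs). (X, l) # zs) ` ((L - {l0}) \<times> D))"
    using coordinates_finite[OF D(1)] finite_L by simp
next
  fix f xs assume f: "f \<in> down_cycles X B"
    and z: "\<forall>d\<in>(\<lambda>(l, zs). (X, l) # zs) ` ((L - {l0}) \<times> D). f d = 0"
  have 1: "f ((X, l) # zs) = 0" if "l \<in> L - {l0}" for l zs
  proof -
    have "(\<Sum>x\<in>V. f (((X, l) # us) @ x # vs)) = 0" for us vs
      using f unfolding down_cycles_def by blast
    then have "(\<lambda>zs. f ((X, l) # zs)) \<in> cycles X B"
      using f that by (auto simp: cycles_def down_cycles_def down_Cons)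
    from coordinates_zero[OF D(1) this] show ?thesis using z that by auto
  qed
  have 2: "f ((X, l0) # zs) = 0" for zs
  proof -
    have "(\<Sum>x\<in>V. f ([] @ x # zs)) = 0" using f unfolding down_cycles_def by blast
    moreover have "(\<Sum>x\<in>V. f (x # zs)) = (\<Sum>l\<in>L. f ((X, l) # zs))"
      using f B by (intro sum_V_fiber) (auto simp: down_cycles_def down_Cons)
    moreover have "(\<Sum>l\<in>L. f ((X, l) # zs)) = f ((X, l0) # zs)"
      using 1 finite_L l0_mem by (subst sum.remove[of _ l0]) auto
    ultimately show ?thesis by simp
  qed
  show "f xs = 0"
  proof (cases "down X xs B")
    case True
    then obtain l zs where "xs = (X, l) # zs" "l \<in> L"
      using B by (cases xs) (auto simp: down_Cons)
    then show ?thesis using 1 2 by (cases "l = l0") auto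
  qed (use f in \<open>auto simp: down_cycles_def\<close>)
next
  fix d assume "d \<in> (\<lambda>(l, zs). (X, l) # zs) ` ((L - {l0}) \<times> D)"
  then obtain zs l where d: "d = (X, l) # zs" "zs \<in> D" "l \<in> L" "l \<noteq> l0" by auto
  obtain b where b: "b \<in> cycles X B" "\<forall>x\<in>D. b x = of_bool (x = zs)"
    using coordinates_dual[OF D(1) d(2)] by blast
  define s where "s = (\<lambda>x. if x = (X, l) then 1 else if x = (X, l0) then - 1 else (0::int))"
  have s: "(\<Sum>x\<in>V. s x) = 0"
  proof -
    have "(\<Sum>x\<in>V. s x) = (\<Sum>x\<in>{(X, l), (X, l0)}. s x)"
      using B d l0_mem by (intro sum.mono_neutral_right finite_V) (auto simp: s_def)
    then show ?thesis using d by (simp add: s_def)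
  qed
  define f where "f = (\<lambda>xs. case xs of [] \<Rightarrow> 0 | x # xs \<Rightarrow> s x * b xs)"
  have "(\<Sum>x\<in>V. f (us @ x # vs)) = 0" for us vs
  proof (cases us)
    case Nil
    then show ?thesis using s by (simp add: f_def flip: sum_distrib_right)
  next
    case (Cons u us')
    have "(\<Sum>x\<in>V. b (us' @ x # vs)) = 0" using b by (auto simp: cycles_def)
    then show ?thesis using Cons by (simp add: f_def flip: sum_distrib_left)
  qed
  moreover have "f xs = 0" if "\<not> down X xs B" for xs
    using that b d l0_mem by (cases xs) (auto simp: f_def s_def down_Cons cycles_def)
  ultimately have "f \<in> down_cycles X B" by (auto simp: down_cycles_def)
  moreover have "\<forall>x\<in>(\<lambda>(l, zs). (X, l) # zs) ` ((L - {l0}) \<times> D). f x = of_bool (x = d)"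
    using b(2) d by (auto simp: f_def s_def)
  ultimately show "\<exists>b\<in>down_cycles X B. \<forall>x\<in>(\<lambda>(l, zs). (X, l) # zs) ` ((L - {l0}) \<times> D). b x = of_bool (x = d)"
    by blast
qed

lemma coordinates_down_cycles_refl: "coordinates (down_cycles B B) {[]}"
  unfolding coordinates_def
proof (intro conjI ballI allI impI)
  fix f xs assume "f \<in> down_cycles B B" "\<forall>d\<in>{[]}. f d = 0"
  moreover have "\<not> down B xs B" if "xs \<noteq> []"
  proof
    assume "down B xs B"
    then have "flag B (tl xs) B" using that by (simp add: down_def)
    from flag_card[OF this] flag_flats[OF this] show False using card_flat_pos[of B] q_gt_1 by auto
  qed
  ultimately show "f xs = 0" by (cases "xs = []") (auto simp: down_cycles_def)
next
  fix d :: "('a set \<times> 'l) list" assume "d \<in> {[]}"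
  then show "\<exists>b\<in>down_cycles B B. \<forall>x\<in>{[]}. b x = of_bool (x = d)"
    by (intro bexI[of _ "\<lambda>xs. of_bool (xs = [])"]) (auto simp: down_cycles_def)
qed auto

end

section \<open>The recursion for cycles\<close>

context labelled_flats begin

text \<open>
  Let \<open>b\<close> be a function on flags from \<open>A\<close> to a flat \<open>W\<close> without \<open>e\<close>, and \<open>X\<close> the span of \<open>W\<close> and \<open>e\<close>.
  The prism extends \<open>b\<close> to flags from \<open>A\<close> to \<open>X\<close>. It agrees with \<open>b\<close> on the flags whose members avoid
  \<open>e\<close>. When the first member contains \<open>e\<close>, it is the span of \<open>A\<close> and \<open>e\<close>, and the value is chosen so
  that it cancels the sum over the rest of the panel, concentrated at the label \<open>l0\<close>. Geometrically
  this is the prism between the flags of \<open>W\<close> and their images under adjoining \<open>e\<close>.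
\<close>

fun prism :: "'a \<Rightarrow> 'a set \<Rightarrow> (('a set \<times> 'l) list \<Rightarrow> int) \<Rightarrow> ('a set \<times> 'l) list \<Rightarrow> int" where
  "prism e A b [] = b []"
| "prism e A b (x # xs) =
     (if \<not> (cov A (fst x) \<and> snd x \<in> L) then 0
      else if e \<notin> fst x then prism e (fst x) (\<lambda>ys. b (x # ys)) xs
      else if snd x = l0 then - (\<Sum>y\<in>{y\<in>V. e \<notin> fst y}. prism e (fst y) (\<lambda>ys. b (y # ys)) xs)
      else 0)"

lemma prism_0: "prism e A (\<lambda>ys. 0) xs = 0"
  by (induction xs arbitrary: A) auto

lemma prism_sum: "prism e A (\<lambda>ys. \<Sum>i\<in>I. b i ys) xs = (\<Sum>i\<in>I. prism e A (b i) xs)"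
proof (induction xs arbitrary: A b)
  case (Cons x xs)
  have "(\<Sum>y\<in>{y\<in>V. e \<notin> fst y}. prism e (fst y) (\<lambda>ys. \<Sum>i\<in>I. b i (y # ys)) xs)
      = (\<Sum>i\<in>I. \<Sum>y\<in>{y\<in>V. e \<notin> fst y}. prism e (fst y) (\<lambda>ys. b i (y # ys)) xs)"
    unfolding Cons.IH by (rule sum.swap)
  then show ?case using Cons.IH by (simp add: sum_negf)
qed simp

lemma up_cycles_zero: "b \<in> up_cycles A W \<Longrightarrow> \<not> up A ys W \<Longrightarrow> b ys = 0"
  by (simp add: up_cycles_def)

lemma up_cycles_sum: "b \<in> up_cycles A W \<Longrightarrow> zs \<noteq> [] \<Longrightarrow> (\<Sum>x\<in>V. b (ys @ x # zs)) = 0"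
  by (simp add: up_cycles_def)

lemma up_cycles_Cons: 
  assumes "b \<in> up_cycles A W"
  shows "(\<lambda>ys. b (x # ys)) \<in> up_cycles (fst x) W"
proof -
  have "(\<Sum>y\<in>V. b ((x # ys) @ y # zs)) = 0" if "zs \<noteq> []" for ys zs
    using assms that by (rule up_cycles_sum)
  then show ?thesis using up_cycles_zero[OF assms] by (auto simp: up_cycles_def up_Cons)
qed

lemma up_cycles_not_cov: 
  "b \<in> up_cycles A W \<Longrightarrow> \<not> (cov A (fst x) \<and> snd x \<in> L) \<Longrightarrow> (\<lambda>ys. b (x # ys)) = (\<lambda>ys. 0)"
  by (rule ext) (auto simp: up_Cons intro: up_cycles_zero)

lemma up_cycles_not_avoid: 
  assumes "b \<in> up_cycles A W" "W \<in> S" "e \<notin> W" "e \<in> fst x"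
  shows "(\<lambda>ys. b (x # ys)) = (\<lambda>ys. 0)"
proof (rule ext)
  fix ys show "b (x # ys) = 0"
  proof (rule up_cycles_zero[OF assms(1)])
    show "\<not> up A (x # ys) W" using up_set[of A "x # ys" W x] assms by auto
  qed
qed

text \<open>
  At the first member the sum vanishes by the choice of the value at the span of \<open>A\<close> and \<open>e\<close>. At later
  members it vanishes by induction, because the prism is linear in \<open>b\<close>.
\<close>

lemma sum_prism:
  assumes "b \<in> up_cycles A W" "A \<in> S" "e \<notin> A" "e \<in> \<Union>S"
  shows "(\<Sum>x\<in>V. prism e A b (us @ x # vs)) = 0"
  using assms
proof (induction us arbitrary: A b)
  case Nil
  let ?s = "\<Sum>y\<in>{y\<in>V. e \<notin> fst y}. prism e (fst y) (\<lambda>ys. b (y # ys)) vs"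
  have "(\<Sum>x\<in>V. prism e A b (x # vs)) =
      (\<Sum>x\<in>{x\<in>V. e \<notin> fst x}. prism e A b (x # vs)) + (\<Sum>x\<in>{x\<in>V. e \<in> fst x}. prism e A b (x # vs))"
    using finite_V by (subst sum.union_disjoint[symmetric]) (auto intro!: sum.cong)
  also have "(\<Sum>x\<in>{x\<in>V. e \<notin> fst x}. prism e A b (x # vs)) = ?s"
    using up_cycles_not_cov[OF Nil(1)] by (intro sum.cong) (auto simp: prism_0)
  also have "(\<Sum>x\<in>{x\<in>V. e \<in> fst x}. prism e A b (x # vs)) = (\<Sum>x\<in>{(adj A e, l0)}. prism e A b (x # vs))"
    using finite_V Nil l0_mem cov_eq_adj[of A _ e]
    by (intro sum.mono_neutral_right) (auto simp: adj_mem adj_flat)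
  also have "\<dots> = - ?s"
    using Nil l0_mem by (simp add: adj_mem cov_adj)
  finally show ?case by simp
next
  case (Cons u us)
  have IH: "(\<Sum>x\<in>V. prism e (fst y) (\<lambda>ys. b (y # ys)) (us @ x # vs)) = 0" if "fst y \<in> S" "e \<notin> fst y" for y
    using Cons.IH[OF up_cycles_Cons[OF Cons.prems(1)]] that Cons.prems by blast
  have "(\<Sum>x\<in>V. \<Sum>y\<in>{y\<in>V. e \<notin> fst y}. prism e (fst y) (\<lambda>ys. b (y # ys)) (us @ x # vs)) = 0"
    by (subst sum.swap, intro sum.neutral ballI IH) auto
  moreover have "cov A (fst u) \<Longrightarrow> fst u \<in> S" by (simp add: cov_def)
  ultimately show ?case using IH[of u]
    by (cases "cov A (fst u) \<and> snd u \<in> L"; cases "e \<in> fst u"; cases "snd u = l0")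
      (simp_all add: sum_negf)
qed

text \<open>
  The prism is built without asking that the list is a flag, and the critical lists have a member with
  \<open>e\<close> followed by one without \<open>e\<close>. On these the prism is a sum over a panel of \<open>b\<close>.
\<close>

lemma prism_not_flag:
  assumes "b \<in> up_cycles A W" "cov W X" "e \<in> X" "e \<notin> W" "A \<in> S" "e \<notin> A"
    and "\<not> flag A xs X"
  shows "prism e A b xs = 0"
  using assms
proof (induction xs arbitrary: A b)
  case Nil
  then show ?case using up_cycles_zero[of b A W "[]"] by auto
next
  case (Cons x xs)
  have W: "W \<in> S" "e \<in> \<Union>S" using Cons.prems by (auto simp: cov_def)
  have IH: "prism e (fst y) (\<lambda>ys. b (y # ys)) xs = 0" if "fst y \<in> S" "e \<notin> fst y" "\<not> flag (fst y) xs X" for y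
    using Cons.IH[OF up_cycles_Cons[OF Cons.prems(1)]] that Cons.prems by blast
  have IH0: "prism e (fst y) (\<lambda>ys. b (y # ys)) xs = 0" if "\<not> (cov A (fst y) \<and> snd y \<in> L)" for y
    using up_cycles_not_cov[OF Cons.prems(1) that] by (simp add: prism_0)
  show ?case
  proof (cases "cov A (fst x) \<and> snd x \<in> L")
    case True
    then have xS: "fst x \<in> S" and nf: "\<not> flag (fst x) xs X" using Cons.prems by (auto simp: cov_def)
    show ?thesis
    proof (cases "e \<in> fst x")
      case False
      then show ?thesis using True IH[OF xS False nf] by simp
    next
      case e: True
      have x: "fst x = adj A e" using cov_eq_adj True e Cons.prems by blast
      have "(\<Sum>y\<in>{y\<in>V. e \<notin> fst y}. prism e (fst y) (\<lambda>ys. b (y # ys)) xs) = 0"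
      proof (cases "xs \<noteq> [] \<and> e \<notin> fst (hd xs)")
        case False
        have "prism e (fst y) (\<lambda>ys. b (y # ys)) xs = 0" if y: "y \<in> V" "e \<notin> fst y" for y
        proof (rule ccontr)
          assume *: "prism e (fst y) (\<lambda>ys. b (y # ys)) xs \<noteq> 0"
          then have "cov A (fst y)" and f: "flag (fst y) xs X"
            using IH[of y] IH0[of y] y by (auto simp: mem_Times_iff)
          then have "flag (fst x) xs X"
            unfolding x using cov_adj_adj[of A "fst y" _ e] False y Cons.prems by (cases xs) auto
          then show False using nf by blast
        qed
        then show ?thesis by (intro sum.neutral) auto
      next
        case True
        then obtain x2 xs' where xs: "xs = x2 # xs'" and e2: "e \<notin> fst x2" by (cases xs) auto
        have "prism e (fst y) (\<lambda>ys. b (y # ys)) xs = prism e (fst x2) (\<lambda>ys. b (y # x2 # ys)) xs'" for y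
          using e2 up_cycles_not_cov[OF up_cycles_Cons[OF Cons.prems(1)], of y x2] 
          by (auto simp: xs prism_0)
        then have "(\<Sum>y\<in>{y\<in>V. e \<notin> fst y}. prism e (fst y) (\<lambda>ys. b (y # ys)) xs)
            = (\<Sum>y\<in>{y\<in>V. e \<notin> fst y}. prism e (fst x2) (\<lambda>ys. b (y # x2 # ys)) xs')"
          by simp
        also have "\<dots> = (\<Sum>y\<in>V. prism e (fst x2) (\<lambda>ys. b (y # x2 # ys)) xs')"
        proof (intro sum.mono_neutral_left finite_V ballI)
          fix y assume "y \<in> V - {y\<in>V. e \<notin> fst y}"
          then have "(\<lambda>ys. b (y # ys)) = (\<lambda>ys. 0)"
            using up_cycles_not_avoid[OF Cons.prems(1) W(1), of e y] Cons.prems by auto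
          then have "(\<lambda>ys. b (y # x2 # ys)) = (\<lambda>ys. 0)" by (metis (no_types))
          then show "prism e (fst x2) (\<lambda>ys. b (y # x2 # ys)) xs' = 0" by (simp add: prism_0)
        qed auto
        also have "\<dots> = prism e (fst x2) (\<lambda>ys. \<Sum>y\<in>V. b (y # x2 # ys)) xs'"
          by (rule prism_sum[symmetric])
        also have "(\<lambda>ys. \<Sum>y\<in>V. b (y # x2 # ys)) = (\<lambda>ys. 0)"
          using up_cycles_sum[OF Cons.prems(1), where ys="[]"] by auto
        finally show ?thesis by (simp add: prism_0)
      qed
      then show ?thesis using e by simp
    qed
  qed simp
qed

lemma prism_avoid:
  assumes "b \<in> up_cycles A W" "\<forall>y\<in>set ys. e \<notin> fst y"
  shows "prism e A b ys = b ys"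
  using assms
proof (induction ys arbitrary: A b)
  case (Cons y ys)
  then show ?case
    using up_cycles_Cons[of b A W y] up_cycles_zero[of b A W "y # ys"] by (auto simp: up_Cons)
qed simp

lemma prism_cycle:
  assumes "b \<in> up_cycles A W" "cov W X" "e \<in> X" "e \<notin> W" "A \<in> S" "e \<notin> A"
  shows "prism e A b \<in> cycles A X"
proof -
  have "e \<in> \<Union>S" using assms by (auto simp: cov_def)
  then show ?thesis using assms prism_not_flag sum_prism unfolding cycles_def by blast
qed

lemma cycles_diff: "f \<in> cycles A B \<Longrightarrow> g \<in> cycles A B \<Longrightarrow> (\<lambda>x. f x - a * g x) \<in> cycles A B"
  by (simp add: cycles_def sum_subtractf flip: sum_distrib_left)

text \<open>
  Cut the flag after its last member without \<open>e\<close>.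
\<close>

lemma flag_split:
  assumes "flag A xs B" "e \<in> B" "e \<notin> A"
  shows "\<exists>ys zs W. xs = ys @ zs \<and> up A ys W \<and> e \<notin> W \<and> W \<in> S \<and> cov W (adj W e) \<and> down (adj W e) zs B"
  using assms
proof (induction xs arbitrary: A)
  case Nil
  then have "B = adj A e" "cov A B" using cov_eq_adj by auto
  then show ?case using Nil by (intro exI[of _ "[]"] exI[of _ A]) (auto simp: cov_def)
next
  case (Cons x xs)
  then have c: "cov A (fst x)" "snd x \<in> L" "flag (fst x) xs B" by auto
  show ?case
  proof (cases "e \<in> fst x")
    case True
    then have "fst x = adj A e" using cov_eq_adj c Cons.prems by auto
    then show ?thesis using c Cons.prems
      by (intro exI[of _ "[]"] exI[of _ "x # xs"] exI[of _ A]) (auto simp: down_Cons cov_def)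
  next
    case False
    from Cons.IH[OF c(3) Cons.prems(2) False] obtain ys zs W where
      "xs = ys @ zs" "up (fst x) ys W" "e \<notin> W" "W \<in> S" "cov W (adj W e)" "down (adj W e) zs B" by blast
    then show ?thesis using c
      by (intro exI[of _ "x # ys"] exI[of _ zs] exI[of _ W]) (auto simp: up_Cons)
  qed
qed

lemma split_unique:
  assumes "up A ys W" "down X zs B" "e \<notin> W" "e \<in> X"
    and "up A ys' W'" "down X' zs' B" "e \<notin> W'" "e \<in> X'" "ys @ zs = ys' @ zs'"
  shows "ys = ys'"
proof -
  have *: "takeWhile (\<lambda>x. e \<notin> fst x) (ys @ zs) = ys" 
    if "up A ys W" "down X zs B" "e \<notin> W" "e \<in> X" for ys zs W X
  proof -
    have "\<forall>y\<in>set ys. e \<notin> fst y" "\<forall>z\<in>set zs. e \<in> fst z"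
      using up_set[OF that(1)] down_set[OF that(2)] that by blast+
    then show ?thesis by (cases zs) (simp_all add: takeWhile_tail)
  qed
  show ?thesis using *[OF assms(1-4)] *[OF assms(5-8)] assms(9) by simp
qed

text \<open>
  The positions in \<open>D\<close> pair, for each possible cut \<open>W\<close>, coordinates below and above the cut. A cycle
  that vanishes on \<open>D\<close> is zero by induction on the number of members that contain \<open>e\<close>: once it
  vanishes on all flags with a longer lower part, the sum over the label of the first member above the
  cut is zero, so it restricts to half-open cycles on both sides. The dual functions are products of a
  prism below the cut and a half-open cycle above it. Such a product vanishes on flags with a longer
  lower part, but need not vanish on those with a shorter one, so the system is only triangular.
\<close>

theorem coordinates_cycles_step:
  assumes AB: "A \<in> S" "B \<in> S" "A \<subseteq> B" and e: "e \<in> B" "e \<notin> A"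
    and H: "H = {W \<in> S. A \<subseteq> W \<and> W \<subseteq> B \<and> e \<notin> W}"
    and Y: "\<And>W. W \<in> H \<Longrightarrow> coordinates (up_cycles A W) (Y W) \<and> Y W \<subseteq> {ys. up A ys W}"
    and Z: "\<And>W. W \<in> H \<Longrightarrow> coordinates (down_cycles (adj W e) B) (Z W) \<and> Z W \<subseteq> {zs. down (adj W e) zs B}"
  defines "D \<equiv> (\<Union>W\<in>H. (\<lambda>(ys, zs). ys @ zs) ` (Y W \<times> Z W))"
  shows "coordinates (cycles A B) D" and "D \<subseteq> {xs. flag A xs B}"
    and "card D = (\<Sum>W\<in>H. card (Y W) * card (Z W))"
proof -
  have eS: "e \<in> \<Union>S" using AB e by blast
  have H1: "W \<in> S" "e \<notin> W" "cov W (adj W e)" "e \<in> adj W e" "adj W e \<in> S" if "W \<in> H" for W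
    using that eS H by (auto simp: cov_adj adj_mem adj_flat)
  show sub: "D \<subseteq> {xs. flag A xs B}"
  proof
    fix xs assume "xs \<in> D"
    then obtain W ys zs where "W \<in> H" "xs = ys @ zs" "ys \<in> Y W" "zs \<in> Z W" by (auto simp: D_def)
    then show "xs \<in> {xs. flag A xs B}" using up_down_flag H1 Y Z by blast
  qed
  have finH: "finite H" using H finite_S by auto
  have fin: "finite (Y W)" "finite (Z W)" if "W \<in> H" for W
    using Y[OF that] Z[OF that] coordinates_finite by blast+
  have finD: "finite D" unfolding D_def using finH fin by auto

  have uniq: "W = W' \<and> ys = ys' \<and> zs = zs'"
    if "W \<in> H" "W' \<in> H" "up A ys W" "up A ys' W'" "down (adj W e) zs B" "down (adj W' e) zs' B" "ys @ zs = ys' @ zs'"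
    for W W' ys ys' zs zs'
  proof -
    have "ys = ys'" using split_unique[OF that(3,5) _ _ that(4,6)] H1 that by blast
    then show ?thesis using that up_unique by auto
  qed

  show "card D = (\<Sum>W\<in>H. card (Y W) * card (Z W))"
  proof -
    have "card ((\<lambda>(ys, zs). ys @ zs) ` (Y W \<times> Z W)) = card (Y W) * card (Z W)" if "W \<in> H" for W
    proof (subst card_image)
      show "inj_on (\<lambda>(ys, zs). ys @ zs) (Y W \<times> Z W)"
      proof (rule inj_onI, clarsimp)
        fix ys zs ys' zs' assume "ys \<in> Y W" "zs \<in> Z W" "ys' \<in> Y W" "zs' \<in> Z W" "ys @ zs = ys' @ zs'"
        then show "ys = ys' \<and> zs = zs'" using uniq[OF that that, of ys ys' zs zs'] Y[OF that] Z[OF that] by blast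
      qed
    qed (simp add: card_cartesian_product)
    moreover have "card D = (\<Sum>W\<in>H. card ((\<lambda>(ys, zs). ys @ zs) ` (Y W \<times> Z W)))"
      unfolding D_def
    proof (intro card_UN_disjoint finH ballI impI)
      fix W W' assume "W \<in> H" "W' \<in> H" "W \<noteq> W'"
      then show "(\<lambda>(ys, zs). ys @ zs) ` (Y W \<times> Z W) \<inter> (\<lambda>(ys, zs). ys @ zs) ` (Y W' \<times> Z W') = {}"
        using uniq[of W W'] Y[of W] Y[of W'] Z[of W] Z[of W'] by fastforce
    qed (use fin in auto)
    ultimately show ?thesis by simp
  qed

  show "coordinates (cycles A B) D"
  proof (rule coordinates_triangular[where level = "\<lambda>xs. length (takeWhile (\<lambda>x. e \<notin> fst x) xs)"])
    fix f xs assume f: "f \<in> cycles A B" and fD: "\<And>d. d \<in> D \<Longrightarrow> f d = 0"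
    have f0: "f xs = 0" if "\<not> flag A xs B" for xs using f that by (simp add: cycles_def)
    show "f xs = 0"
    proof (induction "length (filter (\<lambda>x. e \<in> fst x) xs)" arbitrary: xs rule: less_induct)
      case less
      show ?case
      proof (cases "flag A xs B")
        case True
        then obtain ys0 zs0 W where xs: "xs = ys0 @ zs0" "up A ys0 W" "down (adj W e) zs0 B" 
          and W0: "e \<notin> W" "W \<in> S" "cov W (adj W e)"
          using flag_split[OF True e] by metis
        have WH: "W \<in> H"
          using up_sup[OF AB(1) xs(2)] down_sup[OF AB(2) xs(3)] W0 H by (auto simp: cov_def)
        let ?X = "adj W e"
        have all: "\<forall>z\<in>set zs. e \<in> fst z" if "down ?X zs B" for zs
          using down_set[OF that] H1[OF WH] by blast
        have len: "length zs = length zs0" if "up A ys W" "down ?X zs B" for ys zs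
        proof -
          have "flag A (ys @ zs) B" using up_down_flag that W0 by blast
          moreover have "flag A (ys0 @ zs0) B" using True xs by simp
          moreover have "q ^ length ys = q ^ length ys0"
            using up_length[OF AB(1) that(1)] up_length[OF AB(1) xs(2)] card_flat_pos[OF AB(1)] by simp
          ultimately show ?thesis using flag_length[of A "ys @ zs" B "ys0 @ zs0"] q_gt_1 by simp
        qed
        have filt: "length (filter (\<lambda>x. e \<in> fst x) xs) = length zs0"
        proof -
          have "filter (\<lambda>x. e \<in> fst x) ys0 = []"
            using up_set[OF xs(2)] W0 by (auto simp: filter_empty_conv)
          moreover have "filter (\<lambda>x. e \<in> fst x) zs0 = zs0" using all[OF xs(3)] by simp
          ultimately show ?thesis using xs by simp
        qed
        have b: "(\<lambda>zs. if down ?X zs B then f (ys @ zs) else 0) \<in> down_cycles ?X B" (is "?b \<in> _")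
          if ys: "up A ys W" for ys
        proof -
          have "(\<Sum>x\<in>V. ?b (us @ x # vs)) = 0" for us vs
          proof (cases us)
            case Nil
            have "?b (x # vs) = f (ys @ x # vs)" if "x \<in> V" for x
            proof (rule ccontr)
              assume *: "?b (x # vs) \<noteq> f (ys @ x # vs)"
              then have nd: "\<not> down ?X (x # vs) B" and nz: "f (ys @ x # vs) \<noteq> 0" by (auto split: if_splits)
              have fl: "flag A (ys @ x # vs) B" using nz f0 by blast
              from flag_up_imp_down[OF ys this] have d: "down (fst x) (x # vs) B" "cov W (fst x)" by auto
              then have ex: "e \<notin> fst x" using cov_eq_adj[of W "fst x" e] nd W0 by auto
              \<comment> \<open>This flag avoids \<open>e\<close> for one more step, so induction applies to it.\<close>
              have "length (ys @ x # vs) = length (ys0 @ zs0)" using flag_length fl True xs by blast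
              moreover have "length ys = length ys0"
                using up_length[OF AB(1) ys] up_length[OF AB(1) xs(2)] card_flat_pos[OF AB(1)] q_gt_1 by simp
              moreover have "filter (\<lambda>x. e \<in> fst x) ys = []"
                using up_set[OF ys] W0 by (auto simp: filter_empty_conv)
              ultimately have "length (filter (\<lambda>x. e \<in> fst x) (ys @ x # vs)) < length zs0"
                using ex le_imp_less_Suc[OF length_filter_le[of "\<lambda>x. e \<in> fst x" vs]] by simp
              then show False using less.hyps filt nz by auto
            qed
            then have "(\<Sum>x\<in>V. ?b (x # vs)) = (\<Sum>x\<in>V. f (ys @ x # vs))" by (intro sum.cong) auto
            also have "\<dots> = 0" using f by (simp add: cycles_def)
            finally show ?thesis unfolding Nil append_Nil .
          next
            case (Cons u us')
            show ?thesis
            proof (cases "fst u = ?X")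
              case True
              have "?b (us @ x # vs) = f ((ys @ us) @ x # vs)" for x
                using flag_up_imp_down[OF ys, of u "us' @ x # vs" B] f0[of "ys @ us @ x # vs"] True Cons by auto
              moreover have "(\<Sum>x\<in>V. f ((ys @ us) @ x # vs)) = 0" using f unfolding cycles_def by blast
              ultimately show ?thesis by simp
            qed (simp add: Cons down_Cons)
          qed
          then show ?thesis by (simp add: down_cycles_def)
        qed
        have c: "(\<lambda>ys. if up A ys W then f (ys @ zs) else 0) \<in> up_cycles A W" (is "?c \<in> _")
          if zs: "down ?X zs B" for zs
        proof -
          have "(\<Sum>x\<in>V. ?c (us @ x # vs)) = 0" if "vs \<noteq> []" for us vs
          proof -
            obtain vs' v where v: "vs = vs' @ [v]" using \<open>vs \<noteq> []\<close> by (cases vs rule: rev_cases) auto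
            show ?thesis
            proof (cases "fst v = W")
              case True
              have "?c (us @ x # vs) = f (us @ x # (vs @ zs))" for x
                using flag_down_imp_up[OF zs, of A "us @ x # vs'" v] f0[of "us @ x # vs @ zs"] True v by auto
              moreover have "(\<Sum>x\<in>V. f (us @ x # (vs @ zs))) = 0" using f unfolding cycles_def by blast
              ultimately show ?thesis by simp
            next
              case False
              then have "\<not> up A (us @ x # vs) W" for x
                using up_snoc[of A "us @ x # vs'" v W] v by simp
              then show ?thesis by simp
            qed
          qed
          then show ?thesis by (simp add: up_cycles_def)
        qed
        have "f (ys @ zs) = 0" if "ys \<in> Y W" "down ?X zs B" for ys zs
        proof -
          have "up A ys W" using Y[OF WH] that by blast
          moreover have "f (ys @ z) = 0" if "z \<in> Z W" for z
            using fD[of "ys @ z"] WH that \<open>ys \<in> Y W\<close> by (auto simp: D_def)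
          ultimately have "(if down ?X zs B then f (ys @ zs) else 0) = 0"
            using coordinates_zero[of "down_cycles ?X B" "Z W", OF _ b] Z[OF WH] by simp
          then show ?thesis using that by simp
        qed
        then have "(if up A ys W then f (ys @ zs0) else 0) = 0" if "ys \<in> Y W" for ys
          using that xs(3) by (simp split: if_split)
        then have "(if up A ys0 W then f (ys0 @ zs0) else 0) = 0"
          using coordinates_zero[of "up_cycles A W" "Y W", OF _ c[OF xs(3)]] Y[OF WH] by blast
        then show ?thesis using xs by simp
      qed (use f0 in blast)
    qed
  next
    fix d assume "d \<in> D"
    then obtain W ys0 zs0 where WH: "W \<in> H" and d: "d = ys0 @ zs0" "ys0 \<in> Y W" "zs0 \<in> Z W"
      by (auto simp: D_def)
    let ?X = "adj W e"
    have up0: "up A ys0 W" and down0: "down ?X zs0 B" using Y[OF WH] Z[OF WH] d by auto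
    obtain bu where bu: "bu \<in> up_cycles A W" "\<forall>x\<in>Y W. bu x = of_bool (x = ys0)"
      using coordinates_dual[of "up_cycles A W" "Y W" ys0] Y[OF WH] d by blast
    obtain bd where bd: "bd \<in> down_cycles ?X B" "\<forall>x\<in>Z W. bd x = of_bool (x = zs0)"
      using coordinates_dual[of "down_cycles ?X B" "Z W" zs0] Z[OF WH] d by blast
    define h where "h = prism e A bu"
    have h: "h \<in> cycles A ?X" unfolding h_def
      using prism_cycle[OF bu(1) H1(3)] H1 WH AB e by blast
    define j where "j = length ys0"
    define f where "f = (\<lambda>xs. h (take j xs) * bd (drop j xs))"
    have "f \<in> cycles A B"
    proof -
      have "(\<Sum>x\<in>V. f (us @ x # vs)) = 0" for us vs
      proof (cases "length us < j")
        case True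
        then obtain i where i: "j - length us = Suc i" by (metis Suc_diff_Suc)
        have "(\<Sum>x\<in>V. h (us @ x # take i vs)) = 0" using h by (simp add: cycles_def)
        then show ?thesis using True i by (simp add: f_def flip: sum_distrib_right)
      next
        case False
        have "(\<Sum>x\<in>V. bd (drop j us @ x # vs)) = 0" using bd by (simp add: down_cycles_def)
        then show ?thesis using False by (simp add: f_def flip: sum_distrib_left)
      qed
      moreover have "f xs = 0" if "\<not> flag A xs B" for xs
      proof (rule ccontr)
        assume "f xs \<noteq> 0"
        then have "flag A (take j xs) ?X" "down ?X (drop j xs) B"
          using h bd unfolding f_def cycles_def down_cycles_def by (auto simp: f_def)
        from flag_down[OF this] that show False by simp
      qed
      ultimately show ?thesis by (simp add: cycles_def)
    qed
    moreover have "f x = of_bool (x = d)" 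
      if "x \<in> D" "length (takeWhile (\<lambda>x. e \<notin> fst x) d) \<le> length (takeWhile (\<lambda>x. e \<notin> fst x) x)" for x
    proof -
      have tw: "takeWhile (\<lambda>x. e \<notin> fst x) (ys @ zs) = ys" "\<forall>y\<in>set ys. e \<notin> fst y" "\<forall>z\<in>set zs. e \<in> fst z"
        if "W \<in> H" "ys \<in> Y W" "zs \<in> Z W" for W ys zs
      proof -
        have "up A ys W" "down (adj W e) zs B" using Y Z that by auto
        then show *: "\<forall>y\<in>set ys. e \<notin> fst y" "\<forall>z\<in>set zs. e \<in> fst z"
          using up_set down_set H1[OF that(1)] by blast+
        show "takeWhile (\<lambda>x. e \<notin> fst x) (ys @ zs) = ys" using * by (cases zs) (simp_all add: takeWhile_tail)
      qed
      obtain W' ys zs where W': "W' \<in> H" and x: "x = ys @ zs" "ys \<in> Y W'" "zs \<in> Z W'"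
        using \<open>x \<in> D\<close> by (auto simp: D_def)
      have le: "j \<le> length ys" using that(2) tw(1)[OF WH d(2,3)] tw(1)[OF W' x(2,3)] d x by (simp add: j_def)
      have up': "up A ys W'" and down': "down (adj W' e) zs B" using Y[OF W'] Z[OF W'] x by auto
      show ?thesis
      proof (cases "j = length ys")
        case True
        then have "f x = bu ys * bd zs"
          using prism_avoid[OF bu(1) tw(2)[OF W' x(2,3)]] x by (simp add: f_def h_def)
        moreover have "bu ys = 0" if "W' \<noteq> W"
        proof (rule up_cycles_zero[OF bu(1)])
          show "\<not> up A ys W" using up_unique up' that by blast
        qed
        moreover have "W' = W" if "x = d"
          using uniq[OF W' WH up' up0 down' down0] x d that by simp
        moreover have "ys @ zs = ys0 @ zs0 \<longleftrightarrow> ys = ys0 \<and> zs = zs0" using True by (simp add: j_def)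
        ultimately show ?thesis using bu(2) bd(2) x d by (cases "W' = W") auto
      next
        case False
        then have "drop j ys \<noteq> []" using le by simp
        then obtain u us where u: "drop j ys = u # us" by (cases "drop j ys") auto
        then have "u \<in> set ys" by (metis in_set_dropD list.set_intros(1))
        then have "e \<notin> fst u" using tw(2)[OF W' x(2,3)] by blast
        then have "fst u \<noteq> ?X" using H1[OF WH] by blast
        then have "\<not> down ?X (drop j x) B" using le x u by (simp add: down_Cons)
        then have "f x = 0" using bd(1) by (simp add: f_def down_cycles_def)
        moreover have "x \<noteq> d"
        proof
          assume "x = d"
          then have "ys = ys0" using uniq[OF W' WH up' up0 down' down0] x d by simp
          then show False using False by (simp add: j_def)
        qed
        ultimately show ?thesis by simp
      qed
    qed
    ultimately show "\<exists>b\<in>cycles A B. \<forall>x\<in>D. length (takeWhile (\<lambda>x. e \<notin> fst x) d) \<le> length (takeWhile (\<lambda>x. e \<notin> fst x) x) \<longrightarrow> b x = of_bool (x = d)"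
      by blast
  qed (use finD cycles_diff in auto)
qed

end

section \<open>Counting flats\<close>

context flats begin

text \<open>
  Successive points avoid the closure of the flat spanned so far. The operator \<open>cl\<close> is the identity for
  linearly independent lists, and adjoins \<open>e\<close> for lists that stay independent of \<open>e\<close>.
\<close>

fun indep :: "('a set \<Rightarrow> 'a set) \<Rightarrow> 'a set \<Rightarrow> 'a list \<Rightarrow> bool" where
  "indep cl A [] \<longleftrightarrow> True"
| "indep cl A (x # xs) \<longleftrightarrow> x \<notin> cl A \<and> indep cl (adj A x) xs"

lemma card_indep:
  assumes B: "B \<in> S" and F: "F \<subseteq> S"
    and cl: "\<And>A. A \<in> F \<Longrightarrow> card (cl A) = c * card A"
    and clB: "\<And>A. A \<in> F \<Longrightarrow> A \<subseteq> B \<Longrightarrow> A \<subseteq> cl A \<and> cl A \<subseteq> B"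
    and adjF: "\<And>A x. A \<in> F \<Longrightarrow> x \<in> \<Union>S \<Longrightarrow> x \<notin> cl A \<Longrightarrow> adj A x \<in> F"
    and A: "A \<in> F" "A \<subseteq> B"
  shows "card {xs. length xs = k \<and> set xs \<subseteq> B \<and> indep cl A xs} = (\<Prod>i<k. card B - c * q ^ i * card A)"
  using A
proof (induction k arbitrary: A)
  case 0
  have "{xs. length xs = 0 \<and> set xs \<subseteq> B \<and> indep cl A xs} = {[]}" by auto
  then show ?case by simp
next
  case (Suc k)
  let ?R = "\<lambda>A k. {xs. length xs = k \<and> set xs \<subseteq> B \<and> indep cl A xs}"
  have finB: "finite B" using B finite_flat by blast
  have fin: "finite (?R A k)" for A
    using finite_lists_length_eq[OF finB, of k] by (rule rev_finite_subset) auto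
  have "?R A (Suc k) = (\<lambda>(x, xs). x # xs) ` Sigma (B - cl A) (\<lambda>x. ?R (adj A x) k)"
    by (auto simp: image_iff length_Suc_conv)
  moreover have "inj_on (\<lambda>(x, xs). x # xs) (Sigma (B - cl A) (\<lambda>x. ?R (adj A x) k))"
    by (auto simp: inj_on_def)
  ultimately have "card (?R A (Suc k)) = (\<Sum>x\<in>B - cl A. card (?R (adj A x) k))"
    using finB fin by (simp add: card_image card_SigmaI)
  also have "\<dots> = (\<Sum>x\<in>B - cl A. \<Prod>i<k. card B - c * q ^ Suc i * card A)"
  proof (intro sum.cong refl)
    fix x assume x: "x \<in> B - cl A"
    then have "x \<in> \<Union>S" "x \<notin> A" "A \<in> S" using B clB Suc.prems F by blast+
    then have "adj A x \<in> F" "adj A x \<subseteq> B" "card (adj A x) = q * card A"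
      using x B Suc.prems adjF adj_least card_adj by auto
    then show "card (?R (adj A x) k) = (\<Prod>i<k. card B - c * q ^ Suc i * card A)"
      using Suc.IH by (simp add: mult_ac)
  qed
  also have "\<dots> = card (B - cl A) * (\<Prod>i<k. card B - c * q ^ Suc i * card A)" by simp
  also have "card (B - cl A) = card B - c * q ^ 0 * card A"
    using clB[OF Suc.prems] cl[OF Suc.prems(1)] finB
    by (subst card_Diff_subset) (auto intro: finite_subset)
  finally show ?case by (simp only: prod.lessThan_Suc_shift)
qed

lemma foldl_adj_least:
  "A \<in> S \<Longrightarrow> X \<in> S \<Longrightarrow> A \<subseteq> X \<Longrightarrow> set xs \<subseteq> X \<Longrightarrow> foldl adj A xs \<subseteq> X"
proof (induction xs arbitrary: A)
  case (Cons x xs)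
  then have "x \<in> \<Union>S" by auto
  then have "adj A x \<in> S" "adj A x \<subseteq> X" using Cons.prems adj_flat adj_least by simp_all
  then show ?case using Cons by simp
qed simp

lemma foldl_adj:
  assumes F: "F \<subseteq> S"
    and clA: "\<And>A. A \<in> F \<Longrightarrow> A \<subseteq> cl A"
    and adjF: "\<And>A x. A \<in> F \<Longrightarrow> x \<in> \<Union>S \<Longrightarrow> x \<notin> cl A \<Longrightarrow> adj A x \<in> F"
    and "A \<in> F" "indep cl A xs" "set xs \<subseteq> \<Union>S"
  shows "foldl adj A xs \<in> F \<and> A \<subseteq> foldl adj A xs \<and> set xs \<subseteq> foldl adj A xs \<and>
    card (foldl adj A xs) = q ^ length xs * card A \<and> indep (\<lambda>A. A) A xs"
  using assms(4-)
proof (induction xs arbitrary: A)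
  case (Cons x xs)
  then have *: "A \<in> S" "x \<in> \<Union>S" "x \<notin> A" "adj A x \<in> F" using F clA[of A] adjF[of A x] by auto
  then have "A \<subseteq> adj A x" "x \<in> adj A x" "card (adj A x) = q * card A"
    using adj_sup adj_mem card_adj by auto
  then show ?case using Cons.IH[OF *(4)] Cons.prems * by auto
qed simp

text \<open>
  Count the independent lists of \<open>k\<close> points in \<open>B\<close> in two ways. Each of them spans one flat of the
  family \<open>F\<close>, and each such flat is spanned by the same number of lists. In the applications \<open>F\<close> is
  \<open>S\<close> or the set of flats without \<open>e\<close>.
\<close>

lemma card_flats_between:
  assumes B: "B \<in> S" and F: "F \<subseteq> S"
    and cl: "\<And>A. A \<in> F \<Longrightarrow> card (cl A) = c * card A"
    and clA: "\<And>A. A \<in> F \<Longrightarrow> A \<subseteq> cl A"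
    and clB: "\<And>A. A \<in> F \<Longrightarrow> A \<subseteq> B \<Longrightarrow> cl A \<subseteq> B"
    and adjF: "\<And>A x. A \<in> F \<Longrightarrow> x \<in> \<Union>S \<Longrightarrow> x \<notin> cl A \<Longrightarrow> adj A x \<in> F"
    and clU: "\<And>A U x. A \<in> F \<Longrightarrow> U \<in> F \<Longrightarrow> A \<subseteq> U \<Longrightarrow> x \<in> U \<Longrightarrow> x \<notin> A \<Longrightarrow> x \<notin> cl A"
    and A: "A \<in> F" "A \<subseteq> B" and r: "card B = q ^ r * card A"
  shows "card {U \<in> F. A \<subseteq> U \<and> U \<subseteq> B \<and> card U = q ^ k * card A} * (\<Prod>i<k. q ^ k - q ^ i)
     = (\<Prod>i<k. q ^ r - c * q ^ i)"
proof -
  define H where "H = {U \<in> F. A \<subseteq> U \<and> U \<subseteq> B \<and> card U = q ^ k * card A}"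
  define R where "R = (\<lambda>U. {xs. length xs = k \<and> set xs \<subseteq> U \<and> indep (\<lambda>A. A) A xs})"
  have HS: "U \<in> S" if "U \<in> H" for U using F that by (auto simp: H_def)
  have AS: "A \<in> S" using A F by auto
  have finH: "finite H" using finite_S F by (auto simp: H_def intro: rev_finite_subset)
  have indep_cl: "indep cl A xs" if "U \<in> F" "A \<subseteq> U" "A \<in> F" "set xs \<subseteq> U" "indep (\<lambda>A. A) A xs" for U A xs
    using that
  proof (induction xs arbitrary: A)
    case (Cons x xs)
    then have x: "x \<notin> cl A" using clU by auto
    have "U \<in> S" "A \<in> S" "x \<in> \<Union>S" using Cons.prems F by auto
    then have "adj A x \<in> F" "adj A x \<subseteq> U" using adjF x adj_least[of A U x] Cons.prems by auto
    then show ?case using Cons x by simp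
  qed simp
  have span: "foldl adj A xs = U" if "U \<in> H" "xs \<in> R U" for U xs
  proof (rule flat_eqI)
    have "A \<in> S" "set xs \<subseteq> \<Union>S" "indep (\<lambda>A. A) A xs" using that HS AS by (auto simp: R_def)
    from foldl_adj[OF order_refl _ _ this(1,3,2)] adj_flat
    have *: "foldl adj A xs \<in> S" "card (foldl adj A xs) = q ^ length xs * card A" by auto
    then show "foldl adj A xs \<in> S" by simp
    show "card U \<le> card (foldl adj A xs)" using * that by (simp add: H_def R_def)
    show "foldl adj A xs \<subseteq> U" using foldl_adj_least AS HS that by (auto simp: H_def R_def)
  qed (use that HS in auto)
  have "{xs. length xs = k \<and> set xs \<subseteq> B \<and> indep cl A xs} = (\<Union>U\<in>H. R U)"
  proof (intro equalityI subsetI)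
    fix xs assume "xs \<in> {xs. length xs = k \<and> set xs \<subseteq> B \<and> indep cl A xs}"
    then have xs: "length xs = k" "set xs \<subseteq> B" "indep cl A xs" by auto
    have "set xs \<subseteq> \<Union>S" using xs B by auto
    from foldl_adj[OF F clA adjF A(1) xs(3) this] foldl_adj_least[OF AS B A(2) xs(2)]
    have "foldl adj A xs \<in> H" "xs \<in> R (foldl adj A xs)" using xs by (auto simp: H_def R_def)
    then show "xs \<in> (\<Union>U\<in>H. R U)" by blast
  next
    fix xs assume "xs \<in> (\<Union>U\<in>H. R U)"
    then obtain U where "U \<in> H" "xs \<in> R U" by blast
    then show "xs \<in> {xs. length xs = k \<and> set xs \<subseteq> B \<and> indep cl A xs}"
      using indep_cl[of U A xs] A(1) by (auto simp: H_def R_def)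
  qed
  moreover have "finite (R U)" if "U \<in> H" for U
    using finite_lists_length_eq[OF finite_flat[OF HS[OF that]], of k]
    by (rule rev_finite_subset) (auto simp: R_def)
  moreover have "R U \<inter> R U' = {}" if "U \<in> H" "U' \<in> H" "U \<noteq> U'" for U U'
    using span that by blast
  ultimately have "card {xs. length xs = k \<and> set xs \<subseteq> B \<and> indep cl A xs} = (\<Sum>U\<in>H. card (R U))"
    using finH by (simp add: card_UN_disjoint)
  also have "\<dots> = (\<Sum>U\<in>H. \<Prod>i<k. card A * (q ^ k - q ^ i))"
  proof (intro sum.cong refl)
    fix U assume U: "U \<in> H"
    have "card (R U) = (\<Prod>i<k. card U - 1 * q ^ i * card A)"
      unfolding R_def
      by (rule card_indep[of U S]) (use HS[OF U] AS U adj_flat in \<open>auto simp: H_def\<close>)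
    then show "card (R U) = (\<Prod>i<k. card A * (q ^ k - q ^ i))"
      using U by (simp add: H_def algebra_simps diff_mult_distrib2)
  qed
  also have "\<dots> = card H * card A ^ k * (\<Prod>i<k. q ^ k - q ^ i)"
    by (simp add: prod.distrib)
  finally have *: "card {xs. length xs = k \<and> set xs \<subseteq> B \<and> indep cl A xs} = \<dots>" .
  have "card {xs. length xs = k \<and> set xs \<subseteq> B \<and> indep cl A xs} = (\<Prod>i<k. card B - c * q ^ i * card A)"
    by (rule card_indep[of B F]) (use assms in auto)
  also have "\<dots> = (\<Prod>i<k. card A * (q ^ r - c * q ^ i))"
    using r by (simp add: algebra_simps diff_mult_distrib2)
  also have "\<dots> = card A ^ k * (\<Prod>i<k. q ^ r - c * q ^ i)" by (simp add: prod.distrib)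
  finally have "card A ^ k * (card H * (\<Prod>i<k. q ^ k - q ^ i)) = card A ^ k * (\<Prod>i<k. q ^ r - c * q ^ i)"
    using * by (simp add: mult_ac)
  then show ?thesis using card_flat_pos[OF AS] by (simp add: H_def)
qed

lemma card_flats:
  assumes "A \<in> S" "B \<in> S" "A \<subseteq> B" "card B = q ^ r * card A"
  shows "card {U \<in> S. A \<subseteq> U \<and> U \<subseteq> B \<and> card U = q ^ k * card A} * (\<Prod>i<k. q ^ k - q ^ i)
     = (\<Prod>i<k. q ^ r - q ^ i)"
proof -
  have "card {U \<in> S. A \<subseteq> U \<and> U \<subseteq> B \<and> card U = q ^ k * card A} * (\<Prod>i<k. q ^ k - q ^ i)
     = (\<Prod>i<k. q ^ r - 1 * q ^ i)"
    by (rule card_flats_between[of B S "\<lambda>A. A"]) (use assms adj_flat in auto)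
  then show ?thesis by simp
qed

lemma card_flats_avoiding:
  assumes AB: "A \<in> S" "B \<in> S" "A \<subseteq> B" "card B = q ^ Suc r * card A" and e: "e \<in> B" "e \<notin> A"
  shows "card {U \<in> S. e \<notin> U \<and> A \<subseteq> U \<and> U \<subseteq> B \<and> card U = q ^ k * card A} * (\<Prod>i<k. q ^ k - q ^ i)
     = q ^ k * (\<Prod>i<k. q ^ r - q ^ i)"
proof -
  have eS: "e \<in> \<Union>S" using AB e by auto
  have "card {U \<in> {U \<in> S. e \<notin> U}. A \<subseteq> U \<and> U \<subseteq> B \<and> card U = q ^ k * card A} * (\<Prod>i<k. q ^ k - q ^ i)
     = (\<Prod>i<k. q ^ Suc r - q * q ^ i)"
  proof (rule card_flats_between[of B "{U \<in> S. e \<notin> U}" "\<lambda>A. adj A e"])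
    fix A x assume *: "A \<in> {U \<in> S. e \<notin> U}" "x \<in> \<Union>S" "x \<notin> adj A e"
    then have "x \<notin> A" using adj_sup eS by auto
    then have "e \<notin> adj A x" using cov_eq_adj[OF cov_adj[of A x], of e] * adj_mem by auto
    then show "adj A x \<in> {U \<in> S. e \<notin> U}" using * adj_flat by auto
  next
    fix A U x assume *: "A \<in> {U \<in> S. e \<notin> U}" "U \<in> {U \<in> S. e \<notin> U}" "A \<subseteq> U" "x \<in> U" "x \<notin> A"
    show "x \<notin> adj A e"
    proof
      assume "x \<in> adj A e"
      then have "adj A e = adj A x" using cov_eq_adj[OF cov_adj[of A e], of x] * eS by auto
      then have "adj A e \<subseteq> U" using adj_least * by auto
      then show False using * adj_mem[of A e] eS by auto
    qed
  qed (use AB e eS adj_least adj_sup card_adj in auto)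
  also have "(\<Prod>i<k. q ^ Suc r - q * q ^ i) = (\<Prod>i<k. q * (q ^ r - q ^ i))"
    by (simp add: diff_mult_distrib2)
  also have "\<dots> = q ^ k * (\<Prod>i<k. q ^ r - q ^ i)" by (simp add: prod.distrib)
  finally show ?thesis by (simp add: conj_assoc)
qed

end

section \<open>The rank of the group of cycles\<close>

text \<open>
  The recursion in a form without boundary terms: \<open>m\<close> is the number of labels, \<open>g n k\<close> the number of
  \<open>k\<close>-dimensional subspaces in dimension \<open>n\<close>, and \<open>k\<close> the dimension at which a flag is cut. The case
  distinctions are the empty half-open flags at both ends.
\<close>

fun top_rank :: "nat \<Rightarrow> nat \<Rightarrow> (nat \<Rightarrow> nat \<Rightarrow> nat) \<Rightarrow> nat \<Rightarrow> nat" where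
  "top_rank q m g n = (\<Sum>k<n. q ^ k * g (n - 1) k *
     ((if k = 0 then 1 else m * top_rank q m g k) *
      (if k = n - 1 then 1 else (m - 1) * top_rank q m g (n - 1 - k))))"

declare top_rank.simps [simp del]

context labelled_flats begin

theorem coordinates_cycles:
  assumes g: "\<And>n k. g n k * (\<Prod>i<k. q ^ k - q ^ i) = (\<Prod>i<k. q ^ n - q ^ i)"
    and "A \<in> S" "B \<in> S" "A \<subseteq> B" "card B = q ^ r * card A" "r > 0"
  shows "\<exists>D. coordinates (cycles A B) D \<and> D \<subseteq> {xs. flag A xs B} \<and> card D = top_rank q (card L) g r"
  using assms(2-)
proof (induction r arbitrary: A B rule: less_induct)
  case (less r)
  obtain s where r: "r = Suc s" using gr0_implies_Suc[OF less.prems(5)] by blast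
  let ?t = "top_rank q (card L) g"
  have a0: "card A > 0" using card_flat_pos[OF less.prems(1)] .
  have "card A \<noteq> card B" using one_less_power[OF q_gt_1, of r] less.prems(4,5) a0 by simp
  then have "A \<noteq> B" by blast
  then obtain e where e: "e \<in> B" "e \<notin> A" using less.prems(3) by blast
  have eS: "e \<in> \<Union>S" using e(1) less.prems(2) by blast
  define H where "H = {W \<in> S. A \<subseteq> W \<and> W \<subseteq> B \<and> e \<notin> W}"
  have finH: "finite H" using finite_S by (auto simp: H_def)
  define rk where "rk W = (SOME k. card W = q ^ k * card A)" for W :: "'a set"
  have rk: "card W = q ^ rk W * card A" if "W \<in> H" for W
  proof -
    have "W \<in> S" "A \<subseteq> W" using that by (auto simp: H_def)
    from card_flat_dvd[OF less.prems(1) this] show ?thesis unfolding rk_def by (rule someI_ex)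
  qed
  have rk_eq: "rk W = k \<longleftrightarrow> card W = q ^ k * card A" if "W \<in> H" for W k
  proof -
    have "card W = q ^ k * card A \<longleftrightarrow> q ^ rk W = q ^ k" using rk[OF that] a0 by simp
    also have "\<dots> \<longleftrightarrow> rk W = k" by (rule power_inject_exp[OF q_gt_1])
    finally show ?thesis by simp
  qed
  have X: "adj W e \<in> S" "adj W e \<subseteq> B" "card (adj W e) = q ^ Suc (rk W) * card A" if "W \<in> H" for W
  proof -
    have W: "W \<in> S" "W \<subseteq> B" "e \<notin> W" using that by (auto simp: H_def)
    show "adj W e \<in> S" "adj W e \<subseteq> B"
      using adj_flat[OF W(1) eS] adj_least[OF W(1) less.prems(2) W(2) e(1)] .
    show "card (adj W e) = q ^ Suc (rk W) * card A"
      using card_adj[OF W(1) eS W(3)] rk[OF that] by simp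
  qed
  have rk_less: "rk W < r" if "W \<in> H" for W
  proof -
    have "card (adj W e) \<le> card B"
      by (rule card_mono[OF finite_flat[OF less.prems(2)] X(2)[OF that]])
    then have "q ^ Suc (rk W) \<le> q ^ r" using X(3)[OF that] less.prems(4) a0 by (simp del: power_Suc)
    then have "Suc (rk W) \<le> r" using power_le_imp_le_exp[OF q_gt_1] by blast
    then show ?thesis by simp
  qed
  have rk0: "rk W = 0 \<longleftrightarrow> W = A" if "W \<in> H" for W
  proof -
    have "W \<in> S" "A \<subseteq> W" using that by (auto simp: H_def)
    then have "card W = card A \<longleftrightarrow> W = A" using flat_eqI[OF less.prems(1), of W] by auto
    then show ?thesis using rk_eq[OF that, of 0] by simp
  qed
  have rks: "rk W = s \<longleftrightarrow> adj W e = B" if "W \<in> H" for W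
  proof -
    have "adj W e = B \<longleftrightarrow> card (adj W e) = card B"
      using flat_eqI[OF X(1)[OF that] less.prems(2) X(2)[OF that]] by auto
    also have "\<dots> \<longleftrightarrow> q ^ Suc (rk W) = q ^ Suc s"
      using X(3)[OF that] less.prems(4) r a0 by (simp del: power_Suc)
    also have "\<dots> \<longleftrightarrow> Suc (rk W) = Suc s" by (rule power_inject_exp[OF q_gt_1])
    finally show ?thesis by simp
  qed
  have cardB: "card B = q ^ (s - rk W) * card (adj W e)" if "W \<in> H" for W
  proof -
    have "r = s - rk W + Suc (rk W)" using rk_less[OF that] r by simp
    then have "q ^ r = q ^ (s - rk W) * q ^ Suc (rk W)" by (metis power_add)
    then show ?thesis using less.prems(4) X(3)[OF that] by (simp only: mult.assoc)
  qed
  have "\<exists>Y. coordinates (up_cycles A W) Y \<and> Y \<subseteq> {ys. up A ys W} \<and>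
      card Y = (if rk W = 0 then 1 else card L * ?t (rk W))" if W: "W \<in> H" for W
  proof (cases "W = A")
    case True
    then show ?thesis using coordinates_up_cycles_refl[of A] rk0[OF W]
      by (intro exI[of _ "{[]}"]) auto
  next
    case False
    have "W \<in> S" "A \<subseteq> W" using W by (auto simp: H_def)
    from less.IH[OF rk_less[OF W] less.prems(1) this rk[OF W]] rk0[OF W] False obtain D where
      D: "coordinates (cycles A W) D" "D \<subseteq> {xs. flag A xs W}" "card D = ?t (rk W)" by auto
    have "inj_on (\<lambda>(ys, l). ys @ [(W, l)]) (D \<times> L)" by (auto simp: inj_on_def)
    then have "card ((\<lambda>(ys, l). ys @ [(W, l)]) ` (D \<times> L)) = card L * ?t (rk W)"
      using D by (simp add: card_image card_cartesian_product)
    then show ?thesis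
      using coordinates_up_cycles[OF less.prems(1) _ D(1,2)] D(2) False rk0[OF W]
      by (intro exI[of _ "(\<lambda>(ys, l). ys @ [(W, l)]) ` (D \<times> L)"]) (auto simp: up_snoc)
  qed
  then obtain Y where Y: "\<And>W. W \<in> H \<Longrightarrow> coordinates (up_cycles A W) (Y W) \<and> Y W \<subseteq> {ys. up A ys W} \<and>
      card (Y W) = (if rk W = 0 then 1 else card L * ?t (rk W))" by metis
  have "\<exists>Z. coordinates (down_cycles (adj W e) B) Z \<and> Z \<subseteq> {zs. down (adj W e) zs B} \<and>
      card Z = (if rk W = s then 1 else (card L - 1) * ?t (s - rk W))" if W: "W \<in> H" for W
  proof (cases "adj W e = B")
    case True
    then show ?thesis using coordinates_down_cycles_refl[of B] rks[OF W]
      by (intro exI[of _ "{[]}"]) auto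
  next
    case False
    let ?X = "adj W e"
    have "s - rk W < r" "s - rk W > 0" using False rks[OF W] rk_less[OF W] r by auto
    from less.IH[OF this(1) X(1)[OF W] less.prems(2) X(2)[OF W] cardB[OF W] this(2)] obtain D where
      D: "coordinates (cycles ?X B) D" "D \<subseteq> {xs. flag ?X xs B}" "card D = ?t (s - rk W)" by auto
    have "inj_on (\<lambda>(l, zs). (?X, l) # zs) ((L - {l0}) \<times> D)" by (auto simp: inj_on_def)
    then have "card ((\<lambda>(l, zs). (?X, l) # zs) ` ((L - {l0}) \<times> D)) = (card L - 1) * ?t (s - rk W)"
      using D l0_mem finite_L by (simp add: card_image card_cartesian_product)
    then show ?thesis
      using coordinates_down_cycles[OF X(1)[OF W] False D(1,2)] D(2) False rks[OF W]
      by (intro exI[of _ "(\<lambda>(l, zs). (?X, l) # zs) ` ((L - {l0}) \<times> D)"]) (auto simp: down_Cons)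
  qed
  then obtain Z where Z: "\<And>W. W \<in> H \<Longrightarrow> coordinates (down_cycles (adj W e) B) (Z W) \<and>
      Z W \<subseteq> {zs. down (adj W e) zs B} \<and>
      card (Z W) = (if rk W = s then 1 else (card L - 1) * ?t (s - rk W))" by metis
  define D where "D = (\<Union>W\<in>H. (\<lambda>(ys, zs). ys @ zs) ` (Y W \<times> Z W))"
  have "coordinates (up_cycles A W) (Y W) \<and> Y W \<subseteq> {ys. up A ys W}"
    and "coordinates (down_cycles (adj W e) B) (Z W) \<and> Z W \<subseteq> {zs. down (adj W e) zs B}"
    if "W \<in> H" for W using Y[OF that] Z[OF that] by simp_all
  note step = coordinates_cycles_step[OF less.prems(1-3) e H_def this, folded D_def]
  define f where "f k = (if k = 0 then 1 else card L * ?t k) * (if k = s then 1 else (card L - 1) * ?t (s - k))" for k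
  have "card D = (\<Sum>W\<in>H. f (rk W))" using step(3) Y Z by (simp add: f_def)
  also have "\<dots> = (\<Sum>k<r. \<Sum>W\<in>{W\<in>H. rk W = k}. f (rk W))"
    using finH rk_less by (intro sum.group[symmetric]) auto
  also have "\<dots> = (\<Sum>k<r. q ^ k * g s k * f k)"
  proof (intro sum.cong refl)
    fix k assume "k \<in> {..<r}"
    have "card {W \<in> H. rk W = k} * (\<Prod>i<k. q ^ k - q ^ i) = q ^ k * (\<Prod>i<k. q ^ s - q ^ i)"
    proof -
      have "{W \<in> H. rk W = k} = {U \<in> S. e \<notin> U \<and> A \<subseteq> U \<and> U \<subseteq> B \<and> card U = q ^ k * card A}"
        using rk_eq by (auto simp: H_def)
      then show ?thesis using card_flats_avoiding[OF less.prems(1-3) _ e, of s k] less.prems(4) r by simp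
    qed
    also have "\<dots> = q ^ k * g s k * (\<Prod>i<k. q ^ k - q ^ i)" by (simp add: g)
    finally have "card {W \<in> H. rk W = k} = q ^ k * g s k" using q_gt_1 by auto
    then show "(\<Sum>W\<in>{W\<in>H. rk W = k}. f (rk W)) = q ^ k * g s k * f k" by simp
  qed
  also have "\<dots> = ?t r" by (subst top_rank.simps) (simp add: r f_def)
  finally show ?case using step by blast
qed

end

section \<open>Subspaces of a finite vector space\<close>

lemma (in vectorspace) card_eq_card_field_power_dim:
  assumes "finite (carrier K)" "finite (carrier V)"
  shows "card (carrier V) = card (carrier K) ^ dim"
proof -
  have "fin_dim" unfolding fin_dim_def
    using assms(2) in_own_span[of "carrier V"] span_is_subset2[of "carrier V"] by blast
  then obtain A where A: "finite A" "basis A" using finite_basis_exists by blast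
  then have AV: "A \<subseteq> carrier V" by (simp add: basis_def)
  have "bij_betw (\<lambda>a. lincomb a A) (A \<rightarrow>\<^sub>E carrier K) (carrier V)"
  proof -
    have ex: "\<forall>v. v \<in> carrier V \<longrightarrow> (\<exists>!a. a \<in> A \<rightarrow>\<^sub>E carrier K \<and> lincomb a A = v)"
      using basis_criterion[OF A(1) AV] A(2) by simp
    have "lincomb a A \<in> carrier V" if "a \<in> A \<rightarrow>\<^sub>E carrier K" for a
      using that AV by (intro lincomb_closed) auto
    then show ?thesis using ex unfolding bij_betw_def inj_on_def by blast
  qed
  then have "card (carrier V) = card (A \<rightarrow>\<^sub>E carrier K)" by (simp add: bij_betw_same_card)
  also have "\<dots> = card (carrier K) ^ card A" using A(1) by (simp add: card_PiE)
  finally show ?thesis using dim_basis[OF A] by simp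
qed

lemma card_subspace:
  assumes "vectorspace K V" "subspace K W V" "finite (carrier K)" "finite (carrier V)"
  shows "card W = card (carrier K) ^ vectorspace.dim K (V\<lparr>carrier := W\<rparr>)"
proof -
  interpret V: vectorspace K V by fact
  interpret W: vectorspace K "V\<lparr>carrier := W\<rparr>" using V.subspace_is_vs assms(2) by blast
  have "W \<subseteq> carrier V" using assms(2) V.is_module submodule.subset by blast
  then show ?thesis using W.card_eq_card_field_power_dim assms by (simp add: finite_subset)
qed

context vectorspace begin

definition adjoin :: "'c set \<Rightarrow> 'c \<Rightarrow> 'c set" where
  "adjoin U x = (\<lambda>(u, a). u \<oplus>\<^bsub>V\<^esub> a \<odot>\<^bsub>V\<^esub> x) ` (U \<times> carrier K)"

lemma subspace_iff:
  "subspace K U V \<longleftrightarrow> U \<subseteq> carrier V \<and> \<zero>\<^bsub>V\<^esub> \<in> U \<and>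
    (\<forall>u\<in>U. \<forall>v\<in>U. u \<oplus>\<^bsub>V\<^esub> v \<in> U) \<and> (\<forall>a\<in>carrier K. \<forall>u\<in>U. a \<odot>\<^bsub>V\<^esub> u \<in> U)"
  using vectorspace_axioms module_axioms by (auto simp: subspace_def submodule_def)

lemma subspace_adjoin:
  assumes U: "subspace K U V" and x: "x \<in> carrier V"
  shows "subspace K (adjoin U x) V"
proof -
  note U' = U[unfolded subspace_iff]
  have UV: "u \<in> carrier V" if "u \<in> U" for u using U' that by blast
  have "\<zero>\<^bsub>V\<^esub> \<in> adjoin U x"
    unfolding adjoin_def using U' x by (intro image_eqI[of _ _ "(\<zero>\<^bsub>V\<^esub>, \<zero>\<^bsub>K\<^esub>)"]) auto
  moreover have "(u \<oplus>\<^bsub>V\<^esub> a \<odot>\<^bsub>V\<^esub> x) \<oplus>\<^bsub>V\<^esub> (v \<oplus>\<^bsub>V\<^esub> b \<odot>\<^bsub>V\<^esub> x) \<in> adjoin U x"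
    if "u \<in> U" "v \<in> U" "a \<in> carrier K" "b \<in> carrier K" for u v a b
  proof -
    have "(u \<oplus>\<^bsub>V\<^esub> a \<odot>\<^bsub>V\<^esub> x) \<oplus>\<^bsub>V\<^esub> (v \<oplus>\<^bsub>V\<^esub> b \<odot>\<^bsub>V\<^esub> x)
        = (u \<oplus>\<^bsub>V\<^esub> v) \<oplus>\<^bsub>V\<^esub> (a \<oplus>\<^bsub>K\<^esub> b) \<odot>\<^bsub>V\<^esub> x"
      using that UV x by (simp add: smult_l_distr M.a_ac)
    then show ?thesis unfolding adjoin_def
      using that U' by (intro image_eqI[of _ _ "(u \<oplus>\<^bsub>V\<^esub> v, a \<oplus>\<^bsub>K\<^esub> b)"]) auto
  qed
  moreover have "b \<odot>\<^bsub>V\<^esub> (u \<oplus>\<^bsub>V\<^esub> a \<odot>\<^bsub>V\<^esub> x) \<in> adjoin U x"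
    if "u \<in> U" "a \<in> carrier K" "b \<in> carrier K" for u a b
  proof -
    have "b \<odot>\<^bsub>V\<^esub> (u \<oplus>\<^bsub>V\<^esub> a \<odot>\<^bsub>V\<^esub> x) = b \<odot>\<^bsub>V\<^esub> u \<oplus>\<^bsub>V\<^esub> (b \<otimes>\<^bsub>K\<^esub> a) \<odot>\<^bsub>V\<^esub> x"
      using that UV x by (simp add: smult_r_distr smult_assoc1)
    then show ?thesis unfolding adjoin_def
      using that U' by (intro image_eqI[of _ _ "(b \<odot>\<^bsub>V\<^esub> u, b \<otimes>\<^bsub>K\<^esub> a)"]) auto
  qed
  moreover have "adjoin U x \<subseteq> carrier V" using UV x by (auto simp: adjoin_def)
  ultimately show ?thesis unfolding subspace_iff by (auto simp: adjoin_def)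
qed

theorem flats_subspaces:
  assumes fin: "finite (carrier K)" "finite (carrier V)"
  shows "flats (card (carrier K)) {U. subspace K U V} adjoin"
proof -
  have "carrier V \<in> {U. subspace K U V}" by (simp add: subspace_iff)
  then have points: "\<Union>{U. subspace K U V} = carrier V" by (auto simp: subspace_iff)
  show ?thesis
  proof (unfold_locales, unfold points mem_Collect_eq)
    show "finite (carrier V)" by fact
    have "card {\<zero>\<^bsub>K\<^esub>, \<one>\<^bsub>K\<^esub>} \<le> card (carrier K)" using fin by (intro card_mono) auto
    then show "1 < card (carrier K)" by simp
  next
    fix U assume "subspace K U V"
    then show "U \<noteq> {}" by (auto simp: subspace_iff)
  next
    fix U x assume "subspace K U V" "x \<in> carrier V"
    then show "subspace K (adjoin U x) V" by (rule subspace_adjoin)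
  next
    fix U x assume U: "subspace K U V" and x: "x \<in> carrier V"
    then have UV: "u \<in> carrier V" if "u \<in> U" for u using that by (auto simp: subspace_iff)
    show "U \<subseteq> adjoin U x"
    proof
      fix u assume "u \<in> U"
      then show "u \<in> adjoin U x" unfolding adjoin_def
        using UV x by (intro image_eqI[of _ _ "(u, \<zero>\<^bsub>K\<^esub>)"]) auto
    qed
    show "x \<in> adjoin U x" unfolding adjoin_def
      using U x by (intro image_eqI[of _ _ "(\<zero>\<^bsub>V\<^esub>, \<one>\<^bsub>K\<^esub>)"]) (auto simp: subspace_iff)
  next
    fix U X x assume "subspace K U V" "subspace K X V" "U \<subseteq> X" "x \<in> X"
    then show "adjoin U x \<subseteq> X" by (auto simp: adjoin_def subspace_iff)
  next
    fix U x assume U: "subspace K U V" and x: "x \<in> carrier V" "x \<notin> U"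
    note U' = U[unfolded subspace_iff]
    have UV: "u \<in> carrier V" if "u \<in> U" for u using U' that by blast
    have "inj_on (\<lambda>(u, a). u \<oplus>\<^bsub>V\<^esub> a \<odot>\<^bsub>V\<^esub> x) (U \<times> carrier K)"
    proof (rule inj_onI, clarify)
      fix u a v b assume *: "u \<in> U" "a \<in> carrier K" "v \<in> U" "b \<in> carrier K"
        "u \<oplus>\<^bsub>V\<^esub> a \<odot>\<^bsub>V\<^esub> x = v \<oplus>\<^bsub>V\<^esub> b \<odot>\<^bsub>V\<^esub> x"
      have "(a \<ominus>\<^bsub>K\<^esub> b) \<odot>\<^bsub>V\<^esub> x = v \<oplus>\<^bsub>V\<^esub> (\<ominus>\<^bsub>K\<^esub> \<one>\<^bsub>K\<^esub>) \<odot>\<^bsub>V\<^esub> u"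
      proof -
        have "a \<odot>\<^bsub>V\<^esub> x = \<ominus>\<^bsub>V\<^esub> u \<oplus>\<^bsub>V\<^esub> (u \<oplus>\<^bsub>V\<^esub> a \<odot>\<^bsub>V\<^esub> x)"
          using *(1-4) UV x by (simp add: M.r_neg1)
        also have "\<dots> = \<ominus>\<^bsub>V\<^esub> u \<oplus>\<^bsub>V\<^esub> (v \<oplus>\<^bsub>V\<^esub> b \<odot>\<^bsub>V\<^esub> x)" using * by simp
        finally have "a \<odot>\<^bsub>V\<^esub> x \<oplus>\<^bsub>V\<^esub> \<ominus>\<^bsub>V\<^esub> (b \<odot>\<^bsub>V\<^esub> x)
            = \<ominus>\<^bsub>V\<^esub> u \<oplus>\<^bsub>V\<^esub> v \<oplus>\<^bsub>V\<^esub> (b \<odot>\<^bsub>V\<^esub> x \<oplus>\<^bsub>V\<^esub> \<ominus>\<^bsub>V\<^esub> (b \<odot>\<^bsub>V\<^esub> x))"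
          using *(1-4) UV x by (simp add: M.a_assoc)
        also have "\<dots> = v \<oplus>\<^bsub>V\<^esub> \<ominus>\<^bsub>V\<^esub> u" using *(1-4) UV x by (simp add: M.r_neg M.a_comm)
        finally show ?thesis
          using *(1-4) UV x by (simp add: smult_l_distr smult_l_minus a_minus_def)
      qed
      then have d: "(a \<ominus>\<^bsub>K\<^esub> b) \<odot>\<^bsub>V\<^esub> x \<in> U" using * U' by simp
      have "a = b"
      proof (rule ccontr)
        assume "a \<noteq> b"
        then have nz: "a \<ominus>\<^bsub>K\<^esub> b \<noteq> \<zero>\<^bsub>K\<^esub>" "a \<ominus>\<^bsub>K\<^esub> b \<in> carrier K" using * by auto
        then have "x = inv\<^bsub>K\<^esub> (a \<ominus>\<^bsub>K\<^esub> b) \<odot>\<^bsub>V\<^esub> ((a \<ominus>\<^bsub>K\<^esub> b) \<odot>\<^bsub>V\<^esub> x)"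
          using mult_inverse[OF nz(2) x(1) refl nz(1)] by simp
        moreover have "inv\<^bsub>K\<^esub> (a \<ominus>\<^bsub>K\<^esub> b) \<in> carrier K" using nz by (simp add: field_Units)
        ultimately show False using d U' x by metis
      qed
      then show "u = v \<and> a = b" using * UV x M.add.right_cancel by auto
    qed
    then show "card (adjoin U x) = card (carrier K) * card U"
      by (simp add: adjoin_def card_image card_cartesian_product)
  qed
qed

end

text \<open>
  The Gaussian binomial coefficient, in a form without division. It determines the cardinality because
  the product on the left is not zero.
\<close>

theorem card_grassmannian:
  assumes V: "vectorspace K V" and fin_KV: "finite (carrier K)" "finite (carrier V)"
    and n: "card (carrier V) = card (carrier K) ^ n"
  shows "card (grassmannian K V k) * (\<Prod>i<k. card (carrier K) ^ k - card (carrier K) ^ i)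
    = (\<Prod>i<k. card (carrier K) ^ n - card (carrier K) ^ i)"
proof -
  interpret vectorspace K V by fact
  interpret flats "card (carrier K)" "{U. subspace K U V}" adjoin
    using flats_subspaces[OF fin_KV] .
  have sub: "{\<zero>\<^bsub>V\<^esub>} \<subseteq> U" "U \<subseteq> carrier V" if "subspace K U V" for U
    using that by (simp_all add: subspace_iff)
  have dim: "vectorspace.dim K (V\<lparr>carrier := U\<rparr>) = k \<longleftrightarrow> card U = card (carrier K) ^ k" if "subspace K U V" for U
    unfolding card_subspace[OF V that fin_KV] using q_gt_1 by simp
  have "grassmannian K V k = {U \<in> {U. subspace K U V}. {\<zero>\<^bsub>V\<^esub>} \<subseteq> U \<and> U \<subseteq> carrier V \<and>
      card U = card (carrier K) ^ k * card {\<zero>\<^bsub>V\<^esub>}}"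
    unfolding grassmannian_def using sub dim by auto
  moreover have "subspace K {\<zero>\<^bsub>V\<^esub>} V" "subspace K (carrier V) V" by (simp_all add: subspace_iff)
  ultimately show ?thesis
    using card_flats[of "{\<zero>\<^bsub>V\<^esub>}" "carrier V" n k] n by simp
qed

lemma card_carrier_coord_space: "card (carrier (coord_space R n)) = card (carrier R) ^ n"
  by (simp add: coord_space_def card_PiE)

section \<open>Integral matrices of determinant one\<close>

definition SL :: "nat \<Rightarrow> int mat set" where
  "SL n = {A \<in> carrier_mat n n. det A = 1}"

lemma SL_carrier: "A \<in> SL n \<Longrightarrow> A \<in> carrier_mat n n" by (simp add: SL_def)

lemma mult_entry:
  assumes "A \<in> carrier_mat n n" "B \<in> carrier_mat n n" "r < n" "c < n"
  shows "(A * B) $$ (r, c) = (\<Sum>k<n. A $$ (r, k) * B $$ (k, c))"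
  using assms by (auto simp: scalar_prod_def lessThan_atLeast0 intro!: sum.cong)

lemma one_SL: "1\<^sub>m n \<in> SL n" by (simp add: SL_def)

lemma mult_SL: "A \<in> SL n \<Longrightarrow> B \<in> SL n \<Longrightarrow> A * B \<in> SL n"
  by (auto simp: SL_def det_mult[of _ n])

lemma adj_SL:
  assumes "A \<in> SL n"
  shows "adj_mat A \<in> SL n" "A * adj_mat A = 1\<^sub>m n" "adj_mat A * A = 1\<^sub>m n"
proof -
  have A: "A \<in> carrier_mat n n" "det A = 1" using assms by (auto simp: SL_def)
  note adj = adj_mat[OF A(1)]
  show *: "A * adj_mat A = 1\<^sub>m n" "adj_mat A * A = 1\<^sub>m n"
    using adj A by (auto intro!: eq_matI)
  have "det A * det (adj_mat A) = 1"
    using * det_mult[OF A(1) adj(1)] by simp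
  then show "adj_mat A \<in> SL n" using adj(1) A by (simp add: SL_def)
qed

lemma adj_SL_sum:
  assumes "A \<in> SL n" "j < n" "k < n"
  shows "(\<Sum>r<n. adj_mat A $$ (j, r) * A $$ (r, k)) = of_bool (j = k)"
    and "(\<Sum>r<n. A $$ (j, r) * adj_mat A $$ (r, k)) = of_bool (j = k)"
proof -
  note c = SL_carrier[OF assms(1)] SL_carrier[OF adj_SL(1)[OF assms(1)]]
  show "(\<Sum>r<n. adj_mat A $$ (j, r) * A $$ (r, k)) = of_bool (j = k)"
    unfolding mult_entry[OF c(2,1) assms(2,3), symmetric] adj_SL(3)[OF assms(1)] using assms by simp
  show "(\<Sum>r<n. A $$ (j, r) * adj_mat A $$ (r, k)) = of_bool (j = k)"
    unfolding mult_entry[OF c assms(2,3), symmetric] adj_SL(2)[OF assms(1)] using assms by simp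
qed

subsection \<open>Matrices supported in a diagonal block\<close>

text \<open>
  Matrices that differ from the identity only in the diagonal block with indices \<open>i..<l\<close>. Multiplying a
  frame by them from the right changes only those members of its flag whose dimension lies strictly
  between \<open>i\<close> and \<open>l\<close>.
\<close>

definition block_SL :: "nat \<Rightarrow> nat \<Rightarrow> nat \<Rightarrow> int mat set" where
  "block_SL n i l = {K \<in> SL n. \<forall>r<n. \<forall>c<n. r \<notin> {i..<l} \<or> c \<notin> {i..<l} \<longrightarrow> K $$ (r, c) = of_bool (r = c)}"

lemma block_SL_one: "1\<^sub>m n \<in> block_SL n i l"
  by (auto simp: block_SL_def one_SL)

lemma block_SL_entry:
  "K \<in> block_SL n i l \<Longrightarrow> r < n \<Longrightarrow> c < n \<Longrightarrow> r \<notin> {i..<l} \<or> c \<notin> {i..<l} \<Longrightarrow> K $$ (r, c) = of_bool (r = c)"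
  by (simp add: block_SL_def)

lemma block_SL_mult:
  assumes "K \<in> block_SL n i l" "K' \<in> block_SL n i l"
  shows "K * K' \<in> block_SL n i l"
proof -
  have KK: "K \<in> carrier_mat n n" "K' \<in> carrier_mat n n" using assms by (auto simp: block_SL_def SL_def)
  have "(K * K') $$ (r, c) = of_bool (r = c)" if "r < n" "c < n" "r \<notin> {i..<l} \<or> c \<notin> {i..<l}" for r c
  proof -
    have *: "(K * K') $$ (r, c) = (\<Sum>k<n. K $$ (r, k) * K' $$ (k, c))"
      using mult_entry[OF KK that(1,2)] .
    show ?thesis
    proof (cases "r \<in> {i..<l}")
      case False
      have "(\<Sum>k<n. K $$ (r, k) * K' $$ (k, c)) = (\<Sum>k<n. if r = k then K' $$ (k, c) else 0)"
        using block_SL_entry[OF assms(1) that(1)] False by (intro sum.cong) auto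
      then show ?thesis using * block_SL_entry[OF assms(2) that(1,2)] False that(1) by simp
    next
      case True
      then have c: "c \<notin> {i..<l}" using that by blast
      have "(\<Sum>k<n. K $$ (r, k) * K' $$ (k, c)) = (\<Sum>k<n. if k = c then K $$ (r, k) else 0)"
        using block_SL_entry[OF assms(2) _ that(2)] c by (intro sum.cong) auto
      then show ?thesis using * block_SL_entry[OF assms(1) that(1,2)] c that(2) by simp
    qed
  qed
  then show ?thesis using assms mult_SL by (auto simp: block_SL_def)
qed

lemma block_SL_addrow:
  assumes "r \<noteq> s" "r \<in> {i..<l}" "s \<in> {i..<l}"
  shows "addrow_mat n a r s \<in> block_SL n i l"
  using assms by (auto simp: block_SL_def SL_def det_addrow_mat)

text \<open>
  Modulo \<open>m\<close>, the vector with entries \<open>c r\<close> is \<open>g\<close> times the first column of a matrix in the block. For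
  \<open>m = 0\<close> this is an equation.
\<close>

definition column_rep :: "nat \<Rightarrow> nat \<Rightarrow> nat \<Rightarrow> int \<Rightarrow> int \<Rightarrow> (nat \<Rightarrow> int) \<Rightarrow> bool" where
  "column_rep n i l m g c \<longleftrightarrow> (\<exists>K\<in>block_SL n i l. \<forall>r\<in>{i..<l}. [c r = g * K $$ (r, i)] (mod m))"

text \<open>
  Undoing an elementary row operation.
\<close>

lemma column_rep_add:
  assumes "column_rep n i l m g (c(r := c r - a * c s))" "r \<noteq> s" "r \<in> {i..<l}" "s \<in> {i..<l}" "l \<le> n"
  shows "column_rep n i l m g c"
proof -
  obtain K where K: "K \<in> block_SL n i l"
    "\<And>x. x \<in> {i..<l} \<Longrightarrow> [(c(r := c r - a * c s)) x = g * K $$ (x, i)] (mod m)"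
    using assms(1) by (auto simp: column_rep_def)
  let ?T = "addrow_mat n a r s"
  have Kc: "K \<in> carrier_mat n n" using K by (simp add: block_SL_def SL_def)
  have entry: "(?T * K) $$ (x, i) = K $$ (x, i) + (if x = r then a * K $$ (s, i) else 0)" if "x \<in> {i..<l}" for x
  proof -
    have "?T * K = addrow a r s K" using addrow_mat[OF Kc, of s] assms by simp
    then show ?thesis using that assms Kc by auto
  qed
  have "[c x = g * (?T * K) $$ (x, i)] (mod m)" if x: "x \<in> {i..<l}" for x
  proof (cases "x = r")
    case True
    have 1: "[c r - a * c s = g * K $$ (r, i)] (mod m)" using K(2)[OF assms(3)] by simp
    have 2: "[c s = g * K $$ (s, i)] (mod m)" using K(2)[OF assms(4)] assms(2) by simp
    have "[(c r - a * c s) + a * c s = g * K $$ (r, i) + a * (g * K $$ (s, i))] (mod m)"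
      using 1 2 by (intro cong_add cong_scalar_left)
    then show ?thesis using entry[OF x] True by (simp add: algebra_simps)
  next
    case False
    then show ?thesis using K(2)[OF x] entry[OF x] by simp
  qed
  moreover have "?T * K \<in> block_SL n i l" using K(1) assms block_SL_addrow block_SL_mult by blast
  ultimately show ?thesis unfolding column_rep_def by blast
qed

lemma column_rep_one:
  assumes "[c i = g] (mod m)" "\<And>r. r \<in> {i..<l} \<Longrightarrow> r \<noteq> i \<Longrightarrow> [c r = 0] (mod m)" "l \<le> n"
  shows "column_rep n i l m g c"
  unfolding column_rep_def using assms block_SL_one by (intro bexI[of _ "1\<^sub>m n"]) auto

text \<open>
  Euclid's algorithm on the entries of \<open>c\<close>; the factor is their greatest common divisor up to sign.
\<close>

theorem integral_column:
  assumes "i < l" "l \<le> n"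
  shows "\<exists>g. column_rep n i l 0 g c"
proof (induction "\<Sum>r\<in>{i..<l}. nat \<bar>c r\<bar>" arbitrary: c rule: less_induct)
  case less
  show ?case
  proof (cases "\<exists>r\<in>{i..<l}. \<exists>s\<in>{i..<l}. r \<noteq> s \<and> c s \<noteq> 0 \<and> \<bar>c s\<bar> \<le> \<bar>c r\<bar>")
    case True
    then obtain r s where rs: "r \<in> {i..<l}" "s \<in> {i..<l}" "r \<noteq> s" "c s \<noteq> 0" "\<bar>c s\<bar> \<le> \<bar>c r\<bar>" by blast
    define a where "a = sgn (c r) * sgn (c s)"
    have a: "\<bar>c r - a * c s\<bar> < \<bar>c r\<bar>"
      using rs(4,5) by (auto simp: a_def sgn_if abs_if split: if_splits)
    have "(\<Sum>x\<in>{i..<l}. nat \<bar>(c(r := c r - a * c s)) x\<bar>) < (\<Sum>x\<in>{i..<l}. nat \<bar>c x\<bar>)"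
      using rs(1) a by (intro sum_strict_mono_ex1) auto
    from less[OF this] show ?thesis using column_rep_add rs assms by blast
  next
    case False
    have uniq: "c s = 0 \<or> c r = 0" if rs: "r \<in> {i..<l}" "s \<in> {i..<l}" "r \<noteq> s" for r s
    proof (rule ccontr)
      assume *: "\<not> (c s = 0 \<or> c r = 0)"
      show False
      proof (cases "\<bar>c s\<bar> \<le> \<bar>c r\<bar>")
        case True
        then show False using False rs * by blast
      next
        case F: False
        then have "\<bar>c r\<bar> \<le> \<bar>c s\<bar>" by simp
        then show False using False rs * by metis
      qed
    qed
    show ?thesis
    proof (cases "\<exists>r\<in>{i..<l}. r \<noteq> i \<and> c r \<noteq> 0")
      case False
      then have "column_rep n i l 0 (c i) c" using assms by (intro column_rep_one) auto
      then show ?thesis ..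
    next
      case True
      then obtain r where r: "r \<in> {i..<l}" "r \<noteq> i" "c r \<noteq> 0" by blast
      have i: "i \<in> {i..<l}" using assms by simp
      have z: "c x = 0" if "x \<in> {i..<l}" "x \<noteq> r" for x using uniq[OF that(1) r(1) that(2)] r by blast
      \<comment> \<open>The only nonzero entry is moved from position \<open>r\<close> to position \<open>i\<close>.\<close>
      let ?d = "c(i := c i - (- 1) * c r)"
      have "column_rep n i l 0 (c r) (?d(r := ?d r - 1 * ?d i))"
        using z i r by (intro column_rep_one assms) auto
      then have "column_rep n i l 0 (c r) ?d" using r i assms by (intro column_rep_add[of n i l 0 "c r" ?d r 1 i]) auto
      then show ?thesis using column_rep_add[of n i l 0 "c r" c i "- 1" r] r i assms by blast
    qed
  qed
qed

text \<open>
  Modulo a prime the factor can be one, provided that the block has at least two rows: with the help of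
  an entry that is a unit, a second entry is made congruent to one.
\<close>

theorem modular_column:
  fixes p :: int
  assumes "prime p" "Suc i < l" "l \<le> n" and c: "b \<in> {i..<l}" "\<not> p dvd c b"
  shows "column_rep n i l p 1 c"
proof -
  have one: "column_rep n i l p 1 c" if "[c i = 1] (mod p)" for c
    using that
  proof (induction "card {r \<in> {i..<l} - {i}. \<not> p dvd c r}" arbitrary: c rule: less_induct)
    case less
    show ?case
    proof (cases "\<exists>r\<in>{i..<l} - {i}. \<not> p dvd c r")
      case True
      then obtain r where r: "r \<in> {i..<l}" "r \<noteq> i" "\<not> p dvd c r" by blast
      let ?d = "c(r := c r - c r * c i)"
      have "p dvd c r * (1 - c i)" using less.prems by (simp add: cong_iff_dvd_diff dvd_diff_commute)
      then have "p dvd c r - c r * c i" by (simp add: algebra_simps)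
      then have "{x \<in> {i..<l} - {i}. \<not> p dvd ?d x} \<subset> {x \<in> {i..<l} - {i}. \<not> p dvd c x}" using r by auto
      then have "card {x \<in> {i..<l} - {i}. \<not> p dvd ?d x} < card {x \<in> {i..<l} - {i}. \<not> p dvd c x}"
        by (intro psubset_card_mono) auto
      moreover have "[?d i = 1] (mod p)" using less.prems r by simp
      ultimately have "column_rep n i l p 1 ?d" by (rule less.hyps)
      then show ?thesis using column_rep_add[of n i l p 1 c r "c r" i] r assms by simp
    next
      case False
      then show ?thesis using less.prems assms by (intro column_rep_one) (auto simp: cong_0_iff)
    qed
  qed
  have two: "column_rep n i l p 1 c" if a: "a \<in> {i..<l}" "a \<noteq> i" "\<not> p dvd c a" for a c
  proof -
    have "coprime (c a) p" using a assms prime_imp_coprime coprime_commute by blast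
    then obtain u where u: "[c a * u = 1] (mod p)" using cong_solve_coprime_int by blast
    let ?t = "- ((1 - c i) * u)"
    have "[c i - ?t * c a = c i + (1 - c i) * (c a * u)] (mod p)" by (simp add: algebra_simps)
    also have "[c i + (1 - c i) * (c a * u) = c i + (1 - c i) * 1] (mod p)"
      using u by (intro cong_add cong_refl cong_scalar_left)
    finally have "[c i - ?t * c a = 1] (mod p)" by simp
    then have "column_rep n i l p 1 (c(i := c i - ?t * c a))" by (intro one) simp
    then show ?thesis using column_rep_add[of n i l p 1 c i ?t a] a assms by auto
  qed
  show ?thesis
  proof (cases "\<exists>a\<in>{i..<l} - {i}. \<not> p dvd c a")
    case True
    then show ?thesis using two by blast
  next
    case False
    then have *: "\<not> p dvd c i" "p dvd c (Suc i)" using c assms by (cases "b = i"; auto)+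
    let ?d = "c(Suc i := c (Suc i) - (- 1) * c i)"
    have "\<not> p dvd ?d (Suc i)" using * by (simp add: dvd_add_right_iff)
    then have "column_rep n i l p 1 ?d" using assms by (intro two[of "Suc i"]) auto
    then show ?thesis using column_rep_add[of n i l p 1 c "Suc i" "- 1" i] assms by auto
  qed
qed

subsection \<open>Leading minors\<close>

definition lead :: "nat \<Rightarrow> int mat \<Rightarrow> int" where
  "lead s g = det (mat s s (\<lambda>(i, j). g $$ (i, j)))"

lemma cong_det:
  fixes A B :: "int mat"
  assumes "A \<in> carrier_mat n n" "B \<in> carrier_mat n n"
    and "\<And>i j. i < n \<Longrightarrow> j < n \<Longrightarrow> [A $$ (i, j) = B $$ (i, j)] (mod m)"
  shows "[det A = det B] (mod m)"
proof -
  have "[signof \<pi> * (\<Prod>i = 0..<n. A $$ (i, \<pi> i)) = signof \<pi> * (\<Prod>i = 0..<n. B $$ (i, \<pi> i))] (mod m)"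
    if "\<pi> permutes {0..<n}" for \<pi>
  proof (intro cong_scalar_left cong_prod assms)
    fix i assume "i \<in> {0..<n}"
    then show "i < n" "\<pi> i < n" using permutes_in_image[OF that, of i] by auto
  qed
  then have "[(\<Sum>\<pi> | \<pi> permutes {0..<n}. signof \<pi> * (\<Prod>i = 0..<n. A $$ (i, \<pi> i)))
      = (\<Sum>\<pi> | \<pi> permutes {0..<n}. signof \<pi> * (\<Prod>i = 0..<n. B $$ (i, \<pi> i)))] (mod m)"
    by (intro cong_sum) auto
  then show ?thesis using assms(1,2) by (simp add: det_def)
qed

lemma lead_cong:
  "(\<And>i j. i < s \<Longrightarrow> j < s \<Longrightarrow> [g $$ (i, j) = h $$ (i, j)] (mod m)) \<Longrightarrow> [lead s g = lead s h] (mod m)"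
  unfolding lead_def by (rule cong_det[of _ s]) auto

lemma lead_full: "g \<in> carrier_mat n n \<Longrightarrow> lead n g = det g"
  unfolding lead_def by (rule arg_cong[of _ _ det]) (auto intro: eq_matI)

lemma lead_one: "s \<le> n \<Longrightarrow> lead s (1\<^sub>m n) = 1"
proof -
  assume "s \<le> n"
  then have "mat s s (\<lambda>(i, j). (1\<^sub>m n :: int mat) $$ (i, j)) = 1\<^sub>m s" by (auto intro: eq_matI)
  then show ?thesis by (simp add: lead_def)
qed

text \<open>
  The leading block of a product is the product of the leading blocks up to terms with a factor from
  the lower left part of \<open>h\<close>, which vanish modulo \<open>m\<close>.
\<close>

lemma lead_mult:
  assumes g: "g \<in> carrier_mat n n" "h \<in> carrier_mat n n" "s \<le> n"
    and low: "\<And>r c. s \<le> r \<Longrightarrow> r < n \<Longrightarrow> c < s \<Longrightarrow> [h $$ (r, c) = 0] (mod m)"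
  shows "[lead s (g * h) = lead s g * lead s h] (mod m)"
proof -
  let ?G = "mat s s (\<lambda>(i, j). g $$ (i, j))" and ?H = "mat s s (\<lambda>(i, j). h $$ (i, j))"
  have "[(g * h) $$ (i, j) = (?G * ?H) $$ (i, j)] (mod m)" if "i < s" "j < s" for i j
  proof -
    have "(g * h) $$ (i, j) = (\<Sum>k<n. g $$ (i, k) * h $$ (k, j))"
      by (rule mult_entry) (use that g in auto)
    also have "{..<n} = {..<s} \<union> {s..<n}" using g by auto
    also have "(\<Sum>k\<in>{..<s} \<union> {s..<n}. g $$ (i, k) * h $$ (k, j))
        = (\<Sum>k<s. g $$ (i, k) * h $$ (k, j)) + (\<Sum>k\<in>{s..<n}. g $$ (i, k) * h $$ (k, j))"
      by (intro sum.union_disjoint) auto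
    finally have "(g * h) $$ (i, j)
        = (\<Sum>k<s. g $$ (i, k) * h $$ (k, j)) + (\<Sum>k\<in>{s..<n}. g $$ (i, k) * h $$ (k, j))" .
    moreover have "[(\<Sum>k\<in>{s..<n}. g $$ (i, k) * h $$ (k, j)) = (\<Sum>k\<in>{s..<n}. g $$ (i, k) * 0)] (mod m)"
      using low that by (intro cong_sum cong_scalar_left) auto
    moreover have "(?G * ?H) $$ (i, j) = (\<Sum>k<s. g $$ (i, k) * h $$ (k, j))"
      by (subst mult_entry[of _ s]) (use that in auto)
    ultimately show ?thesis using cong_add[OF cong_refl] by fastforce
  qed
  then have "[lead s (g * h) = det (?G * ?H)] (mod m)"
    unfolding lead_def by (intro cong_det[of _ s]) auto
  then show ?thesis by (simp add: lead_def det_mult[of _ s])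
qed

lemma lead_unit:
  assumes "g \<in> SL n" "s \<le> n"
    and "\<And>r c. s \<le> r \<Longrightarrow> r < n \<Longrightarrow> c < s \<Longrightarrow> [g $$ (r, c) = 0] (mod m)"
  shows "[lead s (adj_mat g) * lead s g = 1] (mod m)"
  using lead_mult[OF SL_carrier[OF adj_SL(1)] SL_carrier, OF assms(1,1,2), of m] assms
  by (simp add: adj_SL lead_one cong_sym_eq)

lemma lead_triangular:
  assumes "\<And>i j. j < i \<Longrightarrow> i < s \<Longrightarrow> [g $$ (i, j) = 0] (mod m)"
  shows "[lead s g = (\<Prod>i<s. g $$ (i, i))] (mod m)"
proof -
  let ?T = "mat s s (\<lambda>(i, j). if j < i then 0 else g $$ (i, j))"
  have "[lead s g = det ?T] (mod m)"
    unfolding lead_def using assms by (intro cong_det[of _ s]) auto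
  moreover have "det ?T = (\<Prod>i<s. g $$ (i, i))"
    by (subst det_upper_triangular[of _ s]) (auto simp: prod_list_diag_prod lessThan_atLeast0)
  ultimately show ?thesis by simp
qed

section \<open>Column spans over the rationals and modulo a prime\<close>

definition qspan :: "nat \<Rightarrow> int mat \<Rightarrow> nat \<Rightarrow> rat vec set" where
  "qspan n A s = {v \<in> carrier_vec n. \<exists>c. \<forall>r<n. v $ r = (\<Sum>j<s. of_int (A $$ (r, j)) * c j)}"

definition mspan :: "nat \<Rightarrow> nat \<Rightarrow> int mat \<Rightarrow> nat \<Rightarrow> (nat \<Rightarrow> int) set" where
  "mspan n p A s = {v \<in> {..<n} \<rightarrow>\<^sub>E {0..int p - 1}. \<exists>c. \<forall>r<n. [v r = (\<Sum>j<s. A $$ (r, j) * c j)] (mod int p)}"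

text \<open>
  The image in \<open>F\<^sub>p\<^sup>n\<close> of the integral vectors of \<open>W\<close>.
\<close>

definition reduction :: "nat \<Rightarrow> nat \<Rightarrow> rat vec set \<Rightarrow> (nat \<Rightarrow> int) set" where
  "reduction n p W = {v \<in> {..<n} \<rightarrow>\<^sub>E {0..int p - 1}.
     \<exists>x. vec n (\<lambda>r. of_int (x r)) \<in> W \<and> (\<forall>r<n. [v r = x r] (mod int p))}"

lemma sum_mult_columns:
  fixes d :: "nat \<Rightarrow> 'a :: comm_ring_1"
  assumes "A \<in> carrier_mat n n" "h \<in> carrier_mat n n" "s \<le> n" "r < n"
  shows "(\<Sum>j<s. of_int ((A * h) $$ (r, j)) * d j) = (\<Sum>k<n. of_int (A $$ (r, k)) * (\<Sum>j<s. of_int (h $$ (k, j)) * d j))"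
proof -
  have "(\<Sum>j<s. of_int ((A * h) $$ (r, j)) * d j) = (\<Sum>j<s. \<Sum>k<n. of_int (A $$ (r, k)) * (of_int (h $$ (k, j)) * d j))"
    using assms
    by (intro sum.cong) (auto simp: mult_entry[of A n h] sum_distrib_right mult.assoc simp del: index_mult_mat(1))
  also have "\<dots> = (\<Sum>k<n. \<Sum>j<s. of_int (A $$ (r, k)) * (of_int (h $$ (k, j)) * d j))" by (rule sum.swap)
  finally show ?thesis by (simp add: sum_distrib_left)
qed

lemma sum_adj_columns:
  fixes c :: "nat \<Rightarrow> 'a :: comm_ring_1"
  assumes "A \<in> SL n" "s \<le> n" "k < n"
  shows "(\<Sum>r<n. of_int (adj_mat A $$ (k, r)) * (\<Sum>j<s. of_int (A $$ (r, j)) * c j)) = (if k < s then c k else 0)"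
proof -
  have "(\<Sum>r<n. of_int (adj_mat A $$ (k, r)) * (\<Sum>j<s. of_int (A $$ (r, j)) * c j))
      = (\<Sum>j<s. of_int ((adj_mat A * A) $$ (k, j)) * c j)"
    using sum_mult_columns[of "adj_mat A" n A s k c] SL_carrier adj_SL(1) assms by simp
  also have "\<dots> = (\<Sum>j<s. if k = j then c j else 0)"
    using assms adj_SL by (intro sum.cong) auto
  finally show ?thesis by simp
qed

lemma sum_lessThan_split:
  fixes f :: "nat \<Rightarrow> 'a :: comm_monoid_add"
  shows "s \<le> n \<Longrightarrow> (\<Sum>k<n. f k) = (\<Sum>k<s. f k) + (\<Sum>k\<in>{s..<n}. f k)"
  by (subst sum.union_disjoint[symmetric]) (auto intro: sum.cong)

lemma sum_mult_of_bool_eq: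
  fixes f :: "nat \<Rightarrow> 'a :: comm_ring_1"
  shows "c < s \<Longrightarrow> (\<Sum>j<s. f j * of_bool (j = c)) = f c"
proof -
  assume "c < s"
  have "(\<Sum>j<s. f j * of_bool (j = c)) = (\<Sum>j<s. if j = c then f j else 0)"
    by (intro sum.cong) auto
  then show ?thesis using \<open>c < s\<close> by simp
qed

lemma block_SL_columns:
  assumes A: "A \<in> carrier_mat n n" and K: "K \<in> block_SL n k l" and kl: "k < l" "l \<le> n" and r: "r < n"
  shows "j < k \<Longrightarrow> (A * K) $$ (r, j) = A $$ (r, j)"
    and "(A * K) $$ (r, k) = (\<Sum>m\<in>{k..<l}. A $$ (r, m) * K $$ (m, k))"
proof -
  have Kc: "K \<in> carrier_mat n n" using K by (simp add: block_SL_def SL_def)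
  have kn: "k < n" using kl by simp
  show "(A * K) $$ (r, j) = A $$ (r, j)" if "j < k"
  proof -
    have "(A * K) $$ (r, j) = (\<Sum>m<n. A $$ (r, m) * of_bool (m = j))"
      unfolding mult_entry[OF A Kc r order.strict_trans[OF that kn]]
      using block_SL_entry[OF K] that kn by (intro sum.cong) auto
    then show ?thesis using that kn by (simp add: sum_mult_of_bool_eq)
  qed
  show "(A * K) $$ (r, k) = (\<Sum>m\<in>{k..<l}. A $$ (r, m) * K $$ (m, k))"
    unfolding mult_entry[OF A Kc r kn]
    using block_SL_entry[OF K] kl by (intro sum.mono_neutral_right) auto
qed

subsection \<open>Rational spans\<close>

text \<open>
  A block triangular matrix in \<open>SL n\<close> has a leading block that is invertible over the integers, so
  multiplication by it only changes the integral basis of the span of the first \<open>s\<close> columns.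
\<close>

lemma qspan_mult:
  assumes A: "A \<in> SL n" and h: "h \<in> SL n" and s: "s \<le> n"
    and low: "\<And>r c. s \<le> r \<Longrightarrow> r < n \<Longrightarrow> c < s \<Longrightarrow> h $$ (r, c) = 0"
  shows "qspan n (A * h) s = qspan n A s"
proof (intro equalityI subsetI)
  note Ac = SL_carrier[OF A] and hc = SL_carrier[OF h]
  have upper: "(\<Sum>k<n. of_int (A $$ (r, k)) * (\<Sum>j<s. of_int (h $$ (k, j)) * d j))
      = (\<Sum>k<s. of_int (A $$ (r, k)) * (\<Sum>j<s. of_int (h $$ (k, j)) * d j))" for r and d :: "nat \<Rightarrow> rat"
    using s low by (simp add: sum_lessThan_split[OF s])
  {
    fix v assume "v \<in> qspan n (A * h) s"
    then obtain d where v: "v \<in> carrier_vec n" "\<forall>r<n. v $ r = (\<Sum>j<s. of_int ((A * h) $$ (r, j)) * d j)"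
      by (auto simp: qspan_def)
    then show "v \<in> qspan n A s" 
      using sum_mult_columns[OF Ac hc s, of _ d] upper[of _ d] by (auto simp: qspan_def)
  next
    fix v assume "v \<in> qspan n A s"
    then obtain d where v: "v \<in> carrier_vec n" "\<forall>r<n. v $ r = (\<Sum>j<s. of_int (A $$ (r, j)) * d j)"
      by (auto simp: qspan_def)
    \<comment> \<open>The leading block of \<open>h\<close> is invertible, because its product with that of the inverse is 1.\<close>
    define X where "X = mat s s (\<lambda>(i, j). adj_mat h $$ (i, j))"
    define H where "H = mat s s (\<lambda>(i, j). h $$ (i, j))"
    have XH: "X * H = 1\<^sub>m s"
    proof (rule eq_matI)
      fix i j assume ij: "i < dim_row (1\<^sub>m s)" "j < dim_col (1\<^sub>m s)"
      have "(X * H) $$ (i, j) = (\<Sum>k<s. X $$ (i, k) * H $$ (k, j))"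
        using ij by (intro mult_entry) (auto simp: X_def H_def)
      also have "\<dots> = (\<Sum>k<s. adj_mat h $$ (i, k) * h $$ (k, j))"
        using ij by (intro sum.cong) (auto simp: X_def H_def)
      also have "\<dots> = (\<Sum>k<n. adj_mat h $$ (i, k) * h $$ (k, j))"
        using ij low by (simp add: sum_lessThan_split[OF s])
      also have "\<dots> = 1\<^sub>m s $$ (i, j)" using ij s by (simp add: adj_SL_sum[OF h])
      finally show "(X * H) $$ (i, j) = 1\<^sub>m s $$ (i, j)" .
    qed (auto simp: X_def H_def)
    have HX: "H * X = 1\<^sub>m s"
    proof -
      have c: "X \<in> carrier_mat s s" "H \<in> carrier_mat s s" by (auto simp: X_def H_def)
      have "det X * det H = 1" using det_mult[OF c] XH by simp
      then have "det H * det H = 1" "H * (det H \<cdot>\<^sub>m adj_mat H) = (det H * det H) \<cdot>\<^sub>m 1\<^sub>m s"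
        using adj_mat[OF c(2)] c by (auto simp: zmult_eq_1_iff mult_smult_distrib intro!: eq_matI)
      then have R: "H * (det H \<cdot>\<^sub>m adj_mat H) = 1\<^sub>m s" by (auto intro!: eq_matI)
      define Y where "Y = det H \<cdot>\<^sub>m adj_mat H"
      have Y: "Y \<in> carrier_mat s s" "H * Y = 1\<^sub>m s" using adj_mat[OF c(2)] R by (auto simp: Y_def)
      have "X = X * (H * Y)" using Y c by simp
      also have "\<dots> = (X * H) * Y" using assoc_mult_mat[OF c Y(1)] by simp
      also have "\<dots> = Y" using XH Y by simp
      finally show ?thesis using Y by simp
    qed
    define c where "c = (\<lambda>j. \<Sum>m<s. of_int (X $$ (j, m)) * d m)"
    have Hc: "(\<Sum>j<s. of_int (h $$ (k, j)) * c j) = d k" if "k < s" for k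
    proof -
      have "(\<Sum>j<s. of_int (h $$ (k, j)) * c j) = (\<Sum>j<s. of_int (H $$ (k, j)) * c j)"
        using that by (intro sum.cong) (auto simp: H_def)
      also have "\<dots> = (\<Sum>m<s. of_int ((H * X) $$ (k, m)) * d m)"
        unfolding c_def using that by (intro sum_mult_columns[symmetric]) (auto simp: X_def H_def)
      also have "\<dots> = (\<Sum>m<s. if k = m then d m else 0)"
        unfolding HX using that by (intro sum.cong) auto
      finally show ?thesis using that by simp
    qed
    have "v $ r = (\<Sum>j<s. of_int ((A * h) $$ (r, j)) * c j)" if "r < n" for r
      using v that sum_mult_columns[OF Ac hc s that, of c] upper[of r c] Hc by simp
    then show "v \<in> qspan n (A * h) s" using v by (auto simp: qspan_def)
  }
qed

lemma qspan_block:
  assumes "A \<in> SL n" "K \<in> block_SL n i l" "s \<le> n" "s \<le> i \<or> l \<le> s"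
  shows "qspan n (A * K) s = qspan n A s"
proof (rule qspan_mult)
  fix r c assume "s \<le> r" "r < n" "c < s"
  then show "K $$ (r, c) = 0" using block_SL_entry[OF assms(2), of r c] assms(4) by auto
qed (use assms in \<open>auto simp: block_SL_def\<close>)

lemma qspan_subset_low:
  assumes A: "A \<in> SL n" "A' \<in> SL n" and s: "s \<le> n" and sub: "qspan n A s \<subseteq> qspan n A' s"
    and rc: "s \<le> r" "r < n" "c < s"
  shows "(adj_mat A' * A) $$ (r, c) = 0"
proof -
  have "vec n (\<lambda>k. of_int (A $$ (k, c))) \<in> qspan n A s"
    unfolding qspan_def using rc s
    by (auto intro!: exI[of _ "\<lambda>j. of_bool (j = c)"] simp: sum_mult_of_bool_eq simp del: of_bool_eq_iff)
  with sub have "vec n (\<lambda>k. of_int (A $$ (k, c))) \<in> qspan n A' s" by blast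
  then obtain d :: "nat \<Rightarrow> rat" where "\<forall>k<n. of_int (A $$ (k, c)) = (\<Sum>j<s. of_int (A' $$ (k, j)) * d j)"
    by (auto simp: qspan_def)
  then have "(\<Sum>k<n. of_int (adj_mat A' $$ (r, k)) * of_int (A $$ (k, c))) = (if r < s then d r else 0)"
    using sum_adj_columns[OF A(2) s rc(2), of d] by simp
  then have "of_int (\<Sum>k<n. adj_mat A' $$ (r, k) * A $$ (k, c)) = (0 :: rat)" using rc by simp
  then have "(\<Sum>k<n. adj_mat A' $$ (r, k) * A $$ (k, c)) = 0" by (simp only: of_int_eq_0_iff)
  then show ?thesis
    using mult_entry[OF SL_carrier[OF adj_SL(1)[OF A(2)]] SL_carrier[OF A(1)] rc(2), of c] rc s by simp
qed

lemma qspan_0: "qspan n A 0 = {0\<^sub>v n}"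
  by (auto simp: qspan_def)

lemma qspan_full:
  assumes "A \<in> SL n"
  shows "qspan n A n = carrier_vec n"
proof -
  have "v \<in> qspan n A n" if v: "v \<in> carrier_vec n" for v
  proof -
    define c :: "nat \<Rightarrow> rat" where "c j = (\<Sum>k<n. of_int (adj_mat A $$ (j, k)) * v $ k)" for j
    have "v $ r = (\<Sum>j<n. of_int (A $$ (r, j)) * c j)" if "r < n" for r
    proof -
      have "(\<Sum>j<n. of_int (A $$ (r, j)) * c j)
          = (\<Sum>k<n. of_int ((A * adj_mat A) $$ (r, k)) * v $ k)"
        unfolding c_def
        by (rule sum_mult_columns[OF SL_carrier SL_carrier, OF assms adj_SL(1)[OF assms] order_refl that, symmetric])
      also have "\<dots> = (\<Sum>k<n. v $ k * of_bool (k = r))"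
        unfolding adj_SL(2)[OF assms] using that by (intro sum.cong) auto
      finally show ?thesis using that by (simp add: sum_mult_of_bool_eq)
    qed
    then show ?thesis unfolding qspan_def using v by (intro CollectI conjI exI[of _ c] allI impI)
  qed
  then show ?thesis by (auto simp: qspan_def)
qed

lemma qspan_mono: "s \<le> t \<Longrightarrow> qspan n A s \<subseteq> qspan n A t"
proof
  fix v assume "s \<le> t" "v \<in> qspan n A s"
  then obtain c where v: "v \<in> carrier_vec n" "\<forall>r<n. v $ r = (\<Sum>j<s. of_int (A $$ (r, j)) * c j)"
    by (auto simp: qspan_def)
  have "(\<Sum>j<s. of_int (A $$ (r, j)) * c j) = (\<Sum>j<t. of_int (A $$ (r, j)) * (if j < s then c j else 0))" for r
    using \<open>s \<le> t\<close> by (intro sum.mono_neutral_cong_left) auto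
  then show "v \<in> qspan n A t" using v by (auto simp: qspan_def)
qed

subsection \<open>Spans modulo a prime\<close>

lemma mspan_cong:
  assumes "\<And>r j. r < n \<Longrightarrow> j < s \<Longrightarrow> [A $$ (r, j) = B $$ (r, j)] (mod int p)"
  shows "mspan n p A s = mspan n p B s"
proof -
  have sub: "mspan n p A s \<subseteq> mspan n p B s"
    if AB: "\<And>r j. r < n \<Longrightarrow> j < s \<Longrightarrow> [A $$ (r, j) = B $$ (r, j)] (mod int p)" for A B
  proof
    fix v assume "v \<in> mspan n p A s"
    then obtain c where v: "v \<in> {..<n} \<rightarrow>\<^sub>E {0..int p - 1}"
        "\<forall>r<n. [v r = (\<Sum>j<s. A $$ (r, j) * c j)] (mod int p)" by (auto simp: mspan_def)
    have "[v r = (\<Sum>j<s. B $$ (r, j) * c j)] (mod int p)" if "r < n" for r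
    proof -
      have "[(\<Sum>j<s. A $$ (r, j) * c j) = (\<Sum>j<s. B $$ (r, j) * c j)] (mod int p)"
        using AB that by (intro cong_sum cong_scalar_right) auto
      then show ?thesis using v(2) that cong_trans by blast
    qed
    then show "v \<in> mspan n p B s" unfolding mspan_def using v(1) by (intro CollectI conjI exI[of _ c]) auto
  qed
  show ?thesis
    by (intro equalityI sub assms) (use assms cong_sym in blast)+
qed

lemma mspan_mult_subset:
  assumes A: "A \<in> carrier_mat n n" and h: "h \<in> carrier_mat n n" and s: "s \<le> n"
    and low: "\<And>r c. s \<le> r \<Longrightarrow> r < n \<Longrightarrow> c < s \<Longrightarrow> [h $$ (r, c) = 0] (mod int p)"
  shows "mspan n p (A * h) s \<subseteq> mspan n p A s"
proof
  fix v assume "v \<in> mspan n p (A * h) s"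
  then obtain d where v: "v \<in> {..<n} \<rightarrow>\<^sub>E {0..int p - 1}"
      "\<forall>r<n. [v r = (\<Sum>j<s. (A * h) $$ (r, j) * d j)] (mod int p)" by (auto simp: mspan_def)
  define c where "c k = (\<Sum>j<s. h $$ (k, j) * d j)" for k
  have "[v r = (\<Sum>k<s. A $$ (r, k) * c k)] (mod int p)" if r: "r < n" for r
  proof -
    have "(\<Sum>j<s. (A * h) $$ (r, j) * d j) = (\<Sum>k<s. A $$ (r, k) * c k) + (\<Sum>k\<in>{s..<n}. A $$ (r, k) * c k)"
      using sum_mult_columns[OF A h s r, of d] by (simp add: c_def sum_lessThan_split[OF s])
    moreover have "[(\<Sum>k\<in>{s..<n}. A $$ (r, k) * c k) = (\<Sum>k\<in>{s..<n}. A $$ (r, k) * (\<Sum>j<s. 0 * d j))] (mod int p)"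
      unfolding c_def using low by (intro cong_sum cong_scalar_left cong_scalar_right) auto
    ultimately have "[(\<Sum>j<s. (A * h) $$ (r, j) * d j) = (\<Sum>k<s. A $$ (r, k) * c k)] (mod int p)"
      using cong_add[OF cong_refl] by fastforce
    then show ?thesis using v r cong_trans by blast
  qed
  then show "v \<in> mspan n p A s" using v by (auto simp: mspan_def)
qed

lemma mspan_coordinates:
  assumes A: "A \<in> SL n" and s: "s \<le> n" and k: "k < n"
    and v: "\<forall>r<n. [v r = (\<Sum>j<s. A $$ (r, j) * c j)] (mod int p)"
  shows "[(\<Sum>r<n. adj_mat A $$ (k, r) * v r) = (if k < s then c k else 0)] (mod int p)"
proof -
  have "[(\<Sum>r<n. adj_mat A $$ (k, r) * v r) = (\<Sum>r<n. adj_mat A $$ (k, r) * (\<Sum>j<s. A $$ (r, j) * c j))] (mod int p)"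
    using v by (intro cong_sum cong_scalar_left) auto
  then show ?thesis using sum_adj_columns[OF A s k, of c] by simp
qed

lemma mspan_subset_low:
  assumes A: "A \<in> SL n" "A' \<in> SL n" and s: "s \<le> n" and sub: "mspan n p A s \<subseteq> mspan n p A' s"
    and p: "p > 0" and rc: "s \<le> r" "r < n" "c < s"
  shows "[(adj_mat A' * A) $$ (r, c) = 0] (mod int p)"
proof -
  let ?v = "\<lambda>k\<in>{..<n}. A $$ (k, c) mod int p"
  have "(\<Sum>j<s. A $$ (k, j) * of_bool (j = c)) = A $$ (k, c)" for k
    using rc by (simp add: sum_mult_of_bool_eq)
  then have "?v \<in> mspan n p A s"
    unfolding mspan_def using p by (auto intro!: exI[of _ "\<lambda>j. of_bool (j = c)"] simp: cong_def)
  with sub have "?v \<in> mspan n p A' s" by blast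
  then obtain d where d: "\<forall>k<n. [?v k = (\<Sum>j<s. A' $$ (k, j) * d j)] (mod int p)"
    by (auto simp: mspan_def)
  have "[(adj_mat A' * A) $$ (r, c) = (\<Sum>k<n. adj_mat A' $$ (r, k) * ?v k)] (mod int p)"
  proof -
    have "(adj_mat A' * A) $$ (r, c) = (\<Sum>k<n. adj_mat A' $$ (r, k) * A $$ (k, c))"
      using mult_entry[OF SL_carrier[OF adj_SL(1)[OF A(2)]] SL_carrier[OF A(1)] rc(2), of c] rc s by simp
    moreover have "[(\<Sum>k<n. adj_mat A' $$ (r, k) * A $$ (k, c)) = (\<Sum>k<n. adj_mat A' $$ (r, k) * ?v k)] (mod int p)"
      by (intro cong_sum cong_scalar_left) (auto simp: cong_def)
    ultimately show ?thesis by simp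
  qed
  also have "[(\<Sum>k<n. adj_mat A' $$ (r, k) * ?v k) = 0] (mod int p)"
    using mspan_coordinates[OF A(2) s rc(2) d] rc by simp
  finally show ?thesis .
qed

lemma card_mspan:
  assumes A: "A \<in> SL n" and s: "s \<le> n" and p: "p > 0"
  shows "card (mspan n p A s) = p ^ s"
proof -
  let ?f = "\<lambda>c. \<lambda>r\<in>{..<n}. (\<Sum>j<s. A $$ (r, j) * c j) mod int p"
  have f: "\<forall>r<n. [?f c r = (\<Sum>j<s. A $$ (r, j) * c j)] (mod int p)" for c by (simp add: cong_def)
  have "bij_betw ?f ({..<s} \<rightarrow>\<^sub>E {0..int p - 1}) (mspan n p A s)"
  proof (rule bij_betwI')
    fix c d assume cd: "c \<in> {..<s} \<rightarrow>\<^sub>E {0..int p - 1}" "d \<in> {..<s} \<rightarrow>\<^sub>E {0..int p - 1}"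
    show "?f c = ?f d \<longleftrightarrow> c = d"
    proof
      assume eq: "?f c = ?f d"
      have "c k = d k" if "k < s" for k
      proof -
        have kn: "k < n" using that s by simp
        have 1: "[(\<Sum>r<n. adj_mat A $$ (k, r) * ?f c r) = c k] (mod int p)" for c
          using mspan_coordinates[OF A s kn f[of c]] unfolding if_P[OF that] .
        have "[c k = d k] (mod int p)"
          using cong_trans[OF cong_sym[OF 1[of c, unfolded eq]] 1[of d]] .
        moreover have "c k \<in> {0..int p - 1}" "d k \<in> {0..int p - 1}"
          using PiE_mem[OF cd(1), of k] PiE_mem[OF cd(2), of k] that by blast+
        ultimately show ?thesis by (simp add: cong_def)
      qed
      then show "c = d" by (intro PiE_ext[OF cd]) simp
    qed simp
  next
    fix c
    have "?f c \<in> {..<n} \<rightarrow>\<^sub>E {0..int p - 1}" using p by auto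
    then show "?f c \<in> mspan n p A s"
      unfolding mspan_def by (intro CollectI conjI exI[of _ c] f)
  next
    fix v assume "v \<in> mspan n p A s"
    then obtain c where v: "v \<in> {..<n} \<rightarrow>\<^sub>E {0..int p - 1}"
      "\<forall>r<n. [v r = (\<Sum>j<s. A $$ (r, j) * c j)] (mod int p)" by (auto simp: mspan_def)
    let ?c = "\<lambda>j\<in>{..<s}. c j mod int p"
    have "?f ?c r = v r" if "r < n" for r
    proof -
      have "[(\<Sum>j<s. A $$ (r, j) * ?c j) = (\<Sum>j<s. A $$ (r, j) * c j)] (mod int p)"
        by (intro cong_sum cong_scalar_left) (auto simp: cong_def)
      then have "[(\<Sum>j<s. A $$ (r, j) * ?c j) = v r] (mod int p)" using v that cong_sym cong_trans by blast
      moreover have "v r \<in> {0..int p - 1}" using v that by auto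
      ultimately show ?thesis using that by (simp add: cong_def)
    qed
    then have "v = ?f ?c" using v by (intro PiE_ext[of v "{..<n}" "\<lambda>_. {0..int p - 1}"]) (use p in auto)
    moreover have "?c \<in> {..<s} \<rightarrow>\<^sub>E {0..int p - 1}" using p by auto
    ultimately show "\<exists>c\<in>{..<s} \<rightarrow>\<^sub>E {0..int p - 1}. v = ?f c" by blast
  qed
  then have "card (mspan n p A s) = card ({..<s} \<rightarrow>\<^sub>E {0..int p - 1})" by (simp add: bij_betw_same_card)
  then show ?thesis by (simp add: card_PiE)
qed

lemma finite_mspan: "finite (mspan n p A s)"
  by (rule finite_subset[of _ "{..<n} \<rightarrow>\<^sub>E {0..int p - 1}"]) (auto simp: mspan_def intro: finite_PiE)

lemma mspan_full:
  assumes "A \<in> SL n" "p > 0"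
  shows "mspan n p A n = {..<n} \<rightarrow>\<^sub>E {0..int p - 1}"
  using card_mspan[OF assms(1) order_refl assms(2)]
  by (intro card_subset_eq) (auto simp: mspan_def card_PiE intro: finite_PiE)

lemma mspan_0:
  assumes "p > 0"
  shows "mspan n p A 0 = {\<lambda>r\<in>{..<n}. 0}"
proof -
  have "v = (\<lambda>r\<in>{..<n}. 0)" if "v \<in> mspan n p A 0" for v
  proof
    fix r
    have v: "v \<in> {..<n} \<rightarrow>\<^sub>E {0..int p - 1}" "r < n \<Longrightarrow> [v r = 0] (mod int p)"
      using that by (auto simp: mspan_def)
    show "v r = (\<lambda>r\<in>{..<n}. 0) r"
    proof (cases "r < n")
      case True
      then have "v r \<in> {0..int p - 1}" using PiE_mem[OF v(1), of r] by blast
      then show ?thesis using v(2) True by (simp add: cong_def)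
    next
      case False
      then show ?thesis using PiE_arb[OF v(1), of r] by simp
    qed
  qed
  moreover have "(\<lambda>r\<in>{..<n}. 0) \<in> mspan n p A 0" using assms by (auto simp: mspan_def)
  ultimately show ?thesis by blast
qed

lemma mspan_mono: 
  assumes "s \<le> t" shows "mspan n p A s \<subseteq> mspan n p A t"
proof
  fix v assume "v \<in> mspan n p A s"
  then obtain c where v: "v \<in> {..<n} \<rightarrow>\<^sub>E {0..int p - 1}"
      "\<forall>r<n. [v r = (\<Sum>j<s. A $$ (r, j) * c j)] (mod int p)" by (auto simp: mspan_def)
  have "(\<Sum>j<s. A $$ (r, j) * c j) = (\<Sum>j<t. A $$ (r, j) * (if j < s then c j else 0))" for r
    using assms by (intro sum.mono_neutral_cong_left) auto
  then show "v \<in> mspan n p A t" using v by (auto simp: mspan_def)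
qed

text \<open>
  Reduction depends only on the rational subspace, so this makes \<open>mspan\<close> an invariant of it.
\<close>

lemma reduction_qspan:
  assumes A: "A \<in> SL n" and s: "s \<le> n"
  shows "reduction n p (qspan n A s) = mspan n p A s"
proof (intro equalityI subsetI)
  fix v assume "v \<in> reduction n p (qspan n A s)"
  then obtain x c where v: "v \<in> {..<n} \<rightarrow>\<^sub>E {0..int p - 1}" "\<forall>r<n. [v r = x r] (mod int p)"
    and x: "\<forall>r<n. of_int (x r) = (\<Sum>j<s. of_int (A $$ (r, j)) * (c j :: rat))"
    by (auto simp: reduction_def qspan_def)
  \<comment> \<open>The inverse of \<open>A\<close> is integral, so the coefficients of an integral vector are integers.\<close>
  define d where "d k = (\<Sum>r<n. adj_mat A $$ (k, r) * x r)" for k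
  have "of_int (d k) = c k" if "k < s" for k
    using sum_adj_columns[OF A s, of k c] that s x by (simp add: d_def)
  then have "(of_int (x r) :: rat) = of_int (\<Sum>j<s. A $$ (r, j) * d j)" if "r < n" for r
    using x that by simp
  then have "x r = (\<Sum>j<s. A $$ (r, j) * d j)" if "r < n" for r using that by (simp only: of_int_eq_iff)
  then show "v \<in> mspan n p A s" using v unfolding mspan_def by auto
next
  fix v assume "v \<in> mspan n p A s"
  then obtain c where v: "v \<in> {..<n} \<rightarrow>\<^sub>E {0..int p - 1}"
      "\<forall>r<n. [v r = (\<Sum>j<s. A $$ (r, j) * c j)] (mod int p)" by (auto simp: mspan_def)
  define x where "x r = (\<Sum>j<s. A $$ (r, j) * c j)" for r
  have "\<forall>r<n. vec n (\<lambda>r. of_int (x r)) $ r = (\<Sum>j<s. of_int (A $$ (r, j)) * (of_int (c j) :: rat))"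
    by (simp add: x_def)
  then have "vec n (\<lambda>r. of_int (x r)) \<in> qspan n A s"
    unfolding qspan_def by (intro CollectI conjI exI[of _ "\<lambda>j. of_int (c j)"]) auto
  moreover have "\<forall>r<n. [v r = x r] (mod int p)" using v(2) by (simp add: x_def)
  ultimately show "v \<in> reduction n p (qspan n A s)"
    unfolding reduction_def using v(1) by blast
qed

section \<open>Subspaces with a label\<close>

text \<open>
  A representative of the class of \<open>a\<close> modulo \<open>p\<close> up to sign.
\<close>

definition unsigned :: "nat \<Rightarrow> int \<Rightarrow> int" where
  "unsigned p a = min (a mod int p) ((- a) mod int p)"

locale odd_prime =
  fixes p :: nat
  assumes prime_p: "prime p" and p_ge_3: "p \<ge> 3"
begin

lemma p_pos: "p > 0" using p_ge_3 by simp

lemma prime_int_p: "prime (int p)" using prime_p by simp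

lemma unsigned_eq_iff: "unsigned p a = unsigned p b \<longleftrightarrow> [a = b] (mod int p) \<or> [a = - b] (mod int p)"
proof -
  have neg: "(- x) mod int p = (if x mod int p = 0 then 0 else int p - x mod int p)" for x
    by (simp add: zmod_zminus1_eq_if)
  define x y where "x = a mod int p" and "y = b mod int p"
  have "0 \<le> x" "x < int p" "0 \<le> y" "y < int p" using p_pos by (auto simp: x_def y_def)
  then show ?thesis
    unfolding unsigned_def cong_def neg x_def[symmetric] y_def[symmetric] by (simp add: min_def) arith
qed

lemma unsigned_mem:
  assumes "\<not> int p dvd a"
  shows "unsigned p a \<in> {1..(int p - 1) div 2}"
proof -
  have neg: "(- a) mod int p = int p - a mod int p" and nz: "a mod int p \<noteq> 0"
    using assms by (auto simp: zmod_zminus1_eq_if dvd_eq_mod_eq_0)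
  define x where "x = a mod int p"
  have r: "0 \<le> x" "x < int p" using p_pos by (auto simp: x_def)
  have "odd (int p)" using prime_p p_ge_3 prime_odd_nat by auto
  then have "2 * ((int p - 1) div 2) = int p - 1" by simp
  then show ?thesis using r nz unfolding unsigned_def neg x_def[symmetric] by (auto simp: min_def)
qed

lemma unsigned_id:
  assumes "u \<in> {1..(int p - 1) div 2}"
  shows "unsigned p u = u" "\<not> int p dvd u"
proof -
  have u: "0 < u" "2 * u < int p" using assms by auto
  then show "unsigned p u = u" by (auto simp: unsigned_def zmod_zminus1_eq_if)
  show "\<not> int p dvd u" using u zdvd_not_zless by auto
qed

lemma unit_dvd: "[a * b = 1] (mod int p) \<Longrightarrow> \<not> int p dvd b"
proof
  assume "[a * b = 1] (mod int p)" "int p dvd b"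
  then have "int p dvd 1" by (metis cong_dvd_iff dvd_mult)
  then show False using p_ge_3 by simp
qed

lemma unsigned_mult_eq_iff:
  assumes "\<not> int p dvd a"
  shows "unsigned p (a * b) = unsigned p a \<longleftrightarrow> unsigned p b = 1"
proof -
  have c: "coprime a (int p)" using assms prime_int_p prime_imp_coprime coprime_commute by blast
  have "unsigned p 1 = 1" using unsigned_id(1)[of 1] p_ge_3 by auto
  then have "unsigned p b = 1 \<longleftrightarrow> unsigned p b = unsigned p 1" by simp
  also have "\<dots> \<longleftrightarrow> [a * b = a * 1] (mod int p) \<or> [a * b = a * (- 1)] (mod int p)"
    unfolding unsigned_eq_iff
    using cong_mult_lcancel[OF c, of b 1] cong_mult_lcancel[OF c, of b "- 1"] by blast
  finally show ?thesis by (simp add: unsigned_eq_iff)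
qed

lemma unsigned_cong: "[a = b] (mod int p) \<Longrightarrow> unsigned p a = unsigned p b"
  by (simp add: unsigned_eq_iff)

text \<open>
  An arbitrary reference basis for the subspace \<open>U\<close> of \<open>F\<^sub>p\<^sup>n\<close>, lifted to the integers.
\<close>

definition frame :: "nat \<Rightarrow> nat \<Rightarrow> (nat \<Rightarrow> int) set \<Rightarrow> int mat" where
  "frame n s U = (SOME A. A \<in> SL n \<and> mspan n p A s = U)"

text \<open>
  The determinant, up to sign, that expresses the first \<open>s\<close> columns of \<open>A\<close> in the reference basis of
  the subspace that they span modulo \<open>p\<close>.
\<close>

definition label :: "nat \<Rightarrow> int mat \<Rightarrow> nat \<Rightarrow> int" where
  "label n A s = unsigned p (lead s (adj_mat (frame n s (mspan n p A s)) * A))"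

definition vertex :: "nat \<Rightarrow> int mat \<Rightarrow> nat \<Rightarrow> (nat \<Rightarrow> int) set \<times> int" where
  "vertex n A s = (mspan n p A s, label n A s)"

lemma frame:
  assumes "A \<in> SL n"
  shows "frame n s (mspan n p A s) \<in> SL n" "mspan n p (frame n s (mspan n p A s)) s = mspan n p A s"
proof -
  have "frame n s (mspan n p A s) \<in> SL n \<and> mspan n p (frame n s (mspan n p A s)) s = mspan n p A s"
    unfolding frame_def by (rule someI[of _ A]) (use assms in simp)
  then show "frame n s (mspan n p A s) \<in> SL n" "mspan n p (frame n s (mspan n p A s)) s = mspan n p A s" by auto
qed

lemma lead_transition_unit:
  assumes "A \<in> SL n" "R \<in> SL n" "s \<le> n" "mspan n p R s = mspan n p A s"
  shows "\<not> int p dvd lead s (adj_mat R * A)"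
proof (rule unit_dvd, rule lead_unit)
  show "adj_mat R * A \<in> SL n" using mult_SL adj_SL assms by blast
  show "[(adj_mat R * A) $$ (r, c) = 0] (mod int p)" if "s \<le> r" "r < n" "c < s" for r c
    using mspan_subset_low[OF assms(1-3) _ p_pos that] assms(4) by simp
qed fact

lemma label_mem:
  assumes "A \<in> SL n" "s \<le> n"
  shows "label n A s \<in> {1..(int p - 1) div 2}"
  unfolding label_def
  using unsigned_mem[OF lead_transition_unit[OF assms(1) frame(1)[OF assms(1)] assms(2) frame(2)[OF assms(1)]]] .

text \<open>
  This controls how the label depends on the frame.
\<close>

lemma lead_transition:
  assumes A: "A \<in> SL n" "g \<in> SL n" "R \<in> SL n" "s \<le> n"
    and low: "\<And>r c. s \<le> r \<Longrightarrow> r < n \<Longrightarrow> c < s \<Longrightarrow> [g $$ (r, c) = 0] (mod int p)"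
  shows "[lead s (adj_mat R * (A * g)) = lead s (adj_mat R * A) * lead s g] (mod int p)"
proof -
  have c: "adj_mat R \<in> carrier_mat n n" "A \<in> carrier_mat n n" "g \<in> carrier_mat n n"
    using assms SL_carrier adj_SL by auto
  have "adj_mat R * (A * g) = adj_mat R * A * g" using assoc_mult_mat[OF c] by simp
  then show ?thesis using lead_mult[of "adj_mat R * A" n g s] c A(4) low by simp
qed

lemma mspan_mult:
  assumes "A \<in> SL n" "g \<in> SL n" "s \<le> n"
    and "\<And>r c. s \<le> r \<Longrightarrow> r < n \<Longrightarrow> c < s \<Longrightarrow> [g $$ (r, c) = 0] (mod int p)"
  shows "mspan n p (A * g) s = mspan n p A s"
proof (rule card_subset_eq[OF finite_mspan])
  show "mspan n p (A * g) s \<subseteq> mspan n p A s"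
    using SL_carrier[OF assms(1)] SL_carrier[OF assms(2)] assms(3,4) by (rule mspan_mult_subset)
  show "card (mspan n p (A * g) s) = card (mspan n p A s)"
    using card_mspan[OF mult_SL[OF assms(1,2)] assms(3) p_pos] card_mspan[OF assms(1,3) p_pos] by simp
qed

lemma transition:
  assumes "A \<in> SL n" "A' \<in> SL n"
  shows "A' * (adj_mat A' * A) = A" "adj_mat A' * A \<in> SL n"
proof -
  have c: "A' \<in> carrier_mat n n" "adj_mat A' \<in> carrier_mat n n" "A \<in> carrier_mat n n"
    using assms SL_carrier adj_SL by auto
  have "A' * (adj_mat A' * A) = A' * adj_mat A' * A" using assoc_mult_mat[OF c] by simp
  then show "A' * (adj_mat A' * A) = A" using adj_SL(2)[OF assms(2)] c by simp
  show "adj_mat A' * A \<in> SL n" using mult_SL adj_SL assms by blast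
qed

lemma vertex_mult_eq_iff:
  assumes "A \<in> SL n" "g \<in> SL n" "s \<le> n"
    and low: "\<And>r c. s \<le> r \<Longrightarrow> r < n \<Longrightarrow> c < s \<Longrightarrow> [g $$ (r, c) = 0] (mod int p)"
  shows "vertex n (A * g) s = vertex n A s \<longleftrightarrow> unsigned p (lead s g) = 1"
proof -
  let ?R = "frame n s (mspan n p A s)"
  note R = frame[OF assms(1), of s]
  have m: "mspan n p (A * g) s = mspan n p A s" using assms by (rule mspan_mult)
  have "[lead s (adj_mat ?R * (A * g)) = lead s (adj_mat ?R * A) * lead s g] (mod int p)"
    using assms(1,2) R(1) assms(3) low by (rule lead_transition)
  then have "label n (A * g) s = unsigned p (lead s (adj_mat ?R * A) * lead s g)"
    unfolding label_def m by (rule unsigned_cong)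
  moreover have "\<not> int p dvd lead s (adj_mat ?R * A)"
    using lead_transition_unit[OF assms(1) R(1) assms(3) R(2)] .
  ultimately show ?thesis
    using unsigned_mult_eq_iff[of "lead s (adj_mat ?R * A)" "lead s g"] m by (simp add: vertex_def label_def)
qed

lemma vertex_eq_iff:
  assumes "A \<in> SL n" "A' \<in> SL n" "s \<le> n"
  shows "vertex n A s = vertex n A' s \<longleftrightarrow> mspan n p A s = mspan n p A' s \<and> unsigned p (lead s (adj_mat A' * A)) = 1"
proof (cases "mspan n p A s = mspan n p A' s")
  case True
  then have "[(adj_mat A' * A) $$ (r, c) = 0] (mod int p)" if "s \<le> r" "r < n" "c < s" for r c
    using mspan_subset_low[OF assms _ p_pos that] by simp
  with assms(2) transition(2)[OF assms(1,2)] assms(3)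
  have "vertex n (A' * (adj_mat A' * A)) s = vertex n A' s \<longleftrightarrow> unsigned p (lead s (adj_mat A' * A)) = 1"
    by (rule vertex_mult_eq_iff)
  then show ?thesis unfolding transition(1)[OF assms(1,2)] using True by simp
qed (simp add: vertex_def)

lemma vertex_cong:
  assumes "A \<in> SL n" "B \<in> SL n" "s \<le> n"
    and eq: "\<And>i j. i < n \<Longrightarrow> j < n \<Longrightarrow> [A $$ (i, j) = B $$ (i, j)] (mod int p)"
  shows "vertex n A s = vertex n B s"
proof -
  have m: "mspan n p A s = mspan n p B s" using eq assms(3) by (intro mspan_cong) auto
  let ?R = "frame n s (mspan n p B s)"
  have Rc: "adj_mat ?R \<in> carrier_mat n n" using frame[OF assms(2)] adj_SL SL_carrier by blast
  have "[(adj_mat ?R * A) $$ (i, j) = (adj_mat ?R * B) $$ (i, j)] (mod int p)" if "i < n" "j < n" for i j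
    unfolding mult_entry[OF Rc SL_carrier[OF assms(1)] that] mult_entry[OF Rc SL_carrier[OF assms(2)] that]
    using eq that by (intro cong_sum cong_scalar_left) auto
  then have "[lead s (adj_mat ?R * A) = lead s (adj_mat ?R * B)] (mod int p)"
    using assms(3) by (intro lead_cong) auto
  then show ?thesis using m unsigned_cong by (simp add: vertex_def label_def)
qed

text \<open>
  Two integral frames of the same rational subspace differ by an integral matrix of determinant \<open>\<plusminus>1\<close>.
\<close>

lemma vertex_eq_of_qspan_eq:
  assumes "A \<in> SL n" "A' \<in> SL n" "s \<le> n" "qspan n A s = qspan n A' s"
  shows "vertex n A s = vertex n A' s"
proof -
  have "mspan n p A s = mspan n p A' s"
    using reduction_qspan[OF assms(1,3), of p] reduction_qspan[OF assms(2,3), of p] assms(4) by simp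
  moreover have "unsigned p (lead s (adj_mat A' * A)) = 1"
  proof -
    let ?g = "adj_mat A' * A"
    have "?g $$ (r, c) = 0" if "s \<le> r" "r < n" "c < s" for r c
      using qspan_subset_low[OF assms(1-3) _ that] assms(4) by simp
    then have "[lead s (adj_mat ?g) * lead s ?g = 1] (mod 0)"
      using lead_unit[OF transition(2)[OF assms(1,2)] assms(3), of 0] by simp
    then have "lead s (adj_mat ?g) * lead s ?g = 1" by simp
    then have "lead s ?g = 1 \<or> lead s ?g = - 1" using zmult_eq_1_iff by blast
    then have "unsigned p (lead s ?g) = unsigned p 1" by (auto simp: unsigned_eq_iff)
    then show ?thesis using unsigned_id(1)[of 1] p_ge_3 by auto
  qed
  ultimately show ?thesis using vertex_eq_iff[OF assms(1-3)] by simp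
qed

lemma congruence_subgroup_iff:
  "G \<in> congruence_subgroup n p \<longleftrightarrow> G \<in> SL n \<and>
    (\<forall>i<n. \<forall>j<n. [G $$ (i, j) = (1\<^sub>m n :: int mat) $$ (i, j)] (mod int p))"
proof -
  have *: "map_mat (\<lambda>a. a mod int p) G = 1\<^sub>m n \<longleftrightarrow>
      (\<forall>i<n. \<forall>j<n. [G $$ (i, j) = (1\<^sub>m n :: int mat) $$ (i, j)] (mod int p))" if "G \<in> carrier_mat n n"
  proof -
    have one: "(1\<^sub>m n :: int mat) $$ (i, j) mod int p = (1\<^sub>m n :: int mat) $$ (i, j)" if "i < n" "j < n" for i j
      using that p_ge_3 by simp
    have "map_mat (\<lambda>a. a mod int p) G = 1\<^sub>m n \<longleftrightarrow>
      (\<forall>i<n. \<forall>j<n. map_mat (\<lambda>a. a mod int p) G $$ (i, j) = (1\<^sub>m n :: int mat) $$ (i, j))"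
      using that by (intro iffI eq_matI) auto
    also have "\<dots> \<longleftrightarrow> (\<forall>i<n. \<forall>j<n. [G $$ (i, j) = (1\<^sub>m n :: int mat) $$ (i, j)] (mod int p))"
      using that one by (simp add: cong_def del: index_one_mat)
    finally show ?thesis .
  qed
  show ?thesis
    unfolding congruence_subgroup_def SL_def mem_Collect_eq
    by (cases "G \<in> carrier_mat n n") (simp_all only: * simp_thms)
qed

lemma congruence_subgroup_mult:
  assumes "G \<in> congruence_subgroup n p" "A \<in> SL n" "i < n" "j < n"
  shows "[(G * A) $$ (i, j) = A $$ (i, j)] (mod int p)"
proof -
  have G: "G \<in> SL n" and G1: "\<And>k. k < n \<Longrightarrow> [G $$ (i, k) = (1\<^sub>m n :: int mat) $$ (i, k)] (mod int p)"
    using assms(1,3) congruence_subgroup_iff by auto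
  have "[(\<Sum>k<n. G $$ (i, k) * A $$ (k, j)) = (\<Sum>k<n. (1\<^sub>m n :: int mat) $$ (i, k) * A $$ (k, j))] (mod int p)"
    using G1 by (intro cong_sum cong_scalar_right) auto
  moreover have "(\<Sum>k<n. (1\<^sub>m n :: int mat) $$ (i, k) * A $$ (k, j)) = (1\<^sub>m n * A) $$ (i, j)"
    by (rule mult_entry[symmetric]) (use SL_carrier assms in auto)
  ultimately show ?thesis
    using mult_entry[OF SL_carrier[OF G] SL_carrier[OF assms(2)] assms(3,4)] SL_carrier[OF assms(2)] by simp
qed

theorem vertex_eq_of_orbit:
  assumes "G \<in> congruence_subgroup n p" "A \<in> SL n" "A' \<in> SL n" "s \<le> n" "qspan n (G * A) s = qspan n A' s"
  shows "vertex n A s = vertex n A' s"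
proof -
  have GA: "G * A \<in> SL n" using assms congruence_subgroup_iff mult_SL by blast
  have "vertex n (G * A) s = vertex n A s"
    using congruence_subgroup_mult[OF assms(1,2)] by (intro vertex_cong GA assms)
  then show ?thesis using vertex_eq_of_qspan_eq[OF GA assms(3,4,5)] by simp
qed

text \<open>
  The transition matrix \<open>g\<close> between the two frames is upper triangular modulo \<open>p\<close> because the
  reductions agree, and its leading minors are \<open>\<plusminus>1\<close> modulo \<open>p\<close> because the labels agree. It lifts to
  an integral triangular matrix \<open>h\<close> with diagonal entries \<open>\<plusminus>1\<close>, whose determinant is one because one and
  minus one differ modulo \<open>p\<close>. The matrix \<open>h\<close> preserves the flag, and \<open>A' * h\<close> is congruent to \<open>A\<close>.
\<close>

theorem orbit_of_vertices_eq:
  assumes A: "A \<in> SL n" "A' \<in> SL n" and eq: "\<And>s. 0 < s \<Longrightarrow> s < n \<Longrightarrow> vertex n A s = vertex n A' s"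
  shows "\<exists>G\<in>congruence_subgroup n p. \<forall>s\<le>n. qspan n (G * A) s = qspan n A' s"
proof -
  define g where "g = adj_mat A' * A"
  have g: "g \<in> SL n" "A' * g = A" using transition[OF A] by (auto simp: g_def)
  have gc: "g \<in> carrier_mat n n" using g SL_carrier by blast
  have tri: "[g $$ (r, c) = 0] (mod int p)" if "c < r" "r < n" for r c
  proof -
    have "fst (vertex n A r) = fst (vertex n A' r)" using eq[of r] that by simp
    then have "mspan n p A r \<subseteq> mspan n p A' r" by (simp add: vertex_def)
    then show ?thesis
      unfolding g_def using that by (intro mspan_subset_low[OF A _ _ p_pos, of r]) simp_all
  qed
  have lead1: "unsigned p (lead s g) = 1" if "s \<le> n" for s
  proof -
    have one: "unsigned p 1 = 1" using unsigned_id(1)[of 1] p_ge_3 by auto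
    have "s = 0 \<or> s = n \<or> 0 < s \<and> s < n" using that by linarith
    then consider "s = 0" | "s = n" | "0 < s" "s < n" by blast
    then show ?thesis
    proof cases
      case 1
      then show ?thesis using one by (simp add: lead_def)
    next
      case 2
      then show ?thesis using g gc one by (simp add: lead_full SL_def)
    next
      case 3
      then show ?thesis using eq vertex_eq_iff[OF A that] by (simp add: g_def)
    qed
  qed
  \<comment> \<open>The diagonal entries of \<open>g\<close> are quotients of successive leading minors.\<close>
  have diag: "[g $$ (s, s) = 1] (mod int p) \<or> [g $$ (s, s) = - 1] (mod int p)" if "s < n" for s
  proof -
    have 1: "[lead (Suc s) g = (\<Prod>i<Suc s. g $$ (i, i))] (mod int p)"
      using tri that by (intro lead_triangular) auto
    have 2: "[lead s g = (\<Prod>i<s. g $$ (i, i))] (mod int p)"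
      using tri that by (intro lead_triangular) auto
    have *: "[lead (Suc s) g = lead s g * g $$ (s, s)] (mod int p)"
      using cong_trans[OF 1[unfolded prod.lessThan_Suc] cong_sym[OF cong_scalar_right[OF 2]]] .
    have "unsigned p (lead s g * g $$ (s, s)) = unsigned p (lead s g)"
      using unsigned_cong[OF *] lead1 that by simp
    moreover have "\<not> int p dvd lead s g"
      using lead_transition_unit[OF A, of s] eq[of s] that
      by (cases "s = 0") (use p_ge_3 in \<open>auto simp: lead_def g_def vertex_def\<close>)
    ultimately have "unsigned p (g $$ (s, s)) = unsigned p 1"
      using unsigned_mult_eq_iff unsigned_id(1)[of 1] p_ge_3 by auto
    then show ?thesis by (simp add: unsigned_eq_iff)
  qed
  define e where "e s = (if [g $$ (s, s) = 1] (mod int p) then 1 else (- 1 :: int))" for s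
  have e: "[e s = g $$ (s, s)] (mod int p)" if "s < n" for s
    using diag[OF that] by (auto simp: e_def cong_sym_eq)
  define h where "h = mat n n (\<lambda>(i, j). if j < i then 0 else if i = j then e i else g $$ (i, j))"
  have hc: "h \<in> carrier_mat n n" by (simp add: h_def)
  have hg: "[h $$ (i, j) = g $$ (i, j)] (mod int p)" if "i < n" "j < n" for i j
    using that e tri[of j i] by (auto simp: h_def cong_sym_eq)
  have "det h = (\<Prod>i<n. e i)"
    by (subst det_upper_triangular[OF _ hc]) (auto simp: h_def prod_list_diag_prod lessThan_atLeast0)
  moreover have "(\<Prod>i<k. e i) = 1 \<or> (\<Prod>i<k. e i) = - 1" for k by (induction k) (auto simp: e_def)
  moreover have "[det h = 1] (mod int p)"
    using cong_det[OF hc gc hg] g(1) by (simp add: SL_def)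
  moreover have "\<not> [- 1 = 1] (mod int p)"
  proof
    assume "[- 1 = 1] (mod int p)"
    then have "int p dvd 2" by (simp add: cong_iff_dvd_diff)
    then show False using p_ge_3 zdvd_imp_le by fastforce
  qed
  ultimately have "det h = 1" by metis
  then have h: "h \<in> SL n" using hc by (simp add: SL_def)
  define G where "G = A' * h * adj_mat A"
  have cs: "A' \<in> carrier_mat n n" "adj_mat A \<in> carrier_mat n n" "A \<in> carrier_mat n n"
    using A SL_carrier adj_SL by auto
  have G: "G \<in> SL n" using A h mult_SL adj_SL by (simp add: G_def)
  have GA: "G * A = A' * h"
  proof -
    have "G * A = A' * h * (adj_mat A * A)"
      unfolding G_def by (rule assoc_mult_mat[OF mult_carrier_mat[OF cs(1) hc] cs(2,3)])
    then show ?thesis using cs hc adj_SL(3)[OF A(1)] by simp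
  qed
  have "[G $$ (i, j) = (1\<^sub>m n :: int mat) $$ (i, j)] (mod int p)" if ij: "i < n" "j < n" for i j
  proof -
    have "[(A' * h) $$ (i, k) = A $$ (i, k)] (mod int p)" if "k < n" for k
    proof -
      have "[(A' * h) $$ (i, k) = (A' * g) $$ (i, k)] (mod int p)"
        unfolding mult_entry[OF cs(1) hc ij(1) that] mult_entry[OF cs(1) gc ij(1) that]
        using hg that by (intro cong_sum cong_scalar_left) auto
      then show ?thesis using g by simp
    qed
    then have "[(A' * h * adj_mat A) $$ (i, j) = (A * adj_mat A) $$ (i, j)] (mod int p)"
      unfolding mult_entry[OF mult_carrier_mat[OF cs(1) hc] cs(2) ij] mult_entry[OF cs(3,2) ij]
      by (intro cong_sum cong_scalar_right) auto
    then show ?thesis unfolding G_def adj_SL(2)[OF A(1)] .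
  qed
  then have "G \<in> congruence_subgroup n p" using G congruence_subgroup_iff by blast
  moreover have "qspan n (G * A) s = qspan n A' s" if "s \<le> n" for s
    unfolding GA by (rule qspan_mult[OF A(2) h that]) (use that in \<open>auto simp: h_def\<close>)
  ultimately show ?thesis by blast
qed

end

section \<open>Moving one member of a flag\<close>

lemma residue_ring_carrier: "carrier (residue_ring m) = {0..m - 1}"
  by (simp add: residue_ring_def)

lemma mspanI:
  assumes "v \<in> {..<n} \<rightarrow>\<^sub>E {0..int p - 1}" "\<And>r. r < n \<Longrightarrow> [v r = (\<Sum>j<s. A $$ (r, j) * c j)] (mod int p)"
  shows "v \<in> mspan n p A s"
  using assms unfolding mspan_def by (intro CollectI conjI exI[of _ c]) auto

context odd_prime begin

abbreviation "F \<equiv> residue_ring (int p)"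
abbreviation "points n \<equiv> carrier (coord_space F n)"

lemma points_def: "points n = {..<n} \<rightarrow>\<^sub>E {0..int p - 1}"
  by (simp add: coord_space_def residue_ring_carrier)

lemma field_F: "field F"
proof -
  interpret residues_prime p F
    using prime_p p_ge_3 by unfold_locales auto
  show ?thesis by (rule is_field)
qed

lemma vectorspace_points: "vectorspace F (coord_space F n)"
  using vectorspace_coord_space[OF field_F] .

lemma finite_points: "finite (points n)" and card_F: "card (carrier F) = p" and finite_F: "finite (carrier F)"
  by (auto simp: points_def residue_ring_carrier intro: finite_PiE)

lemma mspan_points: "mspan n p A s \<subseteq> points n"
  by (auto simp: mspan_def points_def)

abbreviation "is_subspace n U \<equiv> subspace F U (coord_space F n)"

lemma subspace_points: "is_subspace n U \<Longrightarrow> U \<subseteq> points n"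
  by (simp add: vectorspace.subspace_iff[OF vectorspace_points])

lemma subspace_combination:
  assumes U: "is_subspace n U" "u \<in> U" "v \<in> U" and w: "w \<in> points n"
    and eq: "\<And>r. r < n \<Longrightarrow> [w r = a * u r + b * v r] (mod int p)"
  shows "w \<in> U"
proof -
  let ?M = "coord_space F n"
  have cl: "x \<oplus>\<^bsub>?M\<^esub> y \<in> U" "c \<odot>\<^bsub>?M\<^esub> x \<in> U" if "x \<in> U" "y \<in> U" "c \<in> carrier F" for x y c
    using U(1) that by (simp_all add: vectorspace.subspace_iff[OF vectorspace_points])
  have ab: "a mod int p \<in> carrier F" "b mod int p \<in> carrier F"
    using p_pos by (auto simp: residue_ring_carrier)
  have "(a mod int p \<odot>\<^bsub>?M\<^esub> u) \<oplus>\<^bsub>?M\<^esub> (b mod int p \<odot>\<^bsub>?M\<^esub> v) = w" (is "?z = w")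
  proof
    fix r
    show "?z r = w r"
    proof (cases "r < n")
      case True
      have "w r \<in> {0..int p - 1}" using PiE_mem[OF w[unfolded points_def], of r] True by simp
      then have "w r = w r mod int p" by simp
      also have "\<dots> = (a * u r + b * v r) mod int p" using eq[OF True] by (simp add: cong_def)
      finally show ?thesis using True
        by (simp add: coord_space_def residue_ring_def mod_simps)
    next
      case False
      then show ?thesis using PiE_arb[OF w[unfolded points_def], of r] by (simp add: coord_space_def)
    qed
  qed
  moreover have "?z \<in> U" by (intro cl(1)[OF _ _ ab(1)] cl(2)[OF _ U(2)] U(2,3) ab)
  ultimately show ?thesis by simp
qed

lemma subspace_mspan:
  assumes "A \<in> SL n"
  shows "is_subspace n (mspan n p A s)"
  unfolding vectorspace.subspace_iff[OF vectorspace_points]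
proof (intro conjI ballI mspan_points)
  have z: "\<zero>\<^bsub>coord_space F n\<^esub> = (\<lambda>r\<in>{..<n}. 0)" by (simp add: coord_space_def residue_ring_def)
  show "\<zero>\<^bsub>coord_space F n\<^esub> \<in> mspan n p A s"
    using mspan_0[OF p_pos, of n A] mspan_mono[of 0 s n p A] by (simp add: z)
next
  fix u v assume "u \<in> mspan n p A s" "v \<in> mspan n p A s"
  then obtain c d where c: "\<forall>r<n. [u r = (\<Sum>j<s. A $$ (r, j) * c j)] (mod int p)"
    and d: "\<forall>r<n. [v r = (\<Sum>j<s. A $$ (r, j) * d j)] (mod int p)" by (auto simp: mspan_def)
  have "[(u \<oplus>\<^bsub>coord_space F n\<^esub> v) r = (\<Sum>j<s. A $$ (r, j) * (c j + d j))] (mod int p)" if "r < n" for r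
  proof -
    have "[(u \<oplus>\<^bsub>coord_space F n\<^esub> v) r = u r + v r] (mod int p)"
      using that by (simp add: coord_space_def residue_ring_def cong_def)
    also have "[u r + v r = (\<Sum>j<s. A $$ (r, j) * c j) + (\<Sum>j<s. A $$ (r, j) * d j)] (mod int p)"
      using c d that by (intro cong_add) auto
    finally show ?thesis by (simp add: distrib_left sum.distrib)
  qed
  moreover have "u \<oplus>\<^bsub>coord_space F n\<^esub> v \<in> {..<n} \<rightarrow>\<^sub>E {0..int p - 1}"
    using p_pos by (auto simp: coord_space_def residue_ring_def)
  ultimately show "u \<oplus>\<^bsub>coord_space F n\<^esub> v \<in> mspan n p A s"
    unfolding mspan_def by (intro CollectI conjI exI[of _ "\<lambda>j. c j + d j"]) auto
next
  fix a u assume "u \<in> mspan n p A s"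
  then obtain c where c: "\<forall>r<n. [u r = (\<Sum>j<s. A $$ (r, j) * c j)] (mod int p)" by (auto simp: mspan_def)
  have "[(a \<odot>\<^bsub>coord_space F n\<^esub> u) r = (\<Sum>j<s. A $$ (r, j) * (a * c j))] (mod int p)" if "r < n" for r
  proof -
    have "[(a \<odot>\<^bsub>coord_space F n\<^esub> u) r = a * u r] (mod int p)"
      using that by (simp add: coord_space_def residue_ring_def cong_def)
    also have "[a * u r = a * (\<Sum>j<s. A $$ (r, j) * c j)] (mod int p)"
      using c that by (intro cong_scalar_left) auto
    finally show ?thesis by (simp add: sum_distrib_left mult_ac)
  qed
  moreover have "a \<odot>\<^bsub>coord_space F n\<^esub> u \<in> {..<n} \<rightarrow>\<^sub>E {0..int p - 1}"
    using p_pos by (auto simp: coord_space_def residue_ring_def)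
  ultimately show "a \<odot>\<^bsub>coord_space F n\<^esub> u \<in> mspan n p A s"
    unfolding mspan_def by (intro CollectI conjI exI[of _ "\<lambda>j. a * c j"]) auto
qed

text \<open>
  The new member is spanned by the old one and one vector. Its coordinates with respect to \<open>A\<close> in the
  block are not all divisible by \<open>p\<close>, so they form a column of a block matrix modulo \<open>p\<close>.
\<close>

lemma extend_mspan:
  assumes A: "A \<in> SL n" and kl: "Suc k < l" "l \<le> n"
    and U: "is_subspace n U" "mspan n p A k \<subseteq> U" "U \<subseteq> mspan n p A l" "card U = p ^ Suc k"
  shows "\<exists>K\<in>block_SL n k l. mspan n p (A * K) (Suc k) = U"
proof -
  have finU: "finite U" using U(1) subspace_points finite_points finite_subset by blast
  have "U \<noteq> mspan n p A k" using card_mspan[OF A _ p_pos, of k] U(4) kl p_ge_3 by auto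
  then obtain v where v: "v \<in> U" "v \<notin> mspan n p A k" using U(2) by blast
  then obtain c where vE: "v \<in> {..<n} \<rightarrow>\<^sub>E {0..int p - 1}"
    and c: "\<And>r. r < n \<Longrightarrow> [v r = (\<Sum>j<l. A $$ (r, j) * c j)] (mod int p)"
    using U(3) unfolding mspan_def by blast
  have split: "(\<Sum>j<l. A $$ (r, j) * c j) = (\<Sum>j<k. A $$ (r, j) * c j) + (\<Sum>j\<in>{k..<l}. A $$ (r, j) * c j)" for r
    using kl by (intro sum_lessThan_split) simp
  have "\<exists>b\<in>{k..<l}. \<not> int p dvd c b"
  proof (rule ccontr)
    assume "\<not> (\<exists>b\<in>{k..<l}. \<not> int p dvd c b)"
    then have "int p dvd (\<Sum>j\<in>{k..<l}. A $$ (r, j) * c j)" for r by (intro dvd_sum dvd_mult) auto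
    then have "[(\<Sum>j<l. A $$ (r, j) * c j) = (\<Sum>j<k. A $$ (r, j) * c j)] (mod int p)" for r
      unfolding split by (simp add: cong_iff_dvd_diff)
    then have "[v r = (\<Sum>j<k. A $$ (r, j) * c j)] (mod int p)" if "r < n" for r
      using cong_trans[OF c[OF that]] by blast
    then have "v \<in> mspan n p A k" by (rule mspanI[OF vE])
    then show False using v by blast
  qed
  then obtain b where b: "b \<in> {k..<l}" "\<not> int p dvd c b" by blast
  obtain K where K: "K \<in> block_SL n k l" "\<And>r. r \<in> {k..<l} \<Longrightarrow> [c r = K $$ (r, k)] (mod int p)"
    using modular_column[where c = c and b = b, OF prime_int_p kl b] by (auto simp: column_rep_def)
  have Ac: "A \<in> carrier_mat n n" using A SL_carrier by blast
  have "mspan n p (A * K) (Suc k) \<subseteq> U"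
  proof
    fix w assume "w \<in> mspan n p (A * K) (Suc k)"
    then obtain d where wE: "w \<in> {..<n} \<rightarrow>\<^sub>E {0..int p - 1}"
      and d: "\<And>r. r < n \<Longrightarrow> [w r = (\<Sum>j<Suc k. (A * K) $$ (r, j) * d j)] (mod int p)"
      unfolding mspan_def by blast
    define u where "u = (\<lambda>r\<in>{..<n}. (\<Sum>m<k. A $$ (r, m) * (d m - d k * c m)) mod int p)"
    have "u \<in> {..<n} \<rightarrow>\<^sub>E {0..int p - 1}" using p_pos by (auto simp: u_def)
    moreover have ucong: "\<And>r. r < n \<Longrightarrow> [u r = (\<Sum>m<k. A $$ (r, m) * (d m - d k * c m))] (mod int p)"
      by (simp add: u_def cong_def)
    ultimately have "u \<in> mspan n p A k" by (rule mspanI)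
    then have uU: "u \<in> U" using U(2) by blast
    show "w \<in> U"
    proof (rule subspace_combination[OF U(1) uU v(1)])
      show "w \<in> points n" using wE by (simp add: points_def)
      fix r assume r: "r < n"
      let ?S = "\<lambda>f. \<Sum>m<k. A $$ (r, m) * f m" and ?T = "\<lambda>f. \<Sum>m\<in>{k..<l}. A $$ (r, m) * f m"
      have "[w r = ?S d + d k * ?T (\<lambda>m. K $$ (m, k))] (mod int p)"
        using d[OF r] block_SL_columns[OF Ac K(1) _ kl(2) r] kl(1)
        by (simp add: mult.commute del: index_mult_mat(1))
      also have "[?S d + d k * ?T (\<lambda>m. K $$ (m, k)) = ?S d + d k * ?T c] (mod int p)"
        by (intro cong_add cong_refl cong_scalar_left cong_sum cong_sym[OF K(2)])
      also have "?S d + d k * ?T c = ?S (\<lambda>m. d m - d k * c m) + d k * (?S c + ?T c)"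
        by (simp add: algebra_simps sum_subtractf sum_distrib_left)
      also have "[\<dots> = 1 * u r + d k * v r] (mod int p)"
        using cong_add[OF cong_sym[OF ucong[OF r]] cong_scalar_left[OF cong_sym[OF c[OF r]]], of "d k"]
        by (simp add: split)
      finally show "[w r = 1 * u r + d k * v r] (mod int p)" .
    qed
  qed
  moreover have "A * K \<in> SL n" using A K(1) mult_SL by (auto simp: block_SL_def)
  ultimately have "mspan n p (A * K) (Suc k) = U"
    using card_mspan[of "A * K" n "Suc k" p] U(4) kl p_pos by (intro card_subset_eq finU) auto
  then show ?thesis using K(1) by blast
qed

text \<open>
  After the subspace is arranged, a second block matrix multiplies the last basis vector by a unit,
  which multiplies the label by this unit.
\<close>

theorem extend_vertex:
  assumes A: "A \<in> SL n" and kl: "Suc k < l" "l \<le> n"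
    and U: "is_subspace n U" "mspan n p A k \<subseteq> U" "U \<subseteq> mspan n p A l" "card U = p ^ Suc k"
    and w: "w \<in> {1..(int p - 1) div 2}"
  shows "\<exists>K\<in>block_SL n k l. vertex n (A * K) (Suc k) = (U, w)"
proof -
  obtain K where K: "K \<in> block_SL n k l" "mspan n p (A * K) (Suc k) = U"
    using extend_mspan[OF assms(1-7)] by blast
  define B where "B = A * K"
  have B: "B \<in> SL n" using A K(1) mult_SL by (auto simp: block_SL_def B_def)
  have BU: "mspan n p B (Suc k) = U" using K(2) by (simp add: B_def)
  have sk: "Suc k \<le> n" using kl by simp
  define R where "R = frame n (Suc k) U"
  have R: "R \<in> SL n" "mspan n p R (Suc k) = mspan n p B (Suc k)"
    using frame[OF B, of "Suc k"] by (simp_all add: R_def BU)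
  define x where "x = lead (Suc k) (adj_mat R * B)"
  have x: "\<not> int p dvd x" unfolding x_def using lead_transition_unit[OF B R(1) sk R(2)] .
  then have "coprime x (int p)" using prime_int_p prime_imp_coprime coprime_commute by blast
  then obtain y where y: "[x * y = 1] (mod int p)" using cong_solve_coprime_int by blast
  have xu: "[x * (y * w) = w] (mod int p)"
    using cong_scalar_right[OF y, of w] by (simp add: mult.assoc)
  have "\<not> int p dvd y * w"
    using unsigned_id(2)[OF w] cong_dvd_iff[OF xu] dvd_mult[of "int p" "y * w" x] by blast
  then obtain M where M: "M \<in> block_SL n k l" 
    "\<And>r. r \<in> {k..<l} \<Longrightarrow> [(if r = k then y * w else 0) = M $$ (r, k)] (mod int p)"
    using modular_column[OF prime_int_p kl, of k "\<lambda>r. if r = k then y * w else 0"] kl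
    by (auto simp: column_rep_def)
  have MSL: "M \<in> SL n" using M by (simp add: block_SL_def)
  have low: "[M $$ (r, c) = 0] (mod int p)" if "c < r" "r < n" "c < Suc k" for r c
  proof (cases "c = k \<and> r < l")
    case True
    then show ?thesis using M(2)[of r] that by (simp add: cong_sym_eq)
  next
    case False
    then show ?thesis using block_SL_entry[OF M(1), of r c] that by auto
  qed
  have "[lead (Suc k) M = (\<Prod>i<Suc k. M $$ (i, i))] (mod int p)"
    using low kl by (intro lead_triangular) auto
  moreover have "(\<Prod>i<k. M $$ (i, i)) = 1"
    using block_SL_entry[OF M(1)] kl by (intro prod.neutral) auto
  ultimately have "[lead (Suc k) M = M $$ (k, k)] (mod int p)" by simp
  moreover have "[M $$ (k, k) = y * w] (mod int p)" using M(2)[of k] kl by (simp add: cong_sym_eq)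
  ultimately have e1: "[lead (Suc k) M = y * w] (mod int p)" by (rule cong_trans)
  have e2: "[lead (Suc k) (adj_mat R * (B * M)) = x * lead (Suc k) M] (mod int p)"
    unfolding x_def by (rule lead_transition[OF B MSL R(1) sk]) (use low in auto)
  have "unsigned p (lead (Suc k) (adj_mat R * (B * M))) = unsigned p w"
    by (rule unsigned_cong[OF cong_trans[OF e2 cong_trans[OF cong_scalar_left[OF e1] xu]]])
  then have "unsigned p (lead (Suc k) (adj_mat R * (B * M))) = w"
    using unsigned_id(1)[OF w] by simp
  moreover have "mspan n p (B * M) (Suc k) = U"
    unfolding BU[symmetric] by (rule mspan_mult[OF B MSL sk]) (use low in auto)
  ultimately have "vertex n (B * M) (Suc k) = (U, w)"
    by (simp add: vertex_def label_def R_def)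
  moreover have "B * M = A * (K * M)"
    unfolding B_def by (rule assoc_mult_mat) (use A K M in \<open>auto simp: block_SL_def SL_def\<close>)
  ultimately show ?thesis using block_SL_mult[OF K(1) M(1)] by metis
qed

lemma vertex_block:
  assumes "A \<in> SL n" "K \<in> block_SL n i l" "s \<le> n" "s \<le> i \<or> l \<le> s"
  shows "vertex n (A * K) s = vertex n A s"
proof (rule vertex_eq_of_qspan_eq)
  show "A * K \<in> SL n" using assms mult_SL by (auto simp: block_SL_def)
  show "qspan n (A * K) s = qspan n A s" using qspan_block assms by blast
qed fact+

lemma mspan_eq_of_vertex_eq: "vertex n A s = vertex n B s \<Longrightarrow> mspan n p A s = mspan n p B s"
  by (simp add: vertex_def)

text \<open>
  A matrix in a block with two rows adjusts the one member that may differ, without changing the other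
  members of the rational flag. This reduces the claim to the case where all members agree.
\<close>

theorem orbit_of_vertices_eq_except:
  assumes A: "A \<in> SL n" "A' \<in> SL n" and i: "0 < i" "i < n"
    and eq: "\<And>s. 0 < s \<Longrightarrow> s < n \<Longrightarrow> s \<noteq> i \<Longrightarrow> vertex n A s = vertex n A' s"
  shows "\<exists>G\<in>congruence_subgroup n p. \<forall>s\<le>n. s \<noteq> i \<longrightarrow> qspan n (G * A) s = qspan n A' s"
proof -
  obtain k where k: "i = Suc k" using i by (cases i) auto
  have meq: "mspan n p A s = mspan n p A' s" if "s \<le> n" "s \<noteq> i" for s
  proof -
    have "s = 0 \<or> s = n \<or> 0 < s \<and> s < n" using that by linarith
    then show ?thesis
      using mspan_0[OF p_pos] mspan_full[OF A(1) p_pos] mspan_full[OF A(2) p_pos]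
        mspan_eq_of_vertex_eq[OF eq[of s]] that by auto
  qed
  have "mspan n p A k \<subseteq> mspan n p A i" "mspan n p A i \<subseteq> mspan n p A (Suc i)"
    using mspan_mono k by auto
  then have "mspan n p A' k \<subseteq> mspan n p A i" "mspan n p A i \<subseteq> mspan n p A' (Suc i)"
    using meq[of k] meq[of "Suc i"] i k by auto
  then have "\<exists>K\<in>block_SL n k (Suc i). vertex n (A' * K) (Suc k) = (mspan n p A i, label n A i)"
    using extend_vertex[OF A(2) _ _ subspace_mspan[OF A(1)], of k "Suc i" i "label n A i"]
      card_mspan[OF A(1) _ p_pos, of i] label_mem[OF A(1), of i] i k by simp
  then obtain K where K: "K \<in> block_SL n k (Suc i)" "vertex n (A' * K) i = vertex n A i"
    by (auto simp: vertex_def k)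
  have AK: "A' * K \<in> SL n" using A(2) K(1) mult_SL by (auto simp: block_SL_def)
  have "vertex n A s = vertex n (A' * K) s" if "0 < s" "s < n" for s
  proof (cases "s = i")
    case False
    then have "s \<le> k \<or> Suc i \<le> s" using k by linarith
    then have "vertex n (A' * K) s = vertex n A' s"
      using vertex_block[OF A(2) K(1), of s] that by simp
    then show ?thesis using eq[OF that False] by simp
  qed (use K in simp)
  from orbit_of_vertices_eq[OF A(1) AK this] obtain G where
    G: "G \<in> congruence_subgroup n p" "\<forall>s\<le>n. qspan n (G * A) s = qspan n (A' * K) s" by blast
  moreover have "qspan n (A' * K) s = qspan n A' s" if "s \<le> n" "s \<noteq> i" for s
  proof -
    have "s \<le> k \<or> Suc i \<le> s" using k that(2) by linarith
    then show ?thesis by (rule qspan_block[OF A(2) K(1) that(1)])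
  qed
  ultimately show ?thesis by (intro bexI[of _ G]) simp_all
qed

text \<open>
  The members are adjusted one after the other in increasing dimension, by block matrices that do not
  change the smaller members.
\<close>

theorem vertices_surj:
  assumes U: "\<And>s. 0 < s \<Longrightarrow> s < n \<Longrightarrow> is_subspace n (U s) \<and> card (U s) = p ^ s \<and> w s \<in> {1..(int p - 1) div 2}"
    and chain: "\<And>s. 0 < s \<Longrightarrow> Suc s < n \<Longrightarrow> U s \<subseteq> U (Suc s)"
  shows "\<exists>A\<in>SL n. \<forall>s. 0 < s \<longrightarrow> s < n \<longrightarrow> vertex n A s = (U s, w s)"
proof -
  have "\<exists>A\<in>SL n. \<forall>s. 0 < s \<longrightarrow> s \<le> k \<longrightarrow> vertex n A s = (U s, w s)" if "k < n \<or> k = 0" for k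
    using that
  proof (induction k)
    case 0
    then show ?case using one_SL by (intro bexI[of _ "1\<^sub>m n"]) auto
  next
    case (Suc k)
    then obtain A where A: "A \<in> SL n" "\<And>s. 0 < s \<Longrightarrow> s \<le> k \<Longrightarrow> vertex n A s = (U s, w s)" by auto
    have k: "Suc k < n" using Suc.prems by simp
    have Uk: "is_subspace n (U (Suc k))" "card (U (Suc k)) = p ^ Suc k" "w (Suc k) \<in> {1..(int p - 1) div 2}"
      using U[OF _ k] by simp_all
    have "mspan n p A k \<subseteq> U (Suc k)"
    proof (cases "k = 0")
      case True
      have "\<zero>\<^bsub>coord_space F n\<^esub> = (\<lambda>r\<in>{..<n}. 0)" by (simp add: coord_space_def residue_ring_def)
      then have "(\<lambda>r\<in>{..<n}. 0) \<in> U (Suc k)"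
        using Uk vectorspace.subspace_iff[OF vectorspace_points[of n], of "U (Suc k)"] by simp
      then show ?thesis using mspan_0[OF p_pos] True by simp
    next
      case False
      then have "mspan n p A k = U k" using A(2)[of k] by (simp add: vertex_def)
      then show ?thesis using chain[of k] k False by simp
    qed
    moreover have "U (Suc k) \<subseteq> mspan n p A n"
      using mspan_full[OF A(1) p_pos] subspace_points[of "U (Suc k)" n] Uk points_def[of n] by simp
    ultimately obtain K where K: "K \<in> block_SL n k n" "vertex n (A * K) (Suc k) = (U (Suc k), w (Suc k))"
      using extend_vertex[OF A(1) k order_refl Uk(1) _ _ Uk(2,3)] by blast
    have "vertex n (A * K) s = (U s, w s)" if "0 < s" "s \<le> k" for s
      using vertex_block[OF A(1) K(1), of s] A(2)[OF that] that k by simp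
    then have "\<forall>s. 0 < s \<longrightarrow> s \<le> Suc k \<longrightarrow> vertex n (A * K) s = (U s, w s)"
      using K(2) by (auto simp: le_Suc_eq)
    moreover have "A * K \<in> SL n" using A(1) K(1) mult_SL by (auto simp: block_SL_def)
    ultimately show ?case by blast
  qed
  from this[of "n - 1"] obtain A where A: "A \<in> SL n" "\<forall>s. 0 < s \<longrightarrow> s \<le> n - 1 \<longrightarrow> vertex n A s = (U s, w s)"
    by (cases "n = 0") auto
  then show ?thesis by (intro bexI[of _ A]) auto
qed

end

section \<open>Rational flags come from integral frames\<close>

lemma qsubspace_iff:
  "subspace class_ring W (module_vec TYPE(rat) n) \<longleftrightarrow> W \<subseteq> carrier_vec n \<and> 0\<^sub>v n \<in> W \<and>
    (\<forall>u\<in>W. \<forall>v\<in>W. u + v \<in> W) \<and> (\<forall>a. \<forall>u\<in>W. a \<cdot>\<^sub>v u \<in> W)"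
proof -
  have "vectorspace class_ring (module_vec TYPE(rat) n)" by (rule vec_vs)
  from vectorspace.subspace_iff[OF this, of W] show ?thesis
    by (simp add: module_vec_simps)
qed

abbreviation "is_qsubspace n W \<equiv> subspace class_ring W (module_vec TYPE(rat) n)"

lemma qspanI:
  assumes "v \<in> carrier_vec n" "\<And>r. r < n \<Longrightarrow> v $ r = (\<Sum>j<s. of_int (A $$ (r, j)) * c j)"
  shows "v \<in> qspan n A s"
  using assms unfolding qspan_def by (intro CollectI conjI exI[of _ c]) auto

lemma qsubspace_qspan: "is_qsubspace n (qspan n A s)"
  unfolding qsubspace_iff
proof (intro conjI ballI allI)
  show "qspan n A s \<subseteq> carrier_vec n" by (auto simp: qspan_def)
  show "0\<^sub>v n \<in> qspan n A s" by (rule qspanI[where c = "\<lambda>_. 0"]) auto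
next
  fix u v assume uv: "u \<in> qspan n A s" "v \<in> qspan n A s"
  then obtain c d where "\<forall>r<n. u $ r = (\<Sum>j<s. of_int (A $$ (r, j)) * c j)"
    "\<forall>r<n. v $ r = (\<Sum>j<s. of_int (A $$ (r, j)) * d j)" by (auto simp: qspan_def)
  then show "u + v \<in> qspan n A s" using uv
    by (intro qspanI[where c = "\<lambda>j. c j + d j"]) (auto simp: qspan_def distrib_left sum.distrib)
next
  fix a u assume u: "u \<in> qspan n A s"
  then obtain c where "\<forall>r<n. u $ r = (\<Sum>j<s. of_int (A $$ (r, j)) * c j)" by (auto simp: qspan_def)
  then show "a \<cdot>\<^sub>v u \<in> qspan n A s" using u
    by (intro qspanI[where c = "\<lambda>j. a * c j"]) (auto simp: qspan_def sum_distrib_left mult_ac)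
qed

lemma qsubspace_combination:
  assumes "is_qsubspace n W" "u \<in> W" "v \<in> W" "w \<in> carrier_vec n"
    and "\<And>r. r < n \<Longrightarrow> w $ r = a * u $ r + b * v $ r"
  shows "w \<in> W"
proof -
  have uv: "u \<in> carrier_vec n" "v \<in> carrier_vec n" using assms unfolding qsubspace_iff by auto
  have "w = a \<cdot>\<^sub>v u + b \<cdot>\<^sub>v v" by (rule eq_vecI) (use assms uv in auto)
  then show ?thesis using assms unfolding qsubspace_iff by auto
qed

lemma common_denominator: "\<exists>N>0. \<forall>j<(n::nat). \<exists>z. of_int N * (c j :: rat) = of_int z"
proof (induction n)
  case (Suc n)
  then obtain N where N: "N > 0" "\<forall>j<n. \<exists>z. of_int N * c j = of_int z" by blast
  obtain a b where ab: "quotient_of (c n) = (a, b)" by (cases "quotient_of (c n)")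
  then have b: "b > 0" "c n = of_int a / of_int b"
    using quotient_of_denom_pos quotient_of_div by blast+
  have "\<exists>z. of_int (N * b) * c j = of_int z" if "j < Suc n" for j
  proof (cases "j = n")
    case True
    then show ?thesis using b by (intro exI[of _ "N * a"]) simp
  next
    case False
    then have "j < n" using that by simp
    then obtain z where "of_int N * c j = of_int z" using N(2) by blast
    then show ?thesis by (intro exI[of _ "b * z"]) (simp add: mult_ac)
  qed
  moreover have "N * b > 0" using N b by simp
  ultimately show ?case by blast
qed (auto intro: exI[of _ 1])

text \<open>
  A vector of \<open>W\<close> outside the span of the first \<open>k\<close> columns has integral coordinates after scaling. By
  Euclid's algorithm its part in the block is a multiple of a column of a block matrix.
\<close>

lemma extend_frame:
  assumes A: "A \<in> SL n" "k < n" and W: "is_qsubspace n W" "qspan n A k \<subset> W"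
  shows "\<exists>K\<in>block_SL n k n. qspan n (A * K) (Suc k) \<subseteq> W"
proof -
  obtain v where v: "v \<in> W" "v \<notin> qspan n A k" using W(2) by blast
  have Wn: "W \<subseteq> carrier_vec n" using W(1) unfolding qsubspace_iff by blast
  then have "v \<in> qspan n A n" using qspan_full[OF A(1)] v by blast
  then obtain c where c: "\<And>r. r < n \<Longrightarrow> v $ r = (\<Sum>j<n. of_int (A $$ (r, j)) * c j)" unfolding qspan_def by blast
  obtain N where N: "N > 0" "\<forall>j<n. \<exists>z. of_int N * c j = of_int z" using common_denominator by blast
  then obtain z where z: "\<And>j. j < n \<Longrightarrow> of_int N * c j = of_int (z j)" by metis
  obtain g where "column_rep n k n 0 g z" using integral_column[OF A(2) order_refl] by blast
  then obtain K where K: "K \<in> block_SL n k n" "\<And>r. r \<in> {k..<n} \<Longrightarrow> z r = g * K $$ (r, k)"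
    unfolding column_rep_def cong_0 by blast
  have Ac: "A \<in> carrier_mat n n" using A(1) by (rule SL_carrier)
  have col: "(\<Sum>j<Suc k. of_int ((A * K) $$ (r, j)) * d j)
      = (\<Sum>m<k. of_int (A $$ (r, m)) * d m) + d k * (\<Sum>m\<in>{k..<n}. of_int (A $$ (r, m)) * of_int (K $$ (m, k)))"
    if r: "r < n" for r and d :: "nat \<Rightarrow> rat"
    using block_SL_columns[OF Ac K(1) A(2) order_refl r]
    by (simp del: index_mult_mat(1) add: mult.commute)
  have gv: "rat_of_int N * v $ r = (\<Sum>m<k. rat_of_int (A $$ (r, m)) * rat_of_int (z m))
      + rat_of_int g * (\<Sum>m\<in>{k..<n}. rat_of_int (A $$ (r, m)) * rat_of_int (K $$ (m, k)))" if "r < n" for r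
  proof -
    have "rat_of_int N * v $ r = (\<Sum>j<n. rat_of_int (A $$ (r, j)) * (rat_of_int N * c j))"
      unfolding c[OF that] by (simp add: sum_distrib_left mult_ac)
    also have "\<dots> = (\<Sum>j<n. rat_of_int (A $$ (r, j)) * rat_of_int (z j))"
      using z by (intro sum.cong) auto
    also have "\<dots> = (\<Sum>m<k. rat_of_int (A $$ (r, m)) * rat_of_int (z m)) + (\<Sum>m\<in>{k..<n}. rat_of_int (A $$ (r, m)) * rat_of_int (z m))"
      using A(2) by (intro sum_lessThan_split) simp
    also have "(\<Sum>m\<in>{k..<n}. rat_of_int (A $$ (r, m)) * rat_of_int (z m))
        = (\<Sum>m\<in>{k..<n}. rat_of_int (A $$ (r, m)) * (rat_of_int g * rat_of_int (K $$ (m, k))))"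
      using K(2) by (intro sum.cong) auto
    also have "\<dots> = rat_of_int g * (\<Sum>m\<in>{k..<n}. rat_of_int (A $$ (r, m)) * rat_of_int (K $$ (m, k)))"
      by (simp add: sum_distrib_left mult_ac)
    finally show ?thesis .
  qed
  have g0: "g \<noteq> 0"
  proof
    assume "g = 0"
    then have "v $ r = (\<Sum>m<k. of_int (A $$ (r, m)) * (of_int (z m) / of_int N))" if "r < n" for r
      using gv[OF that] N(1) by (simp add: field_simps flip: sum_divide_distrib)
    moreover have "v \<in> carrier_vec n" using v Wn by blast
    ultimately have "v \<in> qspan n A k" by (intro qspanI)
    then show False using v by blast
  qed
  have "qspan n (A * K) (Suc k) \<subseteq> W"
  proof
    fix w assume "w \<in> qspan n (A * K) (Suc k)"
    then obtain d where w: "w \<in> carrier_vec n"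
      and d: "\<And>r. r < n \<Longrightarrow> w $ r = (\<Sum>j<Suc k. of_int ((A * K) $$ (r, j)) * d j)" unfolding qspan_def by blast
    define b where "b = d k / of_int g"
    define u where "u = vec n (\<lambda>r. \<Sum>m<k. of_int (A $$ (r, m)) * (d m - b * of_int (z m)))"
    have "u \<in> qspan n A k" by (rule qspanI) (auto simp: u_def)
    then have "u \<in> W" using W(2) by blast
    then show "w \<in> W"
    proof (rule qsubspace_combination[OF W(1) _ v(1) w])
      fix r assume r: "r < n"
      let ?T = "\<Sum>m\<in>{k..<n}. rat_of_int (A $$ (r, m)) * of_int (K $$ (m, k))"
      have "d k * ?T = b * (of_int g * ?T)" using g0 by (simp add: b_def)
      also have "of_int g * ?T = of_int N * v $ r - (\<Sum>m<k. of_int (A $$ (r, m)) * of_int (z m))"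
        using gv[OF r] by simp
      finally show "w $ r = 1 * u $ r + (b * of_int N) * v $ r"
        using d[OF r] col[OF r, of d] r
        by (simp add: u_def algebra_simps sum_subtractf sum_distrib_left)
    qed
  qed
  then show ?thesis using K(1) by blast
qed

lemma chain_frame:
  assumes W: "\<And>i. i \<le> m \<Longrightarrow> is_qsubspace n (W i)" and chain: "\<And>i. i < m \<Longrightarrow> W i \<subset> W (Suc i)"
  shows "k \<le> m \<Longrightarrow> k \<le> n \<Longrightarrow> \<exists>A\<in>SL n. \<forall>s\<le>k. qspan n A s \<subseteq> W s"
proof (induction k)
  case 0
  have "0\<^sub>v n \<in> W 0" using W[of 0] unfolding qsubspace_iff by simp
  then show ?case by (intro bexI[of _ "1\<^sub>m n"] one_SL) (simp add: qspan_0)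
next
  case (Suc k)
  then obtain A where A: "A \<in> SL n" "\<forall>s\<le>k. qspan n A s \<subseteq> W s" by auto
  have "qspan n A k \<subseteq> W k" "W k \<subset> W (Suc k)" using A(2) chain[of k] Suc.prems by simp_all
  then have "qspan n A k \<subset> W (Suc k)" by (rule subset_psubset_trans)
  then have "\<exists>K\<in>block_SL n k n. qspan n (A * K) (Suc k) \<subseteq> W (Suc k)"
    using Suc.prems by (intro extend_frame A(1) W) simp_all
  then obtain K where K: "K \<in> block_SL n k n" "qspan n (A * K) (Suc k) \<subseteq> W (Suc k)" by blast
  have "qspan n (A * K) s \<subseteq> W s" if "s \<le> Suc k" for s
  proof (cases "s = Suc k")
    case False
    then have "qspan n (A * K) s = qspan n A s"
      using that Suc.prems by (intro qspan_block[OF A(1) K(1)]) auto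
    then show ?thesis using A(2) that False by simp
  qed (use K in simp)
  moreover have "A * K \<in> SL n" using A(1) K(1) mult_SL by (auto simp: block_SL_def)
  ultimately show ?case by blast
qed

text \<open>
  A frame adapted to the first \<open>n\<close> steps already spans everything.
\<close>

lemma chain_length:
  assumes "\<And>i. i \<le> m \<Longrightarrow> is_qsubspace n (W i)" "\<And>i. i < m \<Longrightarrow> W i \<subset> W (Suc i)"
  shows "m \<le> n"
proof (rule ccontr)
  assume "\<not> m \<le> n"
  then obtain A where "A \<in> SL n" "qspan n A n \<subseteq> W n" using chain_frame[where W = W and m = m and n = n, OF assms, of n] by auto
  then have "carrier_vec n \<subset> W (Suc n)" using qspan_full[of A n] assms(2)[of n] \<open>\<not> m \<le> n\<close> by auto
  moreover have "W (Suc n) \<subseteq> carrier_vec n"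
    using assms(1)[of "Suc n"] \<open>\<not> m \<le> n\<close> unfolding qsubspace_iff by simp
  ultimately show False by blast
qed

lemma qspan_strict:
  assumes "A \<in> SL n" "s < n"
  shows "qspan n A s \<subset> qspan n A (Suc s)"
proof -
  have "mspan n 2 A s \<noteq> mspan n 2 A (Suc s)"
    using card_mspan[OF assms(1), of s 2] card_mspan[OF assms(1), of "Suc s" 2] assms(2) by auto
  then have "qspan n A s \<noteq> qspan n A (Suc s)"
    using reduction_qspan[OF assms(1), of s 2] reduction_qspan[OF assms(1), of "Suc s" 2] assms(2) by auto
  then show ?thesis using qspan_mono[of s "Suc s" n A] by auto
qed

lemma full_chain_frame:
  assumes W: "\<And>i. i \<le> n \<Longrightarrow> is_qsubspace n (W i)" and chain: "\<And>i. i < n \<Longrightarrow> W i \<subset> W (Suc i)"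
  shows "\<exists>A\<in>SL n. \<forall>s\<le>n. qspan n A s = W s"
proof -
  obtain A where A: "A \<in> SL n" "\<forall>s\<le>n. qspan n A s \<subseteq> W s" 
    using chain_frame[where W = W and m = n and n = n, OF assms, of n] by auto
  have "qspan n A s = W s" if s: "s \<le> n" for s
  proof (rule ccontr)
    assume "qspan n A s \<noteq> W s"
    then have "qspan n A s \<subset> W s" using A(2) s by auto
    \<comment> \<open>Otherwise the two chains combine to one that is too long.\<close>
    define T where "T i = (if i \<le> s then qspan n A i else W (i - 1))" for i
    have "Suc n \<le> n"
    proof (rule chain_length[where m = "Suc n" and n = n and W = T])
      show "is_qsubspace n (T i)" if "i \<le> Suc n" for i
        using that W qsubspace_qspan by (auto simp: T_def)
      show "T i \<subset> T (Suc i)" if "i < Suc n" for i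
      proof -
        consider "i < s" | "i = s" | "s < i" by linarith
        then show ?thesis
        proof cases
          case 1
          then show ?thesis using qspan_strict[OF A(1), of i] s by (simp add: T_def)
        next
          case 2
          then show ?thesis using \<open>qspan n A s \<subset> W s\<close> by (simp add: T_def)
        next
          case 3
          then show ?thesis using chain[of "i - 1"] that by (simp add: T_def)
        qed
      qed
    qed
    then show False by simp
  qed
  then show ?thesis using A(1) by blast
qed

subsection \<open>Simplices of the building\<close>

text \<open>
  The flag is completed by the zero space and the whole space.
\<close>

lemma tits_simplices_chain:
  assumes F: "F \<in> tits_simplices n k" and n: "n > 0"
  defines "W \<equiv> \<lambda>i. if i = 0 then {0\<^sub>v n} else if i \<le> length F then F ! (i - 1) else carrier_vec n"
  shows "is_qsubspace n (W i)" "i \<le> length F \<Longrightarrow> W i \<subset> W (Suc i)"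
proof -
  have F': "\<And>x. x \<in> set F \<Longrightarrow> is_qsubspace n x \<and> x \<noteq> {0\<^sub>v n} \<and> x \<noteq> carrier_vec n" "sorted_wrt (\<subset>) F"
    using F by (auto simp: tits_simplices_def proper_subspaces_def)
  have triv: "is_qsubspace n {0\<^sub>v n}" "is_qsubspace n (carrier_vec n)" by (auto simp: qsubspace_iff)
  have mem: "F ! j \<in> set F" if "j < length F" for j using that by simp
  show "is_qsubspace n (W i)" using F'(1) mem triv by (auto simp: W_def)
  assume i: "i \<le> length F"
  have sub: "{0\<^sub>v n} \<subseteq> x \<and> x \<subseteq> carrier_vec n" if "x \<in> set F" for x
    using F'(1)[OF that] unfolding qsubspace_iff by auto
  have "unit_vec n 0 \<noteq> (0\<^sub>v n :: rat vec)"
    using n by (metis index_unit_vec(1) index_zero_vec(1) zero_neq_one)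
  then have ne: "{0\<^sub>v n} \<subset> (carrier_vec n :: rat vec set)" by (auto intro!: unit_vec_carrier)
  consider "i = 0" "length F = 0" | "i = 0" "length F > 0" | "i > 0" "i < length F" | "i > 0" "i = length F"
    using i by linarith
  then show "W i \<subset> W (Suc i)"
  proof cases
    case 1
    then show ?thesis using ne by (simp add: W_def)
  next
    case 2
    then have "F ! 0 \<in> set F" by simp
    then have "{0\<^sub>v n} \<subset> F ! 0" using F'(1) sub by blast
    then show ?thesis using 2 by (simp add: W_def Suc_le_eq)
  next
    case 3
    then have "F ! (i - 1) \<subset> F ! i" using F'(2) by (auto simp: sorted_wrt_iff_nth_less)
    then show ?thesis using 3 by (simp add: W_def Suc_le_eq)
  next
    case 4
    then have "F ! (i - 1) \<in> set F" by simp
    then have "F ! (i - 1) \<subset> carrier_vec n" using F'(1) sub by blast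
    then show ?thesis using 4 by (simp add: W_def)
  qed
qed

lemma tits_simplices_above_dimension:
  assumes "n > 0"
  shows "tits_simplices n (int n - 1) = {}"
proof (rule ccontr)
  assume "tits_simplices n (int n - 1) \<noteq> {}"
  then obtain F where F: "F \<in> tits_simplices n (int n - 1)" by blast
  then have len: "length F = n" by (simp add: tits_simplices_def)
  let ?W = "\<lambda>i. if i = 0 then {0\<^sub>v n} else if i \<le> length F then F ! (i - 1) else carrier_vec n"
  have "Suc (length F) \<le> n"
  proof (rule chain_length[where W = ?W])
    show "is_qsubspace n (?W i)" for i by (rule tits_simplices_chain(1)[OF F assms])
    show "?W i \<subset> ?W (Suc i)" if "i < Suc (length F)" for i
      using that by (intro tits_simplices_chain(2)[OF F assms]) simp
  qed
  then have "Suc n \<le> n" using len by simp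
  then show False by simp
qed

theorem tits_simplices_top:
  assumes "n > 0"
  shows "tits_simplices n (int n - 2) = (\<lambda>A. map (qspan n A) [1..<n]) ` SL n"
proof (intro equalityI subsetI)
  fix F assume F: "F \<in> tits_simplices n (int n - 2)"
  then have len: "length F = n - 1" by (auto simp: tits_simplices_def)
  define W where "W i = (if i = 0 then {0\<^sub>v n} else if i \<le> length F then F ! (i - 1) else carrier_vec n)" for i
  have "\<exists>A\<in>SL n. \<forall>s\<le>n. qspan n A s = W s"
    using tits_simplices_chain[OF F assms] assms len by (intro full_chain_frame) (simp_all add: W_def)
  then obtain A where A: "A \<in> SL n" "\<forall>s\<le>n. qspan n A s = W s" by blast
  have "F = map (qspan n A) [1..<n]"
    by (rule nth_equalityI) (use A(2) len in \<open>auto simp: W_def\<close>)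
  then show "F \<in> (\<lambda>A. map (qspan n A) [1..<n]) ` SL n" using A(1) by blast
next
  fix F assume "F \<in> (\<lambda>A. map (qspan n A) [1..<n]) ` SL n"
  then obtain A where A: "A \<in> SL n" "F = map (qspan n A) [1..<n]" by blast
  have lt: "qspan n A s \<subset> qspan n A t" if "s < t" "t \<le> n" for s t
    using qspan_strict[OF A(1), of s] qspan_mono[of "Suc s" t n A] that by auto
  have "qspan n A s \<in> proper_subspaces n" if "1 \<le> s" "s < n" for s
    using lt[of 0 s] lt[of s n] that qsubspace_qspan qspan_0[of n A] qspan_full[OF A(1)]
    by (auto simp: proper_subspaces_def)
  moreover have "sorted_wrt (\<subset>) F"
    unfolding A(2) sorted_wrt_map by (rule sorted_wrt_mono_rel[OF _ sorted_wrt_upt]) (use lt in auto)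
  ultimately show "F \<in> tits_simplices n (int n - 2)"
    using A(2) assms by (auto simp: tits_simplices_def)
qed

section \<open>Orbits of maximal flags\<close>

lemma qspan_image:
  assumes G: "G \<in> SL n" and A: "A \<in> SL n" and s: "s \<le> n"
  shows "(\<lambda>v. map_mat rat_of_int G *\<^sub>v v) ` qspan n A s = qspan n (G * A) s"
proof -
  note Gc = SL_carrier[OF G] and Ac = SL_carrier[OF A]
  have act: "(map_mat rat_of_int G *\<^sub>v v) $ r = (\<Sum>j<s. of_int ((G * A) $$ (r, j)) * c j)"
    if "v \<in> carrier_vec n" "\<forall>r<n. v $ r = (\<Sum>j<s. of_int (A $$ (r, j)) * c j)" "r < n" for v c r
  proof -
    have "(map_mat rat_of_int G *\<^sub>v v) $ r = (\<Sum>k<n. of_int (G $$ (r, k)) * v $ k)"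
      using Gc that by (auto simp: scalar_prod_def lessThan_atLeast0 intro!: sum.cong)
    also have "\<dots> = (\<Sum>k<n. of_int (G $$ (r, k)) * (\<Sum>j<s. of_int (A $$ (k, j)) * c j))"
      using that(2) by (intro sum.cong) auto
    finally show ?thesis using sum_mult_columns[OF Gc Ac s that(3), of c] by simp
  qed
  have carr: "map_mat rat_of_int G *\<^sub>v v \<in> carrier_vec n" for v
    using Gc by (auto intro!: carrier_vecI)
  show ?thesis
  proof (intro equalityI subsetI)
    fix w assume "w \<in> (\<lambda>v. map_mat rat_of_int G *\<^sub>v v) ` qspan n A s"
    then obtain v c where v: "w = map_mat rat_of_int G *\<^sub>v v" "v \<in> carrier_vec n"
      "\<forall>r<n. v $ r = (\<Sum>j<s. of_int (A $$ (r, j)) * c j)" unfolding qspan_def by blast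
    show "w \<in> qspan n (G * A) s" unfolding v(1) by (rule qspanI[OF carr act[OF v(2,3)]])
  next
    fix w assume "w \<in> qspan n (G * A) s"
    then obtain c where w: "w \<in> carrier_vec n" "\<forall>r<n. w $ r = (\<Sum>j<s. of_int ((G * A) $$ (r, j)) * c j)"
      unfolding qspan_def by blast
    define v where "v = vec n (\<lambda>r. \<Sum>j<s. of_int (A $$ (r, j)) * c j)"
    have v: "v \<in> carrier_vec n" "\<forall>r<n. v $ r = (\<Sum>j<s. of_int (A $$ (r, j)) * c j)" by (auto simp: v_def)
    have "w = map_mat rat_of_int G *\<^sub>v v"
    proof (rule eq_vecI)
      fix r assume "r < dim_vec (map_mat rat_of_int G *\<^sub>v v)"
      then have "r < n" using Gc by simp
      then show "w $ r = (map_mat rat_of_int G *\<^sub>v v) $ r" using act[OF v] w(2) by simp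
    qed (use w(1) Gc in auto)
    moreover have "v \<in> qspan n A s" using v by (intro qspanI) auto
    ultimately show "w \<in> (\<lambda>v. map_mat rat_of_int G *\<^sub>v v) ` qspan n A s" by blast
  qed
qed

lemma flag_face_map: "flag_face i (map f xs) = map f (flag_face i xs)"
  by (simp add: flag_face_def take_map drop_map)

lemma quotient_face_orbit: "quotient_face i (flag_orbit n p F) = flag_orbit n p (flag_face i F)"
  by (simp add: quotient_face_def flag_orbit_def image_image flag_act_def flag_face_map)

lemma set_flag_face_upt: "i < n - 1 \<Longrightarrow> set (flag_face i [1..<n]) = {1..<n} - {Suc i}"
  by (auto simp: flag_face_def take_upt drop_upt)

context odd_prime begin

lemma congruence_subgroup_one: "1\<^sub>m n \<in> congruence_subgroup n p"
  by (simp add: congruence_subgroup_iff one_SL)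

lemma congruence_subgroup_closed:
  assumes "G \<in> congruence_subgroup n p" "H \<in> congruence_subgroup n p"
  shows "G * H \<in> congruence_subgroup n p"
proof -
  have SL: "G \<in> SL n" "H \<in> SL n" using assms congruence_subgroup_iff by auto
  have "[(G * H) $$ (i, j) = (1\<^sub>m n :: int mat) $$ (i, j)] (mod int p)" if "i < n" "j < n" for i j
  proof (rule cong_trans[OF congruence_subgroup_mult[OF assms(1) SL(2) that]])
    show "[H $$ (i, j) = (1\<^sub>m n :: int mat) $$ (i, j)] (mod int p)"
      using assms(2) that congruence_subgroup_iff[of H n] by blast
  qed
  then show ?thesis using mult_SL[OF SL] congruence_subgroup_iff[of "G * H" n] by blast
qed

lemma congruence_subgroup_inverse:
  assumes "G \<in> congruence_subgroup n p"
  shows "adj_mat G \<in> congruence_subgroup n p"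
proof -
  have G: "G \<in> SL n" "\<And>i j. i < n \<Longrightarrow> j < n \<Longrightarrow> [G $$ (i, j) = (1\<^sub>m n :: int mat) $$ (i, j)] (mod int p)"
    using assms congruence_subgroup_iff by auto
  note Jc = SL_carrier[OF adj_SL(1)[OF G(1)]]
  have "[adj_mat G $$ (i, j) = (1\<^sub>m n :: int mat) $$ (i, j)] (mod int p)" if ij: "i < n" "j < n" for i j
  proof -
    have "adj_mat G $$ (i, j) = (adj_mat G * 1\<^sub>m n) $$ (i, j)" using Jc by simp
    also have "\<dots> = (\<Sum>k<n. adj_mat G $$ (i, k) * (1\<^sub>m n :: int mat) $$ (k, j))"
      by (rule mult_entry[OF Jc one_carrier_mat ij])
    also have "[\<dots> = (\<Sum>k<n. adj_mat G $$ (i, k) * G $$ (k, j))] (mod int p)"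
      by (intro cong_sum cong_scalar_left cong_sym[OF G(2)]) (use ij in auto)
    also have "(\<Sum>k<n. adj_mat G $$ (i, k) * G $$ (k, j)) = (adj_mat G * G) $$ (i, j)"
      by (rule mult_entry[OF Jc SL_carrier[OF G(1)] ij, symmetric])
    finally show ?thesis unfolding adj_SL(3)[OF G(1)] .
  qed
  then show ?thesis using adj_SL(1)[OF G(1)] congruence_subgroup_iff[of "adj_mat G" n] by blast
qed

lemma congruence_subgroup_SL: "G \<in> congruence_subgroup n p \<Longrightarrow> G \<in> SL n"
  using congruence_subgroup_iff by blast

lemma flag_orbit_qspans:
  assumes "A \<in> SL n" "set ss \<subseteq> {..n}"
  shows "flag_orbit n p (map (qspan n A) ss) = (\<lambda>G. map (qspan n (G * A)) ss) ` congruence_subgroup n p"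
  unfolding flag_orbit_def flag_act_def map_map comp_def
proof (rule image_cong[OF refl])
  fix G assume "G \<in> congruence_subgroup n p"
  then have "G \<in> SL n" by (rule congruence_subgroup_SL)
  then have "(\<lambda>v. map_mat rat_of_int G *\<^sub>v v) ` qspan n A s = qspan n (G * A) s" if "s \<in> set ss" for s
    using assms that by (intro qspan_image) auto
  then show "map (\<lambda>x. (\<lambda>v. map_mat rat_of_int G *\<^sub>v v) ` qspan n A x) ss = map (qspan n (G * A)) ss"
    by (intro map_cong refl)
qed

lemma flag_orbit_eq_iff:
  assumes A: "A \<in> SL n" "A' \<in> SL n" and ss: "set ss \<subseteq> {..n}"
  shows "flag_orbit n p (map (qspan n A) ss) = flag_orbit n p (map (qspan n A') ss) \<longleftrightarrow>
    (\<exists>G\<in>congruence_subgroup n p. \<forall>s\<in>set ss. qspan n (G * A) s = qspan n A' s)"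
proof
  assume eq: "flag_orbit n p (map (qspan n A) ss) = flag_orbit n p (map (qspan n A') ss)"
  have "map (qspan n A') ss = map (qspan n (1\<^sub>m n * A')) ss" using SL_carrier[OF A(2)] by simp
  then have "map (qspan n A') ss \<in> flag_orbit n p (map (qspan n A') ss)"
    unfolding flag_orbit_qspans[OF A(2) ss] using congruence_subgroup_one by blast
  then have "map (qspan n A') ss \<in> flag_orbit n p (map (qspan n A) ss)" using eq by simp
  then obtain G where "G \<in> congruence_subgroup n p" "map (qspan n A') ss = map (qspan n (G * A)) ss"
    unfolding flag_orbit_qspans[OF A(1) ss] by blast
  then show "\<exists>G\<in>congruence_subgroup n p. \<forall>s\<in>set ss. qspan n (G * A) s = qspan n A' s"
    by (intro bexI[of _ G]) auto
next
  have sub: "flag_orbit n p (map (qspan n B') ss) \<subseteq> flag_orbit n p (map (qspan n B) ss)"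
    if B: "B \<in> SL n" "B' \<in> SL n" and H: "H \<in> congruence_subgroup n p" "\<forall>s\<in>set ss. qspan n (H * B) s = qspan n B' s"
    for B B' H
  proof
    fix F assume "F \<in> flag_orbit n p (map (qspan n B') ss)"
    then obtain G where G: "G \<in> congruence_subgroup n p" "F = map (qspan n (G * B')) ss"
      unfolding flag_orbit_qspans[OF B(2) ss] by blast
    note SL = congruence_subgroup_SL[OF G(1)] congruence_subgroup_SL[OF H(1)]
    have "qspan n (G * B') s = qspan n (G * H * B) s" if s: "s \<in> set ss" for s
    proof -
      have sn: "s \<le> n" using ss s by auto
      have "qspan n (G * B') s = (\<lambda>v. map_mat rat_of_int G *\<^sub>v v) ` qspan n (H * B) s"
        using qspan_image[OF SL(1) B(2) sn] H(2) s by simp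
      also have "\<dots> = qspan n (G * (H * B)) s" using qspan_image[OF SL(1) mult_SL[OF SL(2) B(1)] sn] .
      also have "G * (H * B) = G * H * B"
        by (rule assoc_mult_mat[symmetric, OF SL_carrier[OF SL(1)] SL_carrier[OF SL(2)] SL_carrier[OF B(1)]])
      finally show ?thesis .
    qed
    then have "F = map (qspan n (G * H * B)) ss" using G(2) by simp
    then show "F \<in> flag_orbit n p (map (qspan n B) ss)"
      unfolding flag_orbit_qspans[OF B(1) ss] using congruence_subgroup_closed[OF G(1) H(1)] by blast
  qed
  assume "\<exists>G\<in>congruence_subgroup n p. \<forall>s\<in>set ss. qspan n (G * A) s = qspan n A' s"
  then obtain G where G: "G \<in> congruence_subgroup n p" "\<forall>s\<in>set ss. qspan n (G * A) s = qspan n A' s" by blast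
  note GSL = congruence_subgroup_SL[OF G(1)]
  have "qspan n (adj_mat G * A') s = qspan n A s" if s: "s \<in> set ss" for s
  proof -
    have sn: "s \<le> n" using ss s by auto
    have "qspan n (adj_mat G * A') s = (\<lambda>v. map_mat rat_of_int (adj_mat G) *\<^sub>v v) ` qspan n (G * A) s"
      using qspan_image[OF adj_SL(1)[OF GSL] A(2) sn] G(2) s by simp
    also have "\<dots> = qspan n (adj_mat G * (G * A)) s"
      using qspan_image[OF adj_SL(1)[OF GSL] mult_SL[OF GSL A(1)] sn] .
    also have "adj_mat G * (G * A) = adj_mat G * G * A"
      by (rule assoc_mult_mat[symmetric, OF SL_carrier[OF adj_SL(1)[OF GSL]] SL_carrier[OF GSL] SL_carrier[OF A(1)]])
    also have "\<dots> = A" unfolding adj_SL(3)[OF GSL] using SL_carrier[OF A(1)] by simp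
    finally show ?thesis .
  qed
  then show "flag_orbit n p (map (qspan n A) ss) = flag_orbit n p (map (qspan n A') ss)"
    using sub[OF A G] sub[OF A(2,1) congruence_subgroup_inverse[OF G(1)]] by blast
qed

definition top_orbit :: "nat \<Rightarrow> int mat \<Rightarrow> rat vec set list set" where
  "top_orbit n A = flag_orbit n p (map (qspan n A) [1..<n])"

definition vertices :: "nat \<Rightarrow> int mat \<Rightarrow> ((nat \<Rightarrow> int) set \<times> int) list" where
  "vertices n A = map (vertex n A) [1..<n]"

lemma length_vertices [simp]: "length (vertices n A) = n - 1"
  by (simp add: vertices_def)

lemma nth_vertices [simp]: "i < n - 1 \<Longrightarrow> vertices n A ! i = vertex n A (Suc i)"
  by (simp add: vertices_def)

lemma top_orbit_eq_iff:
  assumes "A \<in> SL n" "A' \<in> SL n"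
  shows "top_orbit n A = top_orbit n A' \<longleftrightarrow> vertices n A = vertices n A'"
proof -
  have "top_orbit n A = top_orbit n A' \<longleftrightarrow>
      (\<exists>G\<in>congruence_subgroup n p. \<forall>s\<in>{1..<n}. qspan n (G * A) s = qspan n A' s)"
    unfolding top_orbit_def by (subst flag_orbit_eq_iff[OF assms]) auto
  also have "\<dots> \<longleftrightarrow> (\<forall>s\<in>{1..<n}. vertex n A s = vertex n A' s)"
  proof
    assume "\<exists>G\<in>congruence_subgroup n p. \<forall>s\<in>{1..<n}. qspan n (G * A) s = qspan n A' s"
    then obtain G where "G \<in> congruence_subgroup n p" "\<forall>s\<in>{1..<n}. qspan n (G * A) s = qspan n A' s" by blast
    then show "\<forall>s\<in>{1..<n}. vertex n A s = vertex n A' s"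
      using vertex_eq_of_orbit[OF _ assms] by simp
  next
    assume "\<forall>s\<in>{1..<n}. vertex n A s = vertex n A' s"
    then obtain G where "G \<in> congruence_subgroup n p" "\<forall>s\<le>n. qspan n (G * A) s = qspan n A' s"
      using orbit_of_vertices_eq[OF assms] by auto
    then show "\<exists>G\<in>congruence_subgroup n p. \<forall>s\<in>{1..<n}. qspan n (G * A) s = qspan n A' s"
      by (intro bexI[of _ G]) auto
  qed
  also have "\<dots> \<longleftrightarrow> vertices n A = vertices n A'" by (auto simp: vertices_def)
  finally show ?thesis .
qed

lemma face_top_orbit_eq_iff:
  assumes A: "A \<in> SL n" "A' \<in> SL n" and i: "i < n - 1"
  shows "quotient_face i (top_orbit n A) = quotient_face i (top_orbit n A') \<longleftrightarrow>
    vertices n A = (vertices n A')[i := vertices n A ! i]"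
proof -
  let ?I = "{1..<n} - {Suc i}"
  have I: "set (flag_face i [1..<n]) = ?I" using set_flag_face_upt[OF i] .
  have "quotient_face i (top_orbit n A) = quotient_face i (top_orbit n A') \<longleftrightarrow>
      (\<exists>G\<in>congruence_subgroup n p. \<forall>s\<in>?I. qspan n (G * A) s = qspan n A' s)"
  proof -
    have sub: "set (flag_face i [1..<n]) \<subseteq> {..n}" unfolding I by auto
    show ?thesis
      unfolding top_orbit_def quotient_face_orbit flag_face_map flag_orbit_eq_iff[OF A sub] I ..
  qed
  also have "\<dots> \<longleftrightarrow> (\<forall>s\<in>?I. vertex n A s = vertex n A' s)"
  proof
    assume "\<exists>G\<in>congruence_subgroup n p. \<forall>s\<in>?I. qspan n (G * A) s = qspan n A' s"
    then obtain G where "G \<in> congruence_subgroup n p" "\<forall>s\<in>?I. qspan n (G * A) s = qspan n A' s" by blast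
    then show "\<forall>s\<in>?I. vertex n A s = vertex n A' s"
      using vertex_eq_of_orbit[OF _ A] by simp
  next
    assume *: "\<forall>s\<in>?I. vertex n A s = vertex n A' s"
    have "\<exists>G\<in>congruence_subgroup n p. \<forall>s\<le>n. s \<noteq> Suc i \<longrightarrow> qspan n (G * A) s = qspan n A' s"
      by (rule orbit_of_vertices_eq_except[OF A]) (use i * in auto)
    then obtain G where "G \<in> congruence_subgroup n p" "\<forall>s\<le>n. s \<noteq> Suc i \<longrightarrow> qspan n (G * A) s = qspan n A' s"
      by blast
    then show "\<exists>G\<in>congruence_subgroup n p. \<forall>s\<in>?I. qspan n (G * A) s = qspan n A' s"
      by (intro bexI[of _ G]) auto
  qed
  also have "\<dots> \<longleftrightarrow> vertices n A = (vertices n A')[i := vertices n A ! i]"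
  proof
    assume *: "\<forall>s\<in>?I. vertex n A s = vertex n A' s"
    show "vertices n A = (vertices n A')[i := vertices n A ! i]"
    proof (rule nth_equalityI)
      fix j assume "j < length (vertices n A)"
      then show "vertices n A ! j = (vertices n A')[i := vertices n A ! i] ! j"
        using * i by (cases "j = i") auto
    qed simp
  next
    assume *: "vertices n A = (vertices n A')[i := vertices n A ! i]"
    show "\<forall>s\<in>?I. vertex n A s = vertex n A' s"
    proof
      fix s assume s: "s \<in> ?I"
      then have "vertices n A ! (s - 1) = vertices n A' ! (s - 1)"
        using arg_cong[OF *, of "\<lambda>xs. xs ! (s - 1)"] by auto
      then show "vertex n A s = vertex n A' s" using s by auto
    qed
  qed
  finally show ?thesis .
qed

text \<open>
  The two faces have members of different dimension at position \<open>i\<close>, and the dimension is visible in the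
  cardinality of the reduction.
\<close>

lemma faces_top_orbit_distinct:
  assumes A: "A \<in> SL n" "A' \<in> SL n" and ij: "i < j" "j < n - 1"
  shows "quotient_face i (top_orbit n A) \<noteq> quotient_face j (top_orbit n A')"
proof
  let ?I = "flag_face i [1..<n]" and ?J = "flag_face j [1..<n]"
  have IJ: "set ?I \<subseteq> {..n}" "set ?J \<subseteq> {..n}" using set_flag_face_upt[of i n] set_flag_face_upt[of j n] ij by auto
  assume "quotient_face i (top_orbit n A) = quotient_face j (top_orbit n A')"
  then have eq: "flag_orbit n p (map (qspan n A) ?I) = flag_orbit n p (map (qspan n A') ?J)"
    by (simp add: top_orbit_def quotient_face_orbit flag_face_map)
  have "map (qspan n (1\<^sub>m n * A)) ?I \<in> flag_orbit n p (map (qspan n A) ?I)"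
    unfolding flag_orbit_qspans[OF A(1) IJ(1)] using congruence_subgroup_one by blast
  then obtain G where G: "G \<in> congruence_subgroup n p" "map (qspan n (1\<^sub>m n * A)) ?I = map (qspan n (G * A')) ?J"
    unfolding eq flag_orbit_qspans[OF A(2) IJ(2)] by blast
  have nth: "?I ! i = Suc (Suc i)" "?J ! i = Suc i" "i < length ?I" "i < length ?J"
    using ij by (auto simp: flag_face_def nth_append min_def)
  have "qspan n A (Suc (Suc i)) = qspan n (G * A') (Suc i)"
    using arg_cong[OF G(2), of "\<lambda>xs. xs ! i"] nth SL_carrier[OF A(1)] by simp
  then have 1: "mspan n p A (Suc (Suc i)) = mspan n p (G * A') (Suc i)"
    using reduction_qspan[OF A(1), of "Suc (Suc i)" p] ij
      reduction_qspan[OF mult_SL[OF congruence_subgroup_SL[OF G(1)] A(2)], of "Suc i" p] by simp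
  have 2: "card (mspan n p A (Suc (Suc i))) = p ^ Suc (Suc i)"
    using ij by (intro card_mspan A p_pos) simp
  have 3: "card (mspan n p (G * A') (Suc i)) = p ^ Suc i"
    using ij by (intro card_mspan mult_SL congruence_subgroup_SL G A p_pos) simp
  have "p ^ Suc (Suc i) = p ^ Suc i" by (rule trans[OF 2[unfolded 1, symmetric] 3])
  then show False using p_ge_3 by simp
qed

lemma quotient_simplices_top: "n > 0 \<Longrightarrow> quotient_simplices n p (int n - 2) = top_orbit n ` SL n"
  by (simp add: quotient_simplices_def tits_simplices_top image_image top_orbit_def)

end

section \<open>Homology in the top degree\<close>

lemma lookup_simplicial_boundary:
  assumes "finite Y" "Poly_Mapping.keys x \<subseteq> Y"
  shows "Poly_Mapping.lookup (simplicial_boundary d k x) \<tau>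
    = (\<Sum>i<nat (k + 1). (-1) ^ i * (\<Sum>\<sigma>\<in>{\<sigma>\<in>Y. d i \<sigma> = \<tau>}. Poly_Mapping.lookup x \<sigma>))"
proof -
  let ?l = "Poly_Mapping.lookup"
  have "?l (simplicial_boundary d k x) \<tau>
      = (\<Sum>\<sigma>\<in>Poly_Mapping.keys x. ?l x \<sigma> * (\<Sum>i<nat (k + 1). (-1) ^ i * (if \<tau> = d i \<sigma> then 1 else 0)))"
    by (simp add: simplicial_boundary_def frag_extend_def lookup_sum)
  also have "\<dots> = (\<Sum>\<sigma>\<in>Y. ?l x \<sigma> * (\<Sum>i<nat (k + 1). (-1) ^ i * (if \<tau> = d i \<sigma> then 1 else 0)))"
    using assms by (intro sum.mono_neutral_left) (auto simp: in_keys_iff)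
  also have "\<dots> = (\<Sum>\<sigma>\<in>Y. \<Sum>i<nat (k + 1). (-1) ^ i * (if d i \<sigma> = \<tau> then ?l x \<sigma> else 0))"
    by (auto simp: sum_distrib_left intro!: sum.cong)
  also have "\<dots> = (\<Sum>i<nat (k + 1). \<Sum>\<sigma>\<in>Y. (-1) ^ i * (if d i \<sigma> = \<tau> then ?l x \<sigma> else 0))"
    by (rule sum.swap)
  also have "\<dots> = (\<Sum>i<nat (k + 1). (-1) ^ i * (\<Sum>\<sigma>\<in>{\<sigma>\<in>Y. d i \<sigma> = \<tau>}. ?l x \<sigma>))"
    using assms(1) by (simp add: sum.inter_filter flip: sum_distrib_left)
  finally show ?thesis .
qed

text \<open>
  Here each of the \<open>m\<close> faces gives a separate condition, without signs.
\<close>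

definition facewise_cycles :: "'s set \<Rightarrow> (nat \<Rightarrow> 's \<Rightarrow> 't) \<Rightarrow> nat \<Rightarrow> ('s \<Rightarrow> int) set" where
  "facewise_cycles Y d m = {f. (\<forall>\<sigma>. \<sigma> \<notin> Y \<longrightarrow> f \<sigma> = 0) \<and> (\<forall>i<m. \<forall>\<tau>. (\<Sum>\<sigma>\<in>{\<sigma>\<in>Y. d i \<sigma> = \<tau>}. f \<sigma>) = 0)}"

text \<open>
  In the top degree nothing is divided out except zero, so the homology is the group of cycles. As
  faces with different indices are never equal, the boundary vanishes facewise.
\<close>

theorem abelian_rank_top_homology:
  fixes X :: "int \<Rightarrow> 's set"
  assumes fin: "finite (X k)" and top: "X (k + 1) = {}"
    and sep: "\<And>i j \<sigma> \<sigma>'. i < j \<Longrightarrow> j < nat (k + 1) \<Longrightarrow> \<sigma> \<in> X k \<Longrightarrow> \<sigma>' \<in> X k \<Longrightarrow> d i \<sigma> \<noteq> d j \<sigma>'"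
    and D: "coordinates (facewise_cycles (X k) d (nat (k + 1))) D"
  shows "abelian_rank (reduced_simplicial_homology X d k) = enat (card D)"
proof -
  let ?G = "free_Abelian_group (X k)"
  let ?C = "facewise_cycles (X k) d (nat (k + 1))"
  let ?l = "Poly_Mapping.lookup"
  define K where "K = kernel ?G (free_Abelian_group (X (k - 1))) (simplicial_boundary d k)"
  interpret G: comm_group ?G by (rule abelian_free_Abelian_group)
  have K_iff: "x \<in> K \<longleftrightarrow> Poly_Mapping.keys x \<subseteq> X k \<and> ?l x \<in> ?C" for x
  proof (cases "Poly_Mapping.keys x \<subseteq> X k")
    case keys: True
    let ?f = "\<lambda>i \<tau>. \<Sum>\<sigma>\<in>{\<sigma>\<in>X k. d i \<sigma> = \<tau>}. ?l x \<sigma>"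
    have "x \<in> K \<longleftrightarrow> (\<forall>\<tau>. ?l (simplicial_boundary d k x) \<tau> = 0)"
      using keys by (simp add: K_def kernel_def poly_mapping_eq_iff fun_eq_iff)
    also have "\<dots> \<longleftrightarrow> (\<forall>\<tau>. (\<Sum>i<nat (k + 1). (-1) ^ i * ?f i \<tau>) = 0)"
      unfolding lookup_simplicial_boundary[OF fin keys] ..
    also have "\<dots> \<longleftrightarrow> (\<forall>i<nat (k + 1). \<forall>\<tau>. ?f i \<tau> = 0)"
    proof (intro iffI allI impI)
      fix i \<tau> assume z: "\<forall>\<tau>. (\<Sum>i<nat (k + 1). (-1) ^ i * ?f i \<tau>) = 0" and i: "i < nat (k + 1)"
      show "?f i \<tau> = 0"
      proof (cases "{\<sigma>\<in>X k. d i \<sigma> = \<tau>} = {}")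
        case False
        then obtain \<sigma> where \<sigma>: "\<sigma> \<in> X k" "d i \<sigma> = \<tau>" by blast
        have "?f j \<tau> = 0" if "j < nat (k + 1)" "j \<noteq> i" for j
        proof -
          have "d j \<sigma>' \<noteq> \<tau>" if "\<sigma>' \<in> X k" for \<sigma>'
            using sep[of i j \<sigma> \<sigma>'] sep[of j i \<sigma>' \<sigma>] \<sigma> that i \<open>j < nat (k + 1)\<close> \<open>j \<noteq> i\<close>
            by (cases "i < j") auto
          then have "{\<sigma>\<in>X k. d j \<sigma> = \<tau>} = {}" by blast
          then show ?thesis by (simp only: sum.empty)
        qed
        then have "(\<Sum>j<nat (k + 1). (-1) ^ j * ?f j \<tau>) = (-1) ^ i * ?f i \<tau>"
          using i by (subst sum.remove[of _ i]) auto
        then show ?thesis using z by simp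
      qed (simp only: sum.empty)
    qed simp
    also have "\<dots> \<longleftrightarrow> ?l x \<in> ?C" using keys by (auto simp: facewise_cycles_def in_keys_iff)
    finally show ?thesis using keys by simp
  qed (simp add: K_def kernel_def)
  have K_add: "x + y \<in> K" and K_minus: "- x \<in> K" if "x \<in> K" "y \<in> K" for x y
  proof -
    have *: "Poly_Mapping.keys x \<subseteq> X k" "Poly_Mapping.keys y \<subseteq> X k" "?l x \<in> ?C" "?l y \<in> ?C"
      using that K_iff by auto
    then have "Poly_Mapping.keys (x + y) \<subseteq> X k" using keys_add[of x y] by blast
    moreover have "?l (x + y) \<in> ?C" using *(3,4) by (auto simp: facewise_cycles_def lookup_add sum.distrib)
    ultimately show "x + y \<in> K" using K_iff by blast
    have "?l (- x) \<in> ?C" using *(3) by (auto simp: facewise_cycles_def sum_negf)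
    then show "- x \<in> K" using K_iff *(1) by simp
  qed
  have K0: "0 \<in> K" by (simp add: K_iff facewise_cycles_def)
  have subK: "subgroup K ?G"
  proof (rule G.subgroupI)
    show "K \<subseteq> carrier ?G" using K_iff by auto
    show "K \<noteq> {}" using K0 by blast
    fix x assume "x \<in> K"
    then show "inv\<^bsub>?G\<^esub> x \<in> K" using K_minus K_iff by simp
    fix y assume "y \<in> K"
    then show "x \<otimes>\<^bsub>?G\<^esub> y \<in> K" using K_add \<open>x \<in> K\<close> by simp
  qed
  define H where "H = subgroup_generated ?G K"
  have carrier_H: "carrier H = K"
    unfolding H_def by (rule subgroup.carrier_subgroup_generated_subgroup[OF subK])
  interpret H: comm_group H unfolding H_def by (rule G.abelian_subgroup_generated) (rule G.comm_group_axioms)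
  have mult_H: "monoid.mult H = (+)" by (rule ext)+ (simp add: H_def)
  define Q where "Q = H Mod {0}"
  have "subgroup {\<one>\<^bsub>H\<^esub>} H" by (rule H.triv_subgroup)
  then have "comm_group Q" unfolding Q_def by (intro H.abelian_FactGroup) (simp add: H_def)
  then interpret Q: comm_group Q .
  have carrier_Q: "carrier Q = (\<lambda>x. {x}) ` K"
    by (auto simp: Q_def FactGroup_def RCOSETS_def r_coset_def mult_H carrier_H)
  have mult_Q: "{x} \<otimes>\<^bsub>Q\<^esub> {y} = {x + y}" for x y
    by (simp add: Q_def FactGroup_def set_mult_def mult_H)
  have one_Q: "\<one>\<^bsub>Q\<^esub> = {0}" by (simp add: Q_def FactGroup_def)
  have "simplicial_boundary d (k + 1) ` carrier (free_Abelian_group (X (k + 1))) = {0}"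
    by (auto simp: top simplicial_boundary_def)
  then have "reduced_simplicial_homology X d k = Q"
    by (simp add: reduced_simplicial_homology_def Q_def H_def K_def)
  moreover have "abelian_rank Q = enat (card D)"
  proof (rule Q.abelian_rank_eq_card[where ev = "\<lambda>\<sigma> c. ?l (the_elem c) \<sigma>"])
    show "finite D" using coordinates_finite[OF D] .
    fix c assume "c \<in> carrier Q" and z: "\<And>\<sigma>. \<sigma> \<in> D \<Longrightarrow> ?l (the_elem c) \<sigma> = 0"
    then obtain x where x: "c = {x}" "x \<in> K" using carrier_Q by blast
    then have "?l x \<sigma> = 0" for \<sigma> using coordinates_zero[OF D, of "?l x"] K_iff z by simp
    then show "c = \<one>\<^bsub>Q\<^esub>" using x by (simp add: one_Q poly_mapping_eq_iff fun_eq_iff)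
  next
    fix \<sigma> assume "\<sigma> \<in> D"
    then obtain b where b: "b \<in> ?C" "\<forall>\<sigma>'\<in>D. b \<sigma>' = of_bool (\<sigma>' = \<sigma>)" using coordinates_dual[OF D] by blast
    have supp: "{\<sigma>. b \<sigma> \<noteq> 0} \<subseteq> X k" using b(1) by (auto simp: facewise_cycles_def)
    then have "?l (Abs_poly_mapping b) = b" using fin by (intro lookup_Abs_poly_mapping) (rule finite_subset)
    moreover from this have "Abs_poly_mapping b \<in> K" using b(1) supp by (auto simp: K_iff in_keys_iff)
    ultimately show "\<exists>c\<in>carrier Q. \<forall>\<sigma>'\<in>D. ?l (the_elem c) \<sigma>' = of_bool (\<sigma>' = \<sigma>)"
      using b(2) carrier_Q by (intro bexI[of _ "{Abs_poly_mapping b}"]) auto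
  qed (auto simp: carrier_Q mult_Q lookup_add)
  ultimately show ?thesis by simp
qed

section \<open>The top homology of the quotient\<close>

context labelled_flats begin

lemma flag_map_upt:
  assumes "a < b" "\<And>s. a \<le> s \<Longrightarrow> s < b \<Longrightarrow> cov (W s) (W (Suc s))"
    and "\<And>s. a < s \<Longrightarrow> s < b \<Longrightarrow> fst (x s) = W s \<and> snd (x s) \<in> L"
  shows "flag (W a) (map x [Suc a..<b]) (W b)"
  using assms
proof (induction b)
  case (Suc b)
  show ?case
  proof (cases "a = b")
    case True
    then show ?thesis using Suc.prems by simp
  next
    case False
    then have "flag (W a) (map x [Suc a..<b]) (W b)" using Suc by simp
    moreover have "map x [Suc a..<Suc b] = map x [Suc a..<b] @ [x b]" using False Suc.prems by simp
    ultimately show ?thesis using Suc.prems(2)[of b] Suc.prems(3)[of b] Suc.prems(1) False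
      by (simp add: flag_append del: upt_Suc)
  qed
qed simp

lemma flag_nth_cov:
  "flag A xs B \<Longrightarrow> i \<le> length xs \<Longrightarrow> cov ((A # map fst xs @ [B]) ! i) ((A # map fst xs @ [B]) ! Suc i)"
proof (induction xs arbitrary: A i)
  case (Cons x xs)
  then show ?case by (cases i) auto
qed simp

end

locale level = odd_prime p for p +
  fixes n :: nat
  assumes n_pos: "n > 0"
begin

abbreviation "labels \<equiv> {1..(int p - 1) div 2}"

sublocale labelled_flats p "{U. is_subspace n U}" "vectorspace.adjoin F (coord_space F n)" labels 1
proof (intro labelled_flats.intro labelled_flats_axioms.intro)
  show "flats p {U. is_subspace n U} (vectorspace.adjoin F (coord_space F n))"
    using vectorspace.flats_subspaces[OF vectorspace_points finite_F finite_points] by (simp only: card_F)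
qed (use p_ge_3 in auto)

text \<open>
  The zero subspace of \<open>F\<^sub>p\<^sup>n\<close>, the lower end of complete flags.
\<close>

definition origin :: "(nat \<Rightarrow> int) set" where
  "origin = {\<lambda>r\<in>{..<n}. 0}"

lemma mspan_origin: "mspan n p A 0 = origin"
  using mspan_0[OF p_pos] by (simp add: origin_def)

lemma subspace_origin: "is_subspace n origin"
  using subspace_mspan[OF one_SL, of n 0] by (simp add: mspan_origin)

lemma subspace_all: "is_subspace n (points n)"
  using subspace_mspan[OF one_SL, of n n] mspan_full[OF one_SL p_pos] by (simp add: points_def)

lemma card_points: "card (points n) = p ^ n * card origin"
  by (simp add: card_carrier_coord_space card_F origin_def)

lemma flag_vertices:
  assumes "A \<in> SL n"
  shows "flag origin (vertices n A) (points n)"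
proof -
  have "cov (mspan n p A s) (mspan n p A (Suc s))" if "s < n" for s
    unfolding cov_def using that subspace_mspan[OF assms] mspan_mono[of s "Suc s" n p A]
      card_mspan[OF assms _ p_pos, of s] card_mspan[OF assms _ p_pos, of "Suc s"] by simp
  then have "flag (mspan n p A 0) (map (vertex n A) [Suc 0..<n]) (mspan n p A n)"
    using n_pos label_mem[OF assms] by (intro flag_map_upt) (auto simp: vertex_def)
  then show ?thesis using mspan_full[OF assms p_pos] by (simp add: mspan_origin vertices_def points_def)
qed

lemma flag_length_top:
  assumes "flag origin xs (points n)"
  shows "length xs = n - 1"
proof -
  have "p ^ n = p ^ Suc (length xs)"
    using flag_card[OF assms] card_points by (simp add: origin_def)
  then have "n = Suc (length xs)" using power_inject_exp[OF q_gt_1] by blast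
  then show ?thesis by simp
qed

lemma flag_iff_vertices: "flag origin xs (points n) \<longleftrightarrow> xs \<in> vertices n ` SL n"
proof
  assume fl: "flag origin xs (points n)"
  note len = flag_length_top[OF fl]
  define U where "U s = (origin # map fst xs @ [points n]) ! s" for s
  define w where "w s = snd (xs ! (s - 1))" for s
  have cov: "cov (U s) (U (Suc s))" if "s < n" for s
    unfolding U_def using that len n_pos by (intro flag_nth_cov[OF fl]) auto
  have card: "card (U s) = p ^ s" if "s \<le> n" for s
    using that
  proof (induction s)
    case (Suc s)
    then show ?case using cov[of s] by (simp add: cov_def)
  qed (simp add: U_def origin_def)
  have "\<exists>A\<in>SL n. \<forall>s. 0 < s \<longrightarrow> s < n \<longrightarrow> vertex n A s = (U s, w s)"
  proof (rule vertices_surj)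
    fix s assume s: "0 < s" "s < n"
    then have "xs ! (s - 1) \<in> set xs" using len by simp
    then have "w s \<in> labels" using flag_set[OF fl, of "xs ! (s - 1)"] by (auto simp: w_def mem_Times_iff)
    moreover have "is_subspace n (U s)" using cov[of s] s by (simp add: cov_def)
    ultimately show "is_subspace n (U s) \<and> card (U s) = p ^ s \<and> w s \<in> labels" using card s by simp
  next
    fix s assume "0 < s" "Suc s < n"
    then show "U s \<subseteq> U (Suc s)" using cov[of s] by (simp add: cov_def)
  qed
  then obtain A where A: "A \<in> SL n" "\<And>s. 0 < s \<Longrightarrow> s < n \<Longrightarrow> vertex n A s = (U s, w s)" by blast
  have "vertices n A = xs"
  proof (rule nth_equalityI)
    fix i assume "i < length (vertices n A)"
    then have i: "i < n - 1" by simp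
    then show "vertices n A ! i = xs ! i"
      using A(2)[of "Suc i"] len by (simp add: U_def w_def nth_append)
  qed (simp add: len)
  then show "xs \<in> vertices n ` SL n" using A(1) by blast
qed (use flag_vertices in blast)

definition orbit_of :: "((nat \<Rightarrow> int) set \<times> int) list \<Rightarrow> rat vec set list set" where
  "orbit_of xs = top_orbit n (SOME A. A \<in> SL n \<and> vertices n A = xs)"

lemma orbit_of_vertices:
  assumes "A \<in> SL n"
  shows "orbit_of (vertices n A) = top_orbit n A"
proof -
  let ?A = "SOME B. B \<in> SL n \<and> vertices n B = vertices n A"
  have "?A \<in> SL n \<and> vertices n ?A = vertices n A" by (rule someI[of _ A]) (use assms in simp)
  then show ?thesis using top_orbit_eq_iff[of ?A n A] assms by (simp add: orbit_of_def)
qed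

abbreviation "orbits \<equiv> top_orbit n ` SL n"
abbreviation "flags \<equiv> {xs. flag origin xs (points n)}"

lemma bij_orbit_of: "bij_betw orbit_of flags orbits"
  unfolding bij_betw_def
proof
  have eq: "flags = vertices n ` SL n" using flag_iff_vertices by blast
  show "inj_on orbit_of flags"
    unfolding eq inj_on_def using orbit_of_vertices top_orbit_eq_iff by auto
  show "orbit_of ` flags = orbits"
    unfolding eq image_image using orbit_of_vertices by (intro image_cong) auto
qed

lemma finite_orbits: "finite orbits"
  using bij_betw_finite[OF bij_orbit_of] finite_flags by blast

text \<open>
  A function on orbits of maximal flags, regarded as a function on complete flags with labels.
\<close>

definition pull :: "(rat vec set list set \<Rightarrow> int) \<Rightarrow> ((nat \<Rightarrow> int) set \<times> int) list \<Rightarrow> int" where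
  "pull f xs = (if flag origin xs (points n) then f (orbit_of xs) else 0)"

text \<open>
  Replacing the member at position \<open>i\<close> in all possible ways runs through the orbits with the same
  \<open>i\<close>-th face.
\<close>

lemma sum_pull_panel:
  assumes A: "A \<in> SL n" and i: "i < n - 1"
  shows "(\<Sum>v\<in>V. pull f ((vertices n A)[i := v]))
    = (\<Sum>\<sigma>\<in>{\<sigma>\<in>orbits. quotient_face i \<sigma> = quotient_face i (top_orbit n A)}. f \<sigma>)"
proof -
  let ?g = "\<lambda>v. (vertices n A)[i := v]"
  let ?W = "{v\<in>V. flag origin (?g v) (points n)}"
  let ?T = "{\<sigma>\<in>orbits. quotient_face i \<sigma> = quotient_face i (top_orbit n A)}"
  have "(\<Sum>v\<in>V. pull f (?g v)) = (\<Sum>v\<in>?W. f (orbit_of (?g v)))"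
    unfolding pull_def using finite_V by (intro sum.inter_filter[symmetric])
  also have "\<dots> = (\<Sum>\<sigma>\<in>?T. f \<sigma>)"
  proof (rule sum.reindex_bij_betw)
    show "bij_betw (\<lambda>v. orbit_of (?g v)) ?W ?T"
      unfolding bij_betw_def
    proof
      show "inj_on (\<lambda>v. orbit_of (?g v)) ?W"
      proof (rule inj_onI)
        fix v w assume vw: "v \<in> ?W" "w \<in> ?W" "orbit_of (?g v) = orbit_of (?g w)"
        then have "?g v = ?g w"
          using inj_onD[OF bij_betw_imp_inj_on[OF bij_orbit_of] vw(3)] by simp
        then have "?g v ! i = ?g w ! i" by simp
        then show "v = w" using i by simp
      qed
      show "(\<lambda>v. orbit_of (?g v)) ` ?W = ?T"
      proof (intro equalityI subsetI)
        fix \<sigma> assume "\<sigma> \<in> (\<lambda>v. orbit_of (?g v)) ` ?W"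
        then obtain v where v: "\<sigma> = orbit_of (?g v)" "flag origin (?g v) (points n)" by blast
        then obtain B where B: "B \<in> SL n" "?g v = vertices n B" using flag_iff_vertices by blast
        have "vertices n B ! i = v" using i unfolding B(2)[symmetric] by simp
        then have "quotient_face i (top_orbit n B) = quotient_face i (top_orbit n A)"
          unfolding face_top_orbit_eq_iff[OF B(1) A i] using B(2) by simp
        then show "\<sigma> \<in> ?T" using B orbit_of_vertices v(1) by auto
      next
        fix \<sigma> assume "\<sigma> \<in> ?T"
        then obtain B where B: "B \<in> SL n" "\<sigma> = top_orbit n B"
          "quotient_face i (top_orbit n B) = quotient_face i (top_orbit n A)" by blast
        then have eq: "?g (vertices n B ! i) = vertices n B"
          using face_top_orbit_eq_iff[OF B(1) A i] by simp
        have fl: "flag origin (vertices n B) (points n)" using flag_vertices[OF B(1)] .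
        have "vertices n B ! i \<in> set (vertices n B)" using i by (intro nth_mem) simp
        then have "vertices n B ! i \<in> V" using flag_set[OF fl] by blast
        then have "vertices n B ! i \<in> ?W" using fl eq by simp
        moreover have "\<sigma> = orbit_of (?g (vertices n B ! i))"
          unfolding eq orbit_of_vertices[OF B(1)] B(2) ..
        ultimately show "\<sigma> \<in> (\<lambda>v. orbit_of (?g v)) ` ?W" by (rule rev_image_eqI)
      qed
    qed
  qed
  finally show ?thesis .
qed

lemma pull_cycles_iff:
  assumes supp: "\<And>\<sigma>. \<sigma> \<notin> orbits \<Longrightarrow> f \<sigma> = 0"
  shows "pull f \<in> cycles origin (points n) \<longleftrightarrow> f \<in> facewise_cycles orbits quotient_face (n - 1)"
proof
  assume f: "f \<in> facewise_cycles orbits quotient_face (n - 1)"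
  have "(\<Sum>v\<in>V. pull f (ys @ v # zs)) = 0" for ys zs
  proof (cases "\<exists>v. flag origin (ys @ v # zs) (points n)")
    case True
    then obtain v where v: "flag origin (ys @ v # zs) (points n)" by blast
    then obtain A where A: "A \<in> SL n" "ys @ v # zs = vertices n A" using flag_iff_vertices by blast
    have i: "length ys < n - 1" using flag_length_top[OF v] by simp
    have "ys @ u # zs = (vertices n A)[length ys := u]" for u unfolding A(2)[symmetric] by simp
    then have "(\<Sum>v\<in>V. pull f (ys @ v # zs)) = (\<Sum>v\<in>V. pull f ((vertices n A)[length ys := v]))" by simp
    also have "\<dots> = 0" unfolding sum_pull_panel[OF A(1) i] using f i by (simp add: facewise_cycles_def)
    finally show ?thesis .
  next
    case False
    then have "\<not> flag origin (ys @ v # zs) (points n)" for v by blast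
    then have "pull f (ys @ v # zs) = 0" for v unfolding pull_def by (rule if_not_P)
    then show ?thesis by (simp only: sum.neutral_const)
  qed
  then show "pull f \<in> cycles origin (points n)" by (simp add: cycles_def pull_def)
next
  assume c: "pull f \<in> cycles origin (points n)"
  have "(\<Sum>\<sigma>\<in>{\<sigma>\<in>orbits. quotient_face i \<sigma> = \<tau>}. f \<sigma>) = 0" if i: "i < n - 1" for i \<tau>
  proof (cases "{\<sigma>\<in>orbits. quotient_face i \<sigma> = \<tau>} = {}")
    case False
    then obtain A where A: "A \<in> SL n" "\<tau> = quotient_face i (top_orbit n A)" by blast
    have "(\<Sum>v\<in>V. pull f ((vertices n A)[i := v])) = (\<Sum>v\<in>V. pull f (take i (vertices n A) @ v # drop (Suc i) (vertices n A)))"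
      using i by (simp add: upd_conv_take_nth_drop)
    also have "\<dots> = 0" using c by (simp add: cycles_def)
    finally show ?thesis unfolding A(2) sum_pull_panel[OF A(1) i] .
  qed (simp only: sum.empty)
  then show "f \<in> facewise_cycles orbits quotient_face (n - 1)"
    using supp by (simp add: facewise_cycles_def)
qed

lemma coordinates_orbits:
  assumes D: "coordinates (cycles origin (points n)) D" "D \<subseteq> flags"
  shows "coordinates (facewise_cycles orbits quotient_face (n - 1)) (orbit_of ` D)"
  unfolding coordinates_def
proof (intro conjI ballI allI impI)
  show "finite (orbit_of ` D)" using coordinates_finite[OF D(1)] by simp
next
  fix f \<sigma> assume f: "f \<in> facewise_cycles orbits quotient_face (n - 1)" and z: "\<forall>d\<in>orbit_of ` D. f d = 0"
  have supp: "f \<sigma> = 0" if "\<sigma> \<notin> orbits" for \<sigma> using f that by (simp add: facewise_cycles_def)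
  have c: "pull f \<in> cycles origin (points n)" using pull_cycles_iff[of f] supp f by blast
  have z': "pull f xs = 0" for xs
    by (rule coordinates_zero[OF D(1) c]) (use z in \<open>simp add: pull_def\<close>)
  show "f \<sigma> = 0"
  proof (cases "\<sigma> \<in> orbits")
    case True
    then obtain A where A: "A \<in> SL n" "\<sigma> = top_orbit n A" by blast
    then show ?thesis
      using z'[of "vertices n A"] flag_vertices[OF A(1)] orbit_of_vertices[OF A(1)] by (simp add: pull_def)
  qed (use supp in simp)
next
  fix d assume "d \<in> orbit_of ` D"
  then obtain xs where xs: "xs \<in> D" "d = orbit_of xs" by blast
  obtain b where b: "b \<in> cycles origin (points n)" "\<forall>x\<in>D. b x = of_bool (x = xs)"
    using coordinates_dual[OF D(1) xs(1)] by blast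
  define f where "f \<sigma> = (if \<sigma> \<in> orbits then b (the_inv_into flags orbit_of \<sigma>) else 0)" for \<sigma>
  note inj = bij_betw_imp_inj_on[OF bij_orbit_of]
  have f_orbit: "f (orbit_of x) = b x" if "x \<in> flags" for x
    using that the_inv_into_f_f[OF inj that] bij_betwE[OF bij_orbit_of] by (simp add: f_def)
  have "pull f = b"
  proof
    fix x show "pull f x = b x"
      using f_orbit[of x] b(1) by (simp add: pull_def cycles_def)
  qed
  then have "f \<in> facewise_cycles orbits quotient_face (n - 1)"
    using pull_cycles_iff[of f] b(1) by (simp add: f_def)
  moreover have "f \<sigma> = of_bool (\<sigma> = d)" if "\<sigma> \<in> orbit_of ` D" for \<sigma>
  proof -
    from that obtain x where x: "x \<in> D" "\<sigma> = orbit_of x" by blast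
    have "\<sigma> = d \<longleftrightarrow> x = xs" unfolding x(2) xs(2) using inj_on_eq_iff[OF inj] x(1) xs(1) D(2) by blast
    moreover have "f \<sigma> = b x" unfolding x(2) by (rule f_orbit) (use x D(2) in blast)
    ultimately show ?thesis using b(2) x(1) by simp
  qed
  ultimately show "\<exists>b\<in>facewise_cycles orbits quotient_face (n - 1). \<forall>x\<in>orbit_of ` D. b x = of_bool (x = d)"
    by blast
qed

theorem abelian_rank_tits_quotient:
  assumes g: "\<And>m k. g m k * (\<Prod>i<k. p ^ k - p ^ i) = (\<Prod>i<k. p ^ m - p ^ i)"
  shows "abelian_rank (tits_quotient_homology n p (int n - 2)) = enat (top_rank p ((p - 1) div 2) g n)"
proof -
  have "origin \<subseteq> points n" using mspan_points[of n "1\<^sub>m n" 0] by (simp add: mspan_origin)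
  then obtain D where D: "coordinates (cycles origin (points n)) D" "D \<subseteq> flags"
    "card D = top_rank p (card labels) g n"
    using coordinates_cycles[OF g _ _ _ card_points n_pos] subspace_origin subspace_all by auto
  have X: "quotient_simplices n p (int n - 2) = orbits" using quotient_simplices_top[OF n_pos] .
  have m: "nat (int n - 2 + 1) = n - 1" by simp
  have "abelian_rank (tits_quotient_homology n p (int n - 2)) = enat (card (orbit_of ` D))"
    unfolding tits_quotient_homology_def
  proof (rule abelian_rank_top_homology)
    show "finite (quotient_simplices n p (int n - 2))" unfolding X by (rule finite_orbits)
    show "quotient_simplices n p (int n - 2 + 1) = {}"
      using tits_simplices_above_dimension[OF n_pos] by (simp add: quotient_simplices_def)
    show "quotient_face i \<sigma> \<noteq> quotient_face j \<sigma>'"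
      if "i < j" "j < nat (int n - 2 + 1)" "\<sigma> \<in> quotient_simplices n p (int n - 2)"
        "\<sigma>' \<in> quotient_simplices n p (int n - 2)" for i j \<sigma> \<sigma>'
      using that faces_top_orbit_distinct unfolding X m by blast
    show "coordinates (facewise_cycles (quotient_simplices n p (int n - 2)) quotient_face (nat (int n - 2 + 1))) (orbit_of ` D)"
      unfolding X m by (rule coordinates_orbits[OF D(1,2)])
  qed
  also have "card (orbit_of ` D) = card D"
    using inj_on_subset[OF bij_betw_imp_inj_on[OF bij_orbit_of] D(2)] by (rule card_image)
  also have "card labels = (p - 1) div 2" using p_pos by simp
  then have "card D = top_rank p ((p - 1) div 2) g n" using D(3) by simp
  finally show ?thesis .
qed

end

lemma top_rank_1: "top_rank q m g 1 = g 0 0"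
  by (simp add: top_rank.simps)

text \<open>
  The terms \<open>k = 0\<close> and \<open>k = n - 1\<close> of the uniform recursion give the summands with \<open>t (n - 1)\<close>.
\<close>

lemma top_rank_rec:
  assumes g: "g (n - 1) 0 = 1" "g (n - 1) (n - 1) = 1" and n: "n \<ge> 2"
  shows "top_rank q m g n = ((m - 1) + m * q ^ (n - 1)) * top_rank q m g (n - 1)
    + m * (m - 1) * (\<Sum>k=1..n - 2. q ^ k * g (n - 1) k * top_rank q m g k * top_rank q m g (n - k - 1))"
proof -
  let ?t = "top_rank q m g"
  define f where "f k = q ^ k * g (n - 1) k *
     ((if k = 0 then 1 else m * ?t k) * (if k = n - 1 then 1 else (m - 1) * ?t (n - 1 - k)))" for k
  have ne: "0 \<notin> insert (n - 1) {1..n - 2}" "n - 1 \<notin> {1..n - 2}" using n by auto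
  have "?t n = (\<Sum>k<n. f k)" by (subst top_rank.simps) (simp add: f_def)
  also have "{..<n} = insert 0 (insert (n - 1) {1..n - 2})" using n by auto
  also have "(\<Sum>k\<in>\<dots>. f k) = f 0 + (f (n - 1) + (\<Sum>k=1..n - 2. f k))" 
    by (subst sum.insert[OF _ ne(1)], simp, subst sum.insert[OF _ ne(2)], simp, rule refl)
  also have "f 0 = (m - 1) * ?t (n - 1)" using g n by (simp add: f_def)
  also have "f (n - 1) = q ^ (n - 1) * (m * ?t (n - 1))" using g n by (simp add: f_def)
  also have "(\<Sum>k=1..n - 2. f k) = (\<Sum>k=1..n - 2. m * (m - 1) * (q ^ k * g (n - 1) k * ?t k * ?t (n - k - 1)))"
  proof (intro sum.cong refl)
    fix k assume "k \<in> {1..n - 2}"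
    then have "k \<noteq> 0" "k \<noteq> n - 1" "n - 1 - k = n - k - 1" using n by auto
    then show "f k = m * (m - 1) * (q ^ k * g (n - 1) k * ?t k * ?t (n - k - 1))"
      unfolding f_def by (simp only: if_False mult_ac)
  qed
  finally show ?thesis by (simp add: sum_distrib_left algebra_simps)
qed

theorem theorem3:
  fixes p :: nat
  assumes "prime p" and "p \<ge> 3"
  shows "\<exists>t :: nat \<Rightarrow> nat.
    (\<forall>n\<ge>1. abelian_rank (tits_quotient_homology n p (int n - 2)) = enat (t n)) \<and>
    t 1 = 1 \<and>
    (\<forall>n\<ge>2. real (t n) =
      ((real p - 3) / 2 + (real p - 1) / 2 * real p ^ (n - 1)) * real (t (n - 1)) +
      (real p - 1) * (real p - 3) / 4 *
        (\<Sum>k=1..n - 2. real p ^ k *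
          real (card (grassmannian (residue_ring (int p)) (coord_space (residue_ring (int p)) (n - 1)) k)) *
          real (t k) * real (t (n - k - 1))))"
proof -
  interpret odd_prime p by unfold_locales fact+
  define g where "g n k = card (grassmannian F (coord_space F n) k)" for n k
  define m where "m = (p - 1) div 2"
  let ?t = "top_rank p m g"
  have g: "g n k * (\<Prod>i<k. p ^ k - p ^ i) = (\<Prod>i<k. p ^ n - p ^ i)" for n k
    unfolding g_def
    using card_grassmannian[OF vectorspace_points finite_F finite_points, of n n k]
    by (simp add: card_carrier_coord_space card_F)
  have g0: "g n 0 = 1" for n using g[of n 0] by simp
  have gn: "g n n = 1" for n
  proof -
    have "(\<Prod>i<n. p ^ n - p ^ i) \<noteq> 0" using p_ge_3 by auto
    then show ?thesis using g[of n n] by simp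
  qed
  have "odd p" using assms prime_odd_nat by auto
  then have m: "real m = (real p - 1) / 2" "real (m - 1) = (real p - 3) / 2"
    using p_ge_3 by (auto simp: m_def elim!: oddE)
  have h1: "abelian_rank (tits_quotient_homology n p (int n - 2)) = enat (?t n)" if "n \<ge> 1" for n
  proof -
    interpret level p n by unfold_locales (use that in simp)
    show ?thesis unfolding m_def by (rule abelian_rank_tits_quotient[OF g])
  qed
  have h2: "?t 1 = 1" using top_rank_1 g0 by simp
  have h3: "real (?t n) =
      ((real p - 3) / 2 + (real p - 1) / 2 * real p ^ (n - 1)) * real (?t (n - 1)) +
      (real p - 1) * (real p - 3) / 4 *
        (\<Sum>k=1..n - 2. real p ^ k * real (g (n - 1) k) * real (?t k) * real (?t (n - k - 1)))" if "n \<ge> 2" for n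
  proof -
    have "real (?t n) = (real (m - 1) + real m * real p ^ (n - 1)) * real (?t (n - 1))
      + real m * real (m - 1) * (\<Sum>k=1..n - 2. real p ^ k * real (g (n - 1) k) * real (?t k) * real (?t (n - k - 1)))"
      unfolding top_rank_rec[where g = g and n = n and q = p and m = m, OF g0 gn that] by simp
    then show ?thesis unfolding m by simp
  qed
  show ?thesis
    unfolding g_def[symmetric] by (intro exI[of _ ?t] conjI allI impI h1 h2 h3)
qed

end
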